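(* Every tile of a subdivisible quadrilateral tiling of the torus $T^2$ is one of $Q$, $Q_{13}$, $Q_{13,24}$. Moreover, a quadrilateral tiling of the torus is (pentagonally) subdivisible if and only if one of the following holds: (1) all tiles are $Q$ or $Q_{13}$, and the two fundamental cycles $a,b$ of the torus (generators of $\pi_1T^2$) are represented by cycles (closed edge paths) in the tiling with an even number of edges; (2) $Q_{13,24}$ is a tile.
   Context: A tiling of a compact connected surface without boundary is a graph embedded in the surface such that the complementary regions (tiles) are open disks; tilings are edge-to-edge, every vertex has degree at least $3$, every tile has at least $3$ edges, and tiles may be degenerate (their boundary need not be a simple closed curve). A quadrilateral tiling has $4$ edges along the boundary of each tile. Label the four corners of a quadrilateral tile cyclically $1,2,3,4$. $Q$ denotes a non-degenerate quadrilateral tile. $Q_{13}$ denotes the tile in which corners $1$ and $3$ are the same vertex and there are no other identifications of vertices or edges. $Q_{13,24}$ denotes the tile in which corners $1,3$ are one vertex, corners $2,4$ are another vertex (distinct from the first), and no edges are identified. A simple pentagonal subdivision of a quadrilateral tiling is obtained by placing a new vertex at the middle point of every edge and, inside each tile, joining by an arc the middle points of one of the two pairs of opposite edges of the tile, such that the middle point of each edge is used exactly once. A quadrilateral tiling is (pentagonally) subdivisible if it admits a simple pentagonal subdivision. *)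

theory Defs
  imports "HOL-Analysis.Analysis"
begin

definition torus :: "(complex \<times> complex) set" where
  "torus = sphere 0 1 \<times> sphere 0 1"

section \<open>Embedded graphs and tilings\<close>

text \<open>An edge of an embedded graph is a point set: a simple arc, or a simple closed curve (a loop of
  the graph), that meets the vertex set exactly in its end points.\<close>

definition traverses :: "'a::topological_space set \<Rightarrow> 'a set \<Rightarrow> (real \<Rightarrow> 'a) \<Rightarrow> bool" where
  "traverses V e p \<longleftrightarrow>
     simple_path p \<and> path_image p = e \<and> e \<inter> V = {pathstart p, pathfinish p}"

definition embedded_graph :: "'a::topological_space set \<Rightarrow> 'a set \<Rightarrow> 'a set set \<Rightarrow> bool" where
  "embedded_graph S V E \<longleftrightarrow>
     finite V \<and> V \<subseteq> S \<and>
     finite E \<and> \<Union>E \<subseteq> S \<and> (\<forall>e\<in>E. \<exists>p. traverses V e p) \<and>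
     (\<forall>e\<in>E. \<forall>e'\<in>E. e \<noteq> e' \<longrightarrow> e \<inter> e' \<subseteq> V)"

text \<open>Loops count twice.\<close>

definition degree :: "'a set \<Rightarrow> 'a set set \<Rightarrow> 'a \<Rightarrow> nat" where
  "degree V E v = (\<Sum>e\<in>{e\<in>E. v \<in> e}. if e \<inter> V = {v} then 2 else 1)"

definition tiles :: "'a::topological_space set \<Rightarrow> 'a set \<Rightarrow> 'a set set \<Rightarrow> 'a set set" where
  "tiles S V E = components (S - (V \<union> \<Union>E))"

text \<open>The closed unit disk is regarded as an \<open>n\<close>-gon whose corners are the \<open>n\<close>-th roots of unity.
  The open side \<open>k\<close> runs from corner \<open>k\<close> to corner \<open>k + 1\<close>; indices matter only modulo \<open>n\<close>.\<close>

definition corner :: "nat \<Rightarrow> nat \<Rightarrow> complex" where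
  "corner n k = cis (2 * pi * real k / real n)"

definition side :: "nat \<Rightarrow> nat \<Rightarrow> complex set" where
  "side n k = cis ` {2 * pi * real k / real n <..< 2 * pi * real (k + 1) / real n}"

text \<open>A tile \<open>t\<close> may be degenerate, so the number of edges along its boundary is not the number of
  edges in its frontier: an edge with \<open>t\<close> on both sides is met twice. The boundary is therefore
  described by a map of the closed \<open>n\<close>-gon that is a homeomorphism from the interior onto
  \<open>t\<close> and runs along one open edge on each open side. Such a map also labels the
  corners of \<open>t\<close> cyclically; another map may rotate or reflect the labels.\<close>

definition polygon_map ::
    "'a::topological_space set \<Rightarrow> 'a set set \<Rightarrow> 'a set \<Rightarrow> nat \<Rightarrow> (complex \<Rightarrow> 'a) \<Rightarrow> bool" where
  "polygon_map V E t n f \<longleftrightarrow>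
     continuous_on (cball 0 1) f \<and>
     (\<exists>g. homeomorphism (ball 0 1) t f g) \<and>
     (\<forall>k\<in>{1..n}. f (corner n k) \<in> V) \<and>
     (\<forall>k\<in>{1..n}. \<exists>e\<in>E. \<exists>g. homeomorphism (side n k) (e - V) f g)"

definition tiling :: "'a::topological_space set \<Rightarrow> 'a set \<Rightarrow> 'a set set \<Rightarrow> bool" where
  "tiling S V E \<longleftrightarrow>
     embedded_graph S V E \<and>
     (\<forall>v\<in>V. degree V E v \<ge> 3) \<and>
     (\<forall>t\<in>tiles S V E. t homeomorphic ball (0::complex) 1 \<and> (\<exists>n\<ge>3. \<exists>f. polygon_map V E t n f))"

definition quadrilateral_tiling :: "'a::topological_space set \<Rightarrow> 'a set \<Rightarrow> 'a set set \<Rightarrow> bool" where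
  "quadrilateral_tiling S V E \<longleftrightarrow>
     tiling S V E \<and> (\<forall>t\<in>tiles S V E. \<exists>f. polygon_map V E t 4 f)"

section \<open>Types of quadrilateral tiles\<close>

definition corner_identifications :: "(complex \<Rightarrow> 'a) \<Rightarrow> (nat \<times> nat) set" where
  "corner_identifications f =
     {(i, j). 1 \<le> i \<and> i < j \<and> j \<le> 4 \<and> f (corner 4 i) = f (corner 4 j)}"

definition edge_identifications :: "(complex \<Rightarrow> 'a) \<Rightarrow> (nat \<times> nat) set" where
  "edge_identifications f =
     {(i, j). 1 \<le> i \<and> i < j \<and> j \<le> 4 \<and> f ` side 4 i = f ` side 4 j}"

text \<open>The labels of the corners are at our disposal, hence the existential quantifier over \<open>f\<close>: a
  tile whose corners 2 and 4 are the only identified ones is also of type \<open>Q13\<close>.\<close>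

definition tile_of_type ::
    "'a::topological_space set \<Rightarrow> 'a set set \<Rightarrow> (nat \<times> nat) set \<Rightarrow> 'a set \<Rightarrow> bool" where
  "tile_of_type V E I t \<longleftrightarrow>
     (\<exists>f. polygon_map V E t 4 f \<and> corner_identifications f = I \<and> edge_identifications f = {})"

abbreviation tile_Q :: "'a::topological_space set \<Rightarrow> 'a set set \<Rightarrow> 'a set \<Rightarrow> bool" where
  "tile_Q V E \<equiv> tile_of_type V E {}"

abbreviation tile_Q13 :: "'a::topological_space set \<Rightarrow> 'a set set \<Rightarrow> 'a set \<Rightarrow> bool" where
  "tile_Q13 V E \<equiv> tile_of_type V E {(1, 3)}"

abbreviation tile_Q13_24 :: "'a::topological_space set \<Rightarrow> 'a set set \<Rightarrow> 'a set \<Rightarrow> bool" where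
  "tile_Q13_24 V E \<equiv> tile_of_type V E {(1, 3), (2, 4)}"

section \<open>Simple pentagonal subdivisions\<close>

text \<open>The arc is drawn in the closed quadrilateral and then mapped to the surface, so that it
  leaves and enters the tile through two opposite sides even if these are glued to something else
  (or to each other).\<close>

definition joins_opposite_sides ::
    "'a::topological_space set \<Rightarrow> 'a set set \<Rightarrow> 'a set \<Rightarrow> 'a set \<Rightarrow> (real \<Rightarrow> 'a) \<Rightarrow> bool" where
  "joins_opposite_sides V E M t c \<longleftrightarrow>
     (\<exists>f k p. polygon_map V E t 4 f \<and> arc p \<and> p ` {0<..<1} \<subseteq> ball 0 1 \<and>
        pathstart p \<in> side 4 k \<and> pathfinish p \<in> side 4 (k + 2) \<and>
        c = f \<circ> p \<and> pathstart c \<in> M \<and> pathfinish c \<in> M)"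

text \<open>\<open>m e\<close> is the new vertex on the edge \<open>e\<close>; topologically, a middle point is any interior point.
  It is used once for every end of an arc \<open>c t\<close> that lies at \<open>m e\<close>, so an arc
  joining the middle point of an edge to itself uses it twice.\<close>

definition simple_pentagonal_subdivision ::
    "'a::topological_space set \<Rightarrow> 'a set \<Rightarrow> 'a set set \<Rightarrow> ('a set \<Rightarrow> 'a) \<Rightarrow> ('a set \<Rightarrow> real \<Rightarrow> 'a) \<Rightarrow> bool"
  where
  "simple_pentagonal_subdivision S V E m c \<longleftrightarrow>
     (\<forall>e\<in>E. m e \<in> e - V) \<and>
     (\<forall>t\<in>tiles S V E. joins_opposite_sides V E (m ` E) t (c t)) \<and>
     (\<forall>e\<in>E. card {(t, s). t \<in> tiles S V E \<and> s \<in> {0, 1} \<and> c t s = m e} = 1)"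

definition subdivisible :: "'a::topological_space set \<Rightarrow> 'a set \<Rightarrow> 'a set set \<Rightarrow> bool" where
  "subdivisible S V E \<longleftrightarrow> (\<exists>m c. simple_pentagonal_subdivision S V E m c)"

section \<open>Edge paths and generators of the fundamental group\<close>

inductive edge_path ::
    "'a::topological_space set \<Rightarrow> 'a set set \<Rightarrow> nat \<Rightarrow> (real \<Rightarrow> 'a) \<Rightarrow> bool"
  for V E where
  trivial: "v \<in> V \<Longrightarrow> edge_path V E 0 (\<lambda>_. v)"
| step: "edge_path V E n p \<Longrightarrow> e \<in> E \<Longrightarrow> traverses V e q \<Longrightarrow> pathfinish p = pathstart q \<Longrightarrow>
         edge_path V E (Suc n) (p +++ q)"

text \<open>The based loops whose class lies in the subgroup generated by the classes of \<open>G\<close>.\<close>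

inductive generated_loop ::
    "'a::topological_space set \<Rightarrow> (real \<Rightarrow> 'a) set \<Rightarrow> (real \<Rightarrow> 'a) \<Rightarrow> bool"
  for S G where
  generator: "g \<in> G \<Longrightarrow> generated_loop S G g"
| inverse: "generated_loop S G p \<Longrightarrow> generated_loop S G (reversepath p)"
| product: "generated_loop S G p \<Longrightarrow> generated_loop S G q \<Longrightarrow> generated_loop S G (p +++ q)"
| homotopic: "generated_loop S G p \<Longrightarrow> homotopic_paths S p q \<Longrightarrow> generated_loop S G q"

definition loop_at :: "'a::topological_space set \<Rightarrow> 'a \<Rightarrow> (real \<Rightarrow> 'a) \<Rightarrow> bool" where
  "loop_at S x p \<longleftrightarrow> path p \<and> path_image p \<subseteq> S \<and> pathstart p = x \<and> pathfinish p = x"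

definition generate_pi1 ::
    "'a::topological_space set \<Rightarrow> (real \<Rightarrow> 'a) \<Rightarrow> (real \<Rightarrow> 'a) \<Rightarrow> bool" where
  "generate_pi1 S a b \<longleftrightarrow>
     (\<exists>x. loop_at S x a \<and> loop_at S x b \<and> (\<forall>p. loop_at S x p \<longrightarrow> generated_loop S {a, b} p))"

text \<open>The base point of \<open>a\<close> need not be a vertex, so a loop is represented up to free homotopy; on
  the torus, whose fundamental group is abelian, nothing is lost by this.\<close>

definition represented_by_even_cycle ::
    "'a::topological_space set \<Rightarrow> 'a set \<Rightarrow> 'a set set \<Rightarrow> (real \<Rightarrow> 'a) \<Rightarrow> bool" where
  "represented_by_even_cycle S V E a \<longleftrightarrow>
     (\<exists>n p. even n \<and> edge_path V E n p \<and> pathfinish p = pathstart p \<and> homotopic_loops S a p)"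

end

(* The key notion is bipartiteness: the vertices have a proper 2-colouring. Given one, orient each
   edge from the first colour to the second. The boundary of a tile runs alternately along and against
   its edges, and, the torus being orientable, the two sides of an edge run in opposite directions.
   Selecting the sides that run along their edge gives a simple pentagonal subdivision; conversely, the
   selected sides of a subdivision orient the edges so that every vertex is a source or a sink. So a
   tiling is subdivisible iff it is bipartite, and in a bipartite tiling no tile has glued edges and
   only opposite corners can be identified.

   Bipartite means that all closed edge paths are even. A closed edge path in the plane is even because
   its winding number function jumps across an edge by the number of traversals and every tile has four
   sides. Hence the parity of a closed edge path on the torus only depends on its displacement in the
   lattice of deck transformations, and it suffices to know it on generators: on two generators of the
   fundamental group, or on the two diagonals of a tile of type Q13_24, which cross exactly once and
   therefore generate the lattice.

   That an edge has exactly two sides, running in opposite directions, is read off the jumps of winding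
   numbers of lifted tile boundaries. *)
theory Submission
  imports Defs "HOL-Complex_Analysis.Complex_Analysis"
begin

section \<open>Winding numbers of polygon boundaries\<close>

text \<open>The data are purely topological: edges are arbitrary arcs or loops, and polygon maps are
  injective only on the open polygon and on each single open side, and carry no orientation. In the
  universal cover the orientation of the plane gives every lifted tile a sign, and sides of
  different tiles and of one degenerate tile can be treated alike. No local normal form of an edge
  is at hand. It is replaced by the winding number of the lifted edge itself. An edge is not closed
  in the plane in general, so this number need not be an integer; only its jump from one side to the
  other is used. The jump is 1 or -1, and three sides would need three pairwise opposite signs. That
  one side is not enough is a separate matter, settled by invariance of domain. Intersection numbers
  are avoided in the same spirit: to see that diagonals crossing once generate the lattice, the
  plane is divided by one period, and an exponential turns the resulting cylinder into the punctured
  plane. The degree condition excludes a tile folded along two consecutive sides, which the colours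
  alone would permit.\<close>

lemma winding_number_translate:
  "winding_number (\<lambda>s. p s + c) (z + c) = winding_number p z"
  by (subst (1 2) winding_number_offset) (simp add: algebra_simps)

definition arcp :: "real \<Rightarrow> real \<Rightarrow> real \<Rightarrow> complex" where
  "arcp a b = (\<lambda>s. cis (a + s * (b - a)))"

lemma path_arcp [simp]: "path (arcp a b)"
  unfolding path_def arcp_def by (intro continuous_intros)

lemma arcp_ends [simp]: "pathstart (arcp a b) = cis a" "pathfinish (arcp a b) = cis b"
  by (auto simp: arcp_def pathstart_def pathfinish_def)

lemma path_image_arcp_sphere: "path_image (arcp a b) \<subseteq> sphere 0 1"
  by (auto simp: path_image_def arcp_def)

lemma cis_add_2pi [simp]: "cis (a + 2 * pi) = cis a" "cis (2 * pi + a) = cis a"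
  by (simp_all add: complex_eq_iff cos_add sin_add)

text \<open>The contraction happens in the domain: \<open>p\<close> shrinks to its starting point
  inside the convex set \<open>K\<close>, and \<open>g\<close> carries this homotopy into the
  complement of \<open>w\<close>. The shape of the image of \<open>K\<close> is irrelevant.\<close>

lemma winding_number_null_convex:
  fixes g :: "complex \<Rightarrow> complex"
  assumes "convex K" "continuous_on K g" "path p" "path_image p \<subseteq> K" "pathfinish p = pathstart p"
    and w: "w \<notin> g ` K"
  shows "winding_number (g \<circ> p) w = 0"
proof -
  have in_K: "p t \<in> K" if "t \<in> {0..1}" for t
    using assms(4) that by (auto simp: path_image_def)
  have "homotopic_loops K p (\<lambda>_. pathstart p)"
  proof (rule homotopic_loops_linear)
    show "closed_segment (p t) (pathstart p) \<subseteq> K" if "t \<in> {0..1}" for t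
      using in_K[OF that] in_K[of 0] by (intro closed_segment_subset assms(1)) (auto simp: pathstart_def)
  qed (use assms in \<open>auto simp: pathstart_def pathfinish_def path_def\<close>)
  then have "homotopic_loops (- {w}) (g \<circ> p) (g \<circ> (\<lambda>_. pathstart p))"
    using assms(2) w by (intro homotopic_loops_continuous_image) auto
  then have "winding_number (g \<circ> p) w = winding_number (\<lambda>_. g (pathstart p)) w"
    by (simp add: winding_number_homotopic_loops comp_def)
  moreover have "g (pathstart p) \<noteq> w"
    using w in_K[of 0] by (auto simp: pathstart_def)
  ultimately show ?thesis
    by (simp add: winding_number_zero_const)
qed

text \<open>This is the injectivity that a degenerate tile still has: boundary points may be
  identified with each other, but never with an interior point.\<close>

lemma disc_ne:
  fixes g :: "complex \<Rightarrow> complex"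
  assumes "inj_on g (ball 0 1)" "g ` ball 0 1 \<inter> g ` sphere 0 1 = {}"
    "x \<in> cball 0 1" "q \<in> ball 0 1" "x \<noteq> q"
  shows "g x \<noteq> g q"
proof (cases "x \<in> ball 0 1")
  case True
  then show ?thesis using assms by (auto simp: inj_on_def)
next
  case False
  then have "x \<in> sphere 0 1" using assms by auto
  then show ?thesis using assms by blast
qed

text \<open>The image of the unit circle need not be a simple curve, but that of the circle of
  radius 1/2 is one, and both are homotopic in the image of the disc without its centre. A simple
  closed curve winds once, in one direction or the other, around its inside; connectedness of the
  open disc then carries the value from \<open>g 0\<close> to every \<open>g q\<close>.\<close>

lemma disc_winding:
  fixes g :: "complex \<Rightarrow> complex"
  assumes cont: "continuous_on (cball 0 1) g" and inj: "inj_on g (ball 0 1)"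
    and disj: "g ` ball 0 1 \<inter> g ` sphere 0 1 = {}"
  obtains \<epsilon> :: complex where "\<epsilon> = 1 \<or> \<epsilon> = -1"
    "\<And>a q. q \<in> ball 0 1 \<Longrightarrow> winding_number (g \<circ> arcp a (a + 2 * pi)) (g q) = \<epsilon>"
proof -
  define c where "c = (\<lambda>s::real. cis (2 * pi * s) / 2)"
  have pc: "path c"
    unfolding path_def c_def by (intro continuous_intros) auto
  have c_im: "path_image c \<subseteq> sphere 0 (1/2)"
    by (auto simp: path_image_def c_def norm_divide)
  note ne = disc_ne[OF inj disj]
  have hom: "homotopic_loops (cball 0 1 - {0}) (arcp a (a + 2 * pi)) c" for a
  proof -
    \<comment> \<open>The radius shrinks from 1 to 1/2 while the starting angle turns from
      \<open>a\<close> to 0, so all starting angles end at the same circle \<open>c\<close> and give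
      the same sign.\<close>
    let ?h = "\<lambda>x::real \<times> real. (1 - complex_of_real (fst x) / 2) * cis ((1 - fst x) * a + 2 * pi * snd x)"
    have "continuous_on ({0..1::real} \<times> {0..1}) ?h"
      by (intro continuous_intros) auto
    moreover have "?h \<in> ({0..1::real} \<times> {0..1}) \<rightarrow> cball 0 1 - {0}"
    proof
      fix x :: "real \<times> real" assume "x \<in> {0..1} \<times> {0..1}"
      then have "0 \<le> fst x" "fst x \<le> 1" by auto
      moreover have "norm (?h x) = 1 - fst x / 2"
      proof -
        have "norm (?h x) = norm (1 - complex_of_real (fst x) / 2)"
          by (simp add: norm_mult)
        also have "1 - complex_of_real (fst x) / 2 = of_real (1 - fst x / 2)" by simp
        also have "norm \<dots> = \<bar>1 - fst x / 2\<bar>" by (rule norm_of_real)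
        finally show ?thesis using \<open>fst x \<le> 1\<close> by simp
      qed
      ultimately have "0 < norm (?h x)" "norm (?h x) \<le> 1"
        by linarith+
      then show "?h x \<in> cball 0 1 - {0}"
        unfolding zero_less_norm_iff by simp
    qed
    ultimately show ?thesis
      unfolding homotopic_loops
    proof (intro exI[of _ ?h] conjI ballI)
      fix x :: real assume "x \<in> {0..1}"
      show "?h (0, x) = arcp a (a + 2 * pi) x"
        by (simp add: arcp_def mult.commute)
      show "?h (1, x) = c x"
        by (simp add: c_def)
      show "pathfinish (?h \<circ> Pair x) = pathstart (?h \<circ> Pair x)"
        by (simp add: pathfinish_def pathstart_def)
    qed
  qed
  have wc: "winding_number (g \<circ> arcp a (a + 2 * pi)) (g 0) = winding_number (g \<circ> c) (g 0)" for a
  proof (rule winding_number_homotopic_loops, rule homotopic_loops_continuous_image[OF hom])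
    show "continuous_on (cball 0 1 - {0}) g"
      using cont continuous_on_subset by blast
    show "g \<in> cball 0 1 - {0} \<rightarrow> - {g 0}"
      using ne[of _ 0] by auto
  qed
  have inj2: "inj_on g (cball 0 (1/2))"
    using inj by (rule inj_on_subset) auto
  have simple: "simple_path (g \<circ> c)"
    unfolding simple_path_def loop_free_def
  proof (intro conjI ballI impI)
    show "path (g \<circ> c)"
      using pc by (rule path_continuous_image) (rule continuous_on_subset[OF cont], use c_im in fastforce)
    fix x y :: real
    assume xy: "x \<in> {0..1}" "y \<in> {0..1}" "(g \<circ> c) x = (g \<circ> c) y"
    then have "c x = c y"
      using inj2 c_im by (auto simp: inj_on_def path_image_def image_subset_iff)
    then have "exp (\<i> * (2 * pi * x)) = exp (\<i> * (2 * pi * y))"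
      by (simp add: c_def cis_conv_exp)
    then obtain n :: int where "\<i> * (2 * pi * x) = \<i> * (2 * pi * y) + of_int (2 * n) * pi * \<i>"
      unfolding exp_eq by auto
    then have "Im (\<i> * (2 * pi * x)) = Im (\<i> * (2 * pi * y) + of_int (2 * n) * pi * \<i>)"
      by simp
    then have "pi * x = pi * (y + of_int n)"
      by (simp add: algebra_simps)
    then have eq: "x = y + of_int n"
      by simp
    have "real_of_int n \<le> 1" "-1 \<le> real_of_int n"
      using xy eq by auto
    then have "n = 0 \<or> n = 1 \<or> n = -1" by linarith
    then show "x = y \<or> x = 0 \<and> y = 1 \<or> x = 1 \<and> y = 0"
      using xy eq by auto
  qed
  have imc: "path_image (g \<circ> c) \<subseteq> g ` sphere 0 (1/2)"
    using c_im unfolding path_image_compose by blast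
  \<comment> \<open>By invariance of domain the image \<open>U\<close> of the small open disc is
    open, and its frontier lies on the curve. The outside of the curve is connected and unbounded
    and avoids that frontier, so it cannot meet the bounded set \<open>U\<close>.\<close>
  have g0: "g 0 \<in> inside (path_image (g \<circ> c))"
  proof -
    define U where "U = g ` ball 0 (1/2)"
    have "open U"
      unfolding U_def
      by (intro invariance_of_domain open_ball continuous_on_subset[OF cont] inj_on_subset[OF inj]) auto
    have img_cb: "compact (g ` cball 0 (1/2))"
      by (rule compact_continuous_image) (use cont in \<open>auto intro: continuous_on_subset\<close>)
    have sph: "g ` sphere 0 (1/2) \<subseteq> path_image (g \<circ> c)"
    proof -
      have "sphere 0 (1/2) \<subseteq> path_image c"
      proof
        fix z :: complex assume z: "z \<in> sphere 0 (1/2)"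
        define t where "t = Arg2pi z / (2 * pi)"
        have "z = of_real (norm z) * exp (\<i> * of_real (Arg2pi z))"
          using Arg2pi_eq by simp
        moreover have "norm z = 1 / 2"
          using z by simp
        ultimately have "z = 1 / 2 * exp (\<i> * of_real (Arg2pi z))"
          by (metis of_real_1 of_real_divide of_real_numeral)
        then have "z = c t"
          by (simp add: c_def t_def cis_conv_exp)
        moreover have "t \<in> {0..1}"
          using Arg2pi_ge_0[of z] Arg2pi_lt_2pi[of z] by (simp add: t_def less_imp_le)
        ultimately show "z \<in> path_image c"
          by (auto simp: path_image_def)
      qed
      then show ?thesis unfolding path_image_compose by blast
    qed
    have clU: "closure U \<subseteq> g ` cball 0 (1/2)"
      unfolding U_def by (rule closure_minimal) (use img_cb compact_imp_closed in auto)
    have "g 0 \<in> U"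
      by (auto simp: U_def)
    have "g 0 \<notin> path_image (g \<circ> c)"
    proof
      assume "g 0 \<in> path_image (g \<circ> c)"
      then obtain x where "x \<in> sphere 0 (1/2)" "g x = g 0" using imc by fastforce
      then show False using ne[of x 0] by (cases "x = 0") auto
    qed
    have "frontier U \<subseteq> path_image (g \<circ> c)"
    proof
      fix y assume "y \<in> frontier U"
      then have "y \<in> closure U" "y \<notin> U"
        using \<open>open U\<close> by (auto simp: frontier_def interior_open)
      then obtain x where "x \<in> cball 0 (1/2)" "y = g x" "x \<notin> ball 0 (1/2)"
        using clU unfolding U_def by blast
      then show "y \<in> path_image (g \<circ> c)"
        using sph by auto
    qed
    moreover have "bounded U"
      using img_cb clU closure_subset by (meson bounded_subset compact_imp_bounded order_trans)
    moreover have "path_image (g \<circ> c) \<inter> outside (path_image (g \<circ> c)) = {}"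
      using outside_no_overlap by blast 
    moreover have "connected (outside (path_image (g \<circ> c)))"
      by (intro connected_outside) (auto simp: bounded_simple_path_image simple)
    moreover have "\<not> bounded (outside (path_image (g \<circ> c)))"
      by (intro unbounded_outside) (auto simp: bounded_simple_path_image simple)
    ultimately have "outside (path_image (g \<circ> c)) \<inter> U = {}"
      using connected_Int_frontier[of "outside (path_image (g \<circ> c))" U] bounded_subset[of U] by blast
    then have "g 0 \<notin> outside (path_image (g \<circ> c))"
      using \<open>g 0 \<in> U\<close> by blast
    then show ?thesis
      using inside_Un_outside[of "path_image (g \<circ> c)"] \<open>g 0 \<notin> path_image (g \<circ> c)\<close> by blast
  qed
  obtain \<epsilon> :: complex where eps: "\<epsilon> = 1 \<or> \<epsilon> = -1" "winding_number (g \<circ> c) (g 0) = \<epsilon>"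
    using simple_closed_path_winding_number_inside[OF simple] g0 by metis
  have "winding_number (g \<circ> arcp a (a + 2 * pi)) (g q) = \<epsilon>" if "q \<in> ball 0 1" for a q
  proof -
    let ?P = "g \<circ> arcp a (a + 2 * pi)"
    have "path ?P"
      by (rule path_continuous_image[OF path_arcp])
        (rule continuous_on_subset[OF cont], use path_image_arcp_sphere in fastforce)
    moreover have "pathfinish ?P = pathstart ?P"
      by (simp add: pathfinish_compose pathstart_compose)
    moreover have "connected (g ` ball 0 1)"
      by (rule connected_continuous_image) (use cont in \<open>auto intro: continuous_on_subset\<close>)
    moreover have "g ` ball 0 1 \<inter> path_image ?P = {}"
      using disj path_image_arcp_sphere unfolding path_image_compose by blast
    ultimately have "winding_number ?P constant_on g ` ball 0 1"
      by (rule winding_number_constant)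
    then have "winding_number ?P (g q) = winding_number ?P (g 0)"
      using that unfolding constant_on_def by fastforce
    then show ?thesis using wc eps by simp
  qed
  then show ?thesis using that eps(1) by blast
qed


section \<open>Caps cut off a disc by a chord\<close>

text \<open>The signed distance of \<open>q\<close> from the chord between \<open>cis a\<close> and
  \<open>cis b\<close>, measured in the direction of the midpoint of the arc from \<open>a\<close>
  to \<open>b\<close>; it is nonnegative on that arc when 0 < b - a < 2 pi.\<close>

definition cap_level :: "real \<Rightarrow> real \<Rightarrow> complex \<Rightarrow> real" where
  "cap_level a b q = Re (q * cis (- ((a + b) / 2))) - cos ((b - a) / 2)"

lemma cap_level_affine:
  "cap_level a b ((1 - u) *\<^sub>R x + u *\<^sub>R y) = (1 - u) * cap_level a b x + u * cap_level a b y"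
  by (simp add: cap_level_def algebra_simps)

lemma cap_level_cis: "cap_level a b (cis t) = cos (t - (a + b) / 2) - cos ((b - a) / 2)"
  by (simp add: cap_level_def cis_mult)

lemma cap_level_ends: "cap_level a b (cis a) = 0" "cap_level a b (cis b) = 0"
proof -
  have "a - (a + b) / 2 = - ((b - a) / 2)" "b - (a + b) / 2 = (b - a) / 2"
    by (simp_all add: field_simps)
  then show "cap_level a b (cis a) = 0" "cap_level a b (cis b) = 0"
    by (simp_all only: cap_level_cis cos_minus)
qed

lemma cap_level_linepath:
  "cap_level a b (linepath (cis b) (cis a) s) = 0" "cap_level a b (linepath (cis a) (cis b) s) = 0"
  by (simp_all only: linepath_def cap_level_affine cap_level_ends)

lemma continuous_on_cap_level [continuous_intros]:
  "continuous_on S f \<Longrightarrow> continuous_on S (\<lambda>x. cap_level a b (f x))"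
  unfolding cap_level_def by (intro continuous_intros)

lemma convex_cap: "convex {q \<in> cball 0 1. cap_level a b q \<ge> 0}" "convex {q \<in> cball 0 1. cap_level a b q \<le> 0}"
proof -
  have "convex (cball 0 1 \<inter> {q. cap_level a b q \<ge> 0})" "convex (cball 0 1 \<inter> {q. cap_level a b q \<le> 0})"
    unfolding convex_alt
    by (auto simp: cap_level_affine intro!: convexD_alt[OF convex_cball, of _ 0 1, simplified] add_nonpos_nonpos mult_nonneg_nonpos)
  then show "convex {q \<in> cball 0 1. cap_level a b q \<ge> 0}" "convex {q \<in> cball 0 1. cap_level a b q \<le> 0}"
    by (simp_all only: Int_def mem_Collect_eq)
qed

lemma cap_level_arcp:
  assumes "a < b" "b < a + 2 * pi" "s \<in> {0..1}"
  shows "cap_level a b (arcp a b s) \<ge> 0" "cap_level a b (arcp b (a + 2 * pi) s) \<le> 0"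
proof -
  define d where "d = (b - a) / 2"
  have d: "0 < d" "d < pi" and b: "b = a + 2 * d"
    using assms by (auto simp: d_def field_simps)
  have "s * d \<le> d" "0 \<le> s * d"
    using assms d mult_right_mono[of s 1 d] by auto
  then have "\<bar>2 * s * d - d\<bar> \<le> d" by linarith
  then have "cos d \<le> cos \<bar>2 * s * d - d\<bar>"
    using d by (intro cos_monotone_0_pi_le) auto
  then show "cap_level a b (arcp a b s) \<ge> 0"
    by (simp add: arcp_def cap_level_cis b algebra_simps add_divide_distrib)
  define t where "t = d + s * (2 * pi - 2 * d)"
  have "0 \<le> s * (2 * pi - 2 * d)" "s * (2 * pi - 2 * d) \<le> 2 * pi - 2 * d"
    using assms d mult_right_mono[of s 1 "2 * pi - 2 * d"] by auto
  then have t: "d \<le> t" "t \<le> 2 * pi - d"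
    by (auto simp: t_def)
  have "cos t \<le> cos d"
  proof (cases "t \<le> pi")
    case True
    then show ?thesis using d t by (intro cos_monotone_0_pi_le) auto
  next
    case False
    then have "cos (2 * pi - t) \<le> cos d"
      using d t by (intro cos_monotone_0_pi_le) auto
    then show ?thesis by (simp add: cos_diff)
  qed
  moreover have "b + s * (a + 2 * pi - b) - (a + b) / 2 = t"
    by (simp add: t_def b field_simps)
  ultimately show "cap_level a b (arcp b (a + 2 * pi) s) \<le> 0"
    unfolding arcp_def cap_level_cis by (simp add: d_def)
qed

text \<open>The boundary of the polygon is the boundary of the cap beyond the chord plus the boundary of the
  rest, and each of the two convex pieces only winds around the image of its own interior.\<close>

lemma cap_winding:
  fixes g :: "complex \<Rightarrow> complex"
  assumes cont: "continuous_on (cball 0 1) g" and inj: "inj_on g (ball 0 1)"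
    and disj: "g ` ball 0 1 \<inter> g ` sphere 0 1 = {}"
    and ab: "a < b" "b < a + 2 * pi"
    and eps: "\<And>q. q \<in> ball 0 1 \<Longrightarrow> winding_number (g \<circ> arcp a (a + 2 * pi)) (g q) = \<epsilon>"
  defines "W \<equiv> \<lambda>w. winding_number (g \<circ> arcp a b) w + winding_number (g \<circ> linepath (cis b) (cis a)) w"
  shows "w \<notin> g ` cball 0 1 \<Longrightarrow> W w = 0"
    and "q \<in> ball 0 1 \<Longrightarrow> cap_level a b q < 0 \<Longrightarrow> W (g q) = 0"
    and "q \<in> ball 0 1 \<Longrightarrow> cap_level a b q > 0 \<Longrightarrow> W (g q) = \<epsilon>"
proof -
  let ?K1 = "{q \<in> cball 0 1. cap_level a b q \<ge> 0}" and ?K2 = "{q \<in> cball 0 1. cap_level a b q \<le> 0}"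
  \<comment> \<open>\<open>W'\<close> is the boundary of the complementary piece. The chord is run
    through once in each direction, so \<open>W\<close> and \<open>W'\<close> add up to the whole
    boundary.\<close>
  define W' where
    "W' = (\<lambda>w. winding_number (g \<circ> arcp b (a + 2 * pi)) w + winding_number (g \<circ> linepath (cis a) (cis b)) w)"
  have seg: "linepath (cis a) (cis b) s \<in> cball 0 1" "linepath (cis b) (cis a) s \<in> cball 0 1"
    if "s \<in> {0..1}" for s
  proof -
    have "closed_segment (cis a) (cis b) \<subseteq> cball 0 1" "closed_segment (cis b) (cis a) \<subseteq> cball 0 1"
      by (intro closed_segment_subset convex_cball; simp)+
    moreover have "linepath (cis a) (cis b) s \<in> closed_segment (cis a) (cis b)"
      "linepath (cis b) (cis a) s \<in> closed_segment (cis b) (cis a)"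
      using that by (metis image_eqI linepath_image_01)+
    ultimately show "linepath (cis a) (cis b) s \<in> cball 0 1" "linepath (cis b) (cis a) s \<in> cball 0 1"
      by blast+
  qed
  have arc_cb: "arcp u v s \<in> cball 0 1" for u v s
    by (simp add: arcp_def)
  have im: "path_image (arcp a b) \<subseteq> ?K1" "path_image (arcp b (a + 2 * pi)) \<subseteq> ?K2"
    "path_image (linepath (cis b) (cis a)) \<subseteq> ?K1" "path_image (linepath (cis a) (cis b)) \<subseteq> ?K2"
    using cap_level_arcp[OF ab] arc_cb seg
    by (auto simp: path_image_def cap_level_linepath simp del: linepath_image_01 mem_cball)
  have cont': "continuous_on ?K1 g" "continuous_on ?K2 g"
    using cont by (auto intro: continuous_on_subset)
  have pg: "path (g \<circ> p)" if "path p" "path_image p \<subseteq> cball 0 1" for p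
    using that cont by (meson continuous_on_subset path_continuous_image)
  have W0: "W w = 0" if "w \<notin> g ` ?K1" for w
  proof -
    have "winding_number (g \<circ> (arcp a b +++ linepath (cis b) (cis a))) w = 0"
      by (rule winding_number_null_convex[OF convex_cap(1) cont'(1) _ _ _ that])
        (use im in \<open>simp_all add: path_image_join\<close>)
    moreover have "w \<notin> path_image (g \<circ> arcp a b)" "w \<notin> path_image (g \<circ> linepath (cis b) (cis a))"
      using that im unfolding path_image_compose by blast+
    ultimately show ?thesis
      unfolding path_compose_join W_def
      by (subst (asm) winding_number_join) (use im in \<open>auto intro!: pg simp: pathfinish_compose pathstart_compose\<close>)
  qed
  have W'0: "W' w = 0" if "w \<notin> g ` ?K2" for w
  proof -
    have "winding_number (g \<circ> (arcp b (a + 2 * pi) +++ linepath (cis a) (cis b))) w = 0"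
      by (rule winding_number_null_convex[OF convex_cap(2) cont'(2) _ _ _ that])
        (use im in \<open>simp_all add: path_image_join\<close>)
    moreover have "w \<notin> path_image (g \<circ> arcp b (a + 2 * pi))" "w \<notin> path_image (g \<circ> linepath (cis a) (cis b))"
      using that im unfolding path_image_compose by blast+
    ultimately show ?thesis
      unfolding path_compose_join W'_def
      by (subst (asm) winding_number_join) (use im in \<open>auto intro!: pg simp: pathfinish_compose pathstart_compose\<close>)
  qed
  note ne = disc_ne[OF inj disj]
  show "w \<notin> g ` cball 0 1 \<Longrightarrow> W w = 0"
    by (rule W0) blast
  show "q \<in> ball 0 1 \<Longrightarrow> cap_level a b q < 0 \<Longrightarrow> W (g q) = 0"
  proof (rule W0)
    assume "q \<in> ball 0 1" "cap_level a b q < 0"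
    then show "g q \<notin> g ` ?K1"
      using ne by fastforce
  qed
  show "W (g q) = \<epsilon>" if q: "q \<in> ball 0 1" "cap_level a b q > 0"
  proof -
    have "W' (g q) = 0"
    proof (rule W'0)
      show "g q \<notin> g ` ?K2"
        using q ne by fastforce
    qed
    moreover have "winding_number (g \<circ> arcp a b) (g q) + winding_number (g \<circ> arcp b (a + 2 * pi)) (g q) = \<epsilon>"
    proof -
      let ?P = "g \<circ> arcp a (a + 2 * pi)"
      define v where "v = (b - a) / (2 * pi)"
      have v: "v \<in> {0..1}" using ab by (auto simp: v_def)
      have b: "b = a + v * (2 * pi)"
        by (simp add: v_def)
      have "subpath 0 v ?P = g \<circ> arcp a b" "subpath v 1 ?P = g \<circ> arcp b (a + 2 * pi)"
        by (auto simp: subpath_def arcp_def b fun_eq_iff algebra_simps)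
      moreover have "winding_number (subpath 0 v ?P) (g q) + winding_number (subpath v 1 ?P) (g q)
          = winding_number (subpath 0 1 ?P) (g q)"
      proof (rule winding_number_subpath_combine)
        show "path ?P"
          using path_image_arcp_sphere by (intro pg) fastforce+
        show "g q \<notin> path_image ?P"
          using path_image_arcp_sphere disj q unfolding path_image_compose by blast
      qed (use v in auto)
      ultimately show ?thesis
        using eps q by simp
    qed
    moreover have "winding_number (g \<circ> linepath (cis a) (cis b)) (g q) =
        - winding_number (g \<circ> linepath (cis b) (cis a)) (g q)"
    proof -
      have "g \<circ> linepath (cis a) (cis b) = reversepath (g \<circ> linepath (cis b) (cis a))"
        by (simp add: fun_eq_iff reversepath_def linepath_def algebra_simps)
      moreover have "g q \<notin> path_image (g \<circ> linepath (cis b) (cis a))"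
      proof
        assume "g q \<in> path_image (g \<circ> linepath (cis b) (cis a))"
        then obtain s where s: "s \<in> {0..1}" "g q = g (linepath (cis b) (cis a) s)"
          by (auto simp: path_image_def)
        then have "q = linepath (cis b) (cis a) s"
          using ne[OF seg(2)] q by metis
        then show False using q cap_level_linepath by (metis less_irrefl)
      qed
      moreover have "path (g \<circ> linepath (cis b) (cis a))"
        by (intro pg path_linepath order_trans[OF im(3)]) blast
      ultimately show ?thesis
        by (simp add: winding_number_reversepath)
    qed
    ultimately show ?thesis
      unfolding W_def W'_def by (simp add: algebra_simps) 
  qed
qed


lemma path_image_subpath_mono:
  "u \<le> v \<Longrightarrow> path_image (subpath u v r) = r ` {u..v}"
  by (simp add: path_image_subpath)

text \<open>The arc \<open>r\<close> runs along a side of the polygon through \<open>p\<close>. Its winding number need not be an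
  integer, but it differs from that of the boundary of a cap at \<open>p\<close> by a function that is continuous
  at \<open>r (1 / 2)\<close>; so it jumps by \<open>\<epsilon>\<close> between the image of the cap and its complement.\<close>

lemma jump:
  fixes G :: "complex \<Rightarrow> complex" and r :: "real \<Rightarrow> complex"
  assumes cont: "continuous_on (cball 0 1) G" and inj: "inj_on G (ball 0 1)"
    and disj: "G ` ball 0 1 \<inter> G ` sphere 0 1 = {}"
    and eps: "\<And>a q. q \<in> ball 0 1 \<Longrightarrow> winding_number (G \<circ> arcp a (a + 2 * pi)) (G q) = \<epsilon>"
    and r: "path r" and h: "continuous_on {0..1} h" "strict_mono_on {0..1} h" "h 0 = 0" "h 1 = 1"
    and eq: "\<And>s. s \<in> {0..1} \<Longrightarrow> G (cis (pi / 2 * (j + s))) = r (h s)"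
    and s0: "0 < s0" "s0 < 1" "h s0 = 1 / 2"
    and once: "\<And>u. u \<in> {0..1} \<Longrightarrow> r u = r (1 / 2) \<Longrightarrow> u = 1 / 2"
    and p: "p = cis (pi / 2 * (j + s0))" and p': "p' \<in> sphere 0 1" "p' \<noteq> p"
  shows "\<exists>c. ((\<lambda>q. winding_number r (G q)) \<longlongrightarrow> c + \<epsilon>) (at p within ball 0 1) \<and>
    (G p' = r (1 / 2) \<longrightarrow> ((\<lambda>q. winding_number r (G q)) \<longlongrightarrow> c) (at p' within ball 0 1)) \<and>
    (\<forall>f (F :: complex filter). (f \<longlongrightarrow> r (1 / 2)) F \<longrightarrow> eventually (\<lambda>x. f x \<notin> G ` cball 0 1) F \<longrightarrow>
       ((\<lambda>x. winding_number r (f x)) \<longlongrightarrow> c) F)"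
proof -
  define m where "m = pi / 2 * (j + s0)"
  have pm: "p = cis m" by (simp add: p m_def)
  have Gp: "G p = r (1 / 2)"
    using eq[of s0] s0 by (simp add: p)
  \<comment> \<open>\<open>k\<close> is the cosine of the angle between \<open>p\<close> and
    \<open>p'\<close>. A cap around \<open>p\<close> of half-angle \<open>\<eta>\<close> with cos
    \<eta> > \<open>k\<close> leaves \<open>p'\<close> outside; the bound by
    \<open>min s0 (1 - s0)\<close> keeps the arc of the cap within the side.\<close>
  define k where "k = Re (p' * cis (- m))"
  have "k < 1"
  proof -
    have n: "norm (p' * cis (- m)) = 1" using p' by (simp add: norm_mult)
    have "p' * cis (- m) \<noteq> 1"
    proof
      assume "p' * cis (- m) = 1"
      then have "p' * cis (- m) * cis m = cis m" by simp
      then show False using p' pm by (simp add: mult.assoc cis_mult)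
    qed
    moreover have "p' * cis (- m) = 1" if "k \<ge> 1"
    proof -
      have "(Re (p' * cis (- m)))\<^sup>2 + (Im (p' * cis (- m)))\<^sup>2 = 1"
        using n by (simp add: cmod_def)
      moreover have "(Re (p' * cis (- m)))\<^sup>2 \<ge> 1"
        using that unfolding k_def by (simp add: power2_eq_square mult_ge1_I)
      ultimately have "(Im (p' * cis (- m)))\<^sup>2 \<le> 0" by linarith
      then have "Im (p' * cis (- m)) = 0" by simp
      moreover have "Re (p' * cis (- m)) \<le> 1"
        using complex_Re_le_cmod[of "p' * cis (- m)"] n by simp
      ultimately show ?thesis using that unfolding k_def by (simp add: complex_eq_iff)
    qed
    ultimately show ?thesis by linarith
  qed
  have "((\<lambda>x::real. cos x) \<longlongrightarrow> cos 0) (at_right 0)"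
    by (intro tendsto_intros)
  then have "eventually (\<lambda>x. k < cos x) (at_right 0)"
    using \<open>k < 1\<close> by (intro order_tendstoD(1)) auto
  moreover have "eventually (\<lambda>x. x < pi / 2 * min s0 (1 - s0)) (at_right 0)"
    using s0 by (intro order_tendstoD(2)[of "\<lambda>x. x", OF tendsto_ident_at]) auto
  moreover have "eventually (\<lambda>x::real. 0 < x) (at_right 0)"
    by (simp add: eventually_at_filter)
  ultimately have "eventually (\<lambda>x. k < cos x \<and> x < pi / 2 * min s0 (1 - s0) \<and> 0 < x) (at_right 0)"
    by eventually_elim auto
  then obtain \<eta> where eta: "k < cos \<eta>" "\<eta> < pi / 2 * min s0 (1 - s0)" "0 < \<eta>"
    using eventually_happens'[OF trivial_limit_at_right_real] by blast
  define d where "d = 2 * \<eta> / pi"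
  have d: "0 < d" "d < s0" "d < 1 - s0" and eta_d: "\<eta> = pi / 2 * d"
  proof -
    have "\<eta> < pi / 2 * s0" "\<eta> < pi / 2 * (1 - s0)"
      using eta(2) by (auto simp: min_def mult_strict_left_mono split: if_splits intro: less_le_trans)
    then show "0 < d" "d < s0" "d < 1 - s0" "\<eta> = pi / 2 * d"
      using eta(3) by (auto simp: d_def field_simps)
  qed
  have "\<eta> < pi / 2"
    using d by (simp add: eta_d)
  define a b where "a = m - \<eta>" and "b = m + \<eta>"
  have ab: "a < b" "b < a + 2 * pi"
    using \<open>\<eta> < pi / 2\<close> \<open>0 < \<eta>\<close> by (auto simp: a_def b_def)
  define s1 s2 where "s1 = s0 - d" and "s2 = s0 + d"
  have s12: "0 < s1" "s1 < s0" "s0 < s2" "s2 < 1"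
    using d by (auto simp: s1_def s2_def)
  define u1 u2 where "u1 = h s1" and "u2 = h s2"
  have u: "0 < u1" "u1 < 1/2" "1/2 < u2" "u2 < 1"
    using strict_mono_onD[OF h(2), of 0 s1] strict_mono_onD[OF h(2), of s1 s0]
      strict_mono_onD[OF h(2), of s0 s2] strict_mono_onD[OF h(2), of s2 1] s12 s0 h
    by (auto simp: u1_def u2_def)
  have lev: "cap_level a b q = Re (q * cis (- m)) - cos \<eta>" for q
    by (simp add: cap_level_def a_def b_def)
  have lev_p: "cap_level a b p > 0"
  proof -
    have "cos \<eta> < cos 0"
      using \<open>\<eta> < pi / 2\<close> \<open>0 < \<eta>\<close> by (intro cos_monotone_0_pi) auto
    then show ?thesis by (simp add: lev pm cis_mult)
  qed
  have lev_p': "cap_level a b p' < 0"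
    using eta by (simp add: lev k_def)
  define W where
    "W = (\<lambda>w. winding_number (G \<circ> arcp a b) w + winding_number (G \<circ> linepath (cis b) (cis a)) w)"
  \<comment> \<open>\<open>C\<close> collects what stays away from \<open>r (1 / 2)\<close>, namely
    the two ends of \<open>r\<close> and the reversed chord. Up to reparametrization the middle
    piece of \<open>r\<close> is the arc of the cap, so \<open>r\<close> winds as \<open>C\<close>
    plus the boundary of the cap.\<close>
  define C where "C = (\<lambda>w. winding_number (subpath 0 u1 r) w + winding_number (subpath u2 1 r) w
    - winding_number (G \<circ> linepath (cis b) (cis a)) w)"
  have cap0: "W w = 0" if "w \<notin> G ` cball 0 1" for w
    unfolding W_def by (rule cap_winding(1)[OF cont inj disj ab]) (use eps that in auto)
  have cap1: "W (G q) = 0" if "q \<in> ball 0 1" "cap_level a b q < 0" for q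
    unfolding W_def by (rule cap_winding(2)[OF cont inj disj ab]) (use eps that in auto)
  have cap2: "W (G q) = \<epsilon>" if "q \<in> ball 0 1" "0 < cap_level a b q" for q
    unfolding W_def by (rule cap_winding(3)[OF cont inj disj ab]) (use eps that in auto)
  have seg: "linepath (cis b) (cis a) s \<in> cball 0 1" if "s \<in> {0..1}" for s
  proof -
    have "closed_segment (cis b) (cis a) \<subseteq> cball 0 1"
      by (intro closed_segment_subset convex_cball; simp)
    moreover have "linepath (cis b) (cis a) s \<in> closed_segment (cis b) (cis a)"
      using that by (metis image_eqI linepath_image_01)
    ultimately show ?thesis by blast
  qed
  have chord_path: "path (G \<circ> linepath (cis b) (cis a))"
    by (intro path_continuous_image continuous_on_subset[OF cont])
      (use seg in \<open>auto simp: path_image_def simp del: linepath_image_01\<close>)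
  have arc_eq: "(G \<circ> arcp a b) t = r (h (s1 + t * (s2 - s1)))" if "t \<in> {0..1}" for t
  proof -
    have "s1 + t * (s2 - s1) \<in> {0..1}"
    proof -
      have "t * (s2 - s1) \<le> s2 - s1" "0 \<le> t * (s2 - s1)"
        using that s12 by (auto intro!: mult_left_le_one_le)
      then have "0 \<le> s1 + t * (s2 - s1)" "s1 + t * (s2 - s1) \<le> 1"
        using s12 by linarith+
      then show ?thesis by simp
    qed
    then show ?thesis
      by (subst eq[symmetric]) (auto simp: arcp_def a_def b_def m_def s1_def s2_def eta_d algebra_simps add_divide_distrib)
  qed
  have r_sub: "path_image r \<subseteq> G ` sphere 0 1"
  proof
    fix z assume "z \<in> path_image r"
    then obtain u where u: "u \<in> {0..1}" "z = r u" by (auto simp: path_image_def)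
    then obtain s where "s \<in> {0..1}" "h s = u"
      using IVT'[of h 0 u 1] h by auto
    then have "z = G (cis (pi / 2 * (j + s)))" using eq u by simp
    then show "z \<in> G ` sphere 0 1" by auto
  qed
  \<comment> \<open>Inner points of the chord lie in the open disc, whose image misses that of the
    circle. The end points of the chord have parameters \<open>u2\<close> and \<open>u1\<close> on
    \<open>r\<close>, which differ from 1/2.\<close>
  have chord_x: "r (1 / 2) \<notin> path_image (G \<circ> linepath (cis b) (cis a))"
  proof
    assume "r (1 / 2) \<in> path_image (G \<circ> linepath (cis b) (cis a))"
    then obtain s where s: "s \<in> {0..1}" "G p = G (linepath (cis b) (cis a) s)"
      by (auto simp: path_image_def Gp)
    let ?c = "linepath (cis b) (cis a) s"
    have "?c \<in> sphere 0 1"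
    proof (rule ccontr)
      assume "?c \<notin> sphere 0 1"
      then have "?c \<in> ball 0 1" using seg[OF s(1)] by auto
      then show False using disj s(2) pm by (metis IntI norm_cis dist_0_norm empty_iff image_eqI mem_sphere)
    qed
    moreover have "norm ?c < 1" if "s \<noteq> 0" "s \<noteq> 1"
    proof -
      have "?c \<in> open_segment (cis b) (cis a)"
      proof -
        have "cis a \<noteq> cis b"
        proof
          assume "cis a = cis b"
          then have "Re (cis a * cis (- m)) = Re (cis b * cis (- m))" "Im (cis a * cis (- m)) = Im (cis b * cis (- m))" by simp_all
          then have "sin \<eta> = 0" by (simp_all add: cis_mult a_def b_def)
          then show False using \<open>0 < \<eta>\<close> \<open>\<eta> < pi / 2\<close> sin_gt_zero[of \<eta>] by simp
        qed
        then show ?thesis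
          using s that by (auto simp: in_segment linepath_def intro!: exI[of _ s])
      qed
      then show ?thesis
        using dist_decreases_open_segment[of ?c "cis b" "cis a" 0] by (auto simp: dist_norm)
    qed
    ultimately have "s = 0 \<or> s = 1" by fastforce
    then have "r (1 / 2) = r u2 \<or> r (1 / 2) = r u1"
      using s arc_eq[of 0] arc_eq[of 1] Gp by (auto simp: linepath_def arcp_def u1_def u2_def)
    then show False
      using once[of u1] once[of u2] u by auto
  qed
  have sub_x: "r (1 / 2) \<notin> path_image (subpath 0 u1 r)" "r (1 / 2) \<notin> path_image (subpath u2 1 r)"
  proof -
    show "r (1 / 2) \<notin> path_image (subpath 0 u1 r)"
    proof
      assume "r (1 / 2) \<in> path_image (subpath 0 u1 r)"
      then obtain v where "v \<in> {0..u1}" "r v = r (1 / 2)"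
        using u by (auto simp: path_image_subpath_mono)
      then show False using once[of v] u by auto
    qed
    show "r (1 / 2) \<notin> path_image (subpath u2 1 r)"
    proof
      assume "r (1 / 2) \<in> path_image (subpath u2 1 r)"
      then obtain v where "v \<in> {u2..1}" "r v = r (1 / 2)"
        using u by (auto simp: path_image_subpath_mono)
      then show False using once[of v] u by auto
    qed
  qed
  have C_cont: "isCont C (r (1 / 2))"
    unfolding C_def
    by (intro continuous_intros continuous_at_winding_number chord_path chord_x sub_x path_subpath r)
      (use u in auto)
  have main: "winding_number r w = C w + W w" if "w \<notin> path_image r" for w
  proof -
    have "winding_number r w = winding_number (subpath 0 u1 r) w + winding_number (subpath u1 u2 r) w
        + winding_number (subpath u2 1 r) w"
      using winding_number_subpath_combine[OF r that, of 0 u1 u2] winding_number_subpath_combine[OF r that, of 0 u2 1] u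
      by simp
    moreover have "winding_number (subpath u1 u2 r) w = winding_number (G \<circ> arcp a b) w"
    proof (rule winding_number_homotopic_paths, rule homotopic_paths_reparametrize)
      let ?f = "\<lambda>t. (h (s1 + t * (s2 - s1)) - u1) / (u2 - u1)"
      have ran: "s1 + t * (s2 - s1) \<in> {s1..s2}" if "t \<in> {0..1}" for t
      proof -
        have "t * (s2 - s1) \<le> s2 - s1" "0 \<le> t * (s2 - s1)"
          using that s12 by (auto intro!: mult_left_le_one_le)
        then have "s1 \<le> s1 + t * (s2 - s1)" "s1 + t * (s2 - s1) \<le> s2"
          by linarith+
        then show ?thesis by simp
      qed
      show "path (subpath u1 u2 r)" using r u by (intro path_subpath) auto
      show "path_image (subpath u1 u2 r) \<subseteq> - {w}"
        using that path_image_subpath_subset[of u1 u2 r] u by fastforce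
      show "continuous_on {0..1} ?f"
      proof (intro continuous_intros)
        show "continuous_on {0..1} (\<lambda>t. h (s1 + t * (s2 - s1)))"
          by (rule continuous_on_compose2[OF h(1)]) (use ran s12 in \<open>force intro!: continuous_intros\<close>)+
      qed (use u in auto)
      show "?f \<in> {0..1} \<rightarrow> {0..1}"
      proof
        fix t :: real assume "t \<in> {0..1}"
        then have "h s1 \<le> h (s1 + t * (s2 - s1))" "h (s1 + t * (s2 - s1)) \<le> h s2"
          using ran[of t] s12 by (auto intro!: strict_mono_on_leD[OF h(2)])
        then show "?f t \<in> {0..1}" using u by (auto simp: u1_def u2_def field_simps)
      qed
      show "?f 0 = 0" "?f 1 = 1" using u by (auto simp: u1_def u2_def)
      show "(G \<circ> arcp a b) t = subpath u1 u2 r (?f t)" if "t \<in> {0..1}" for t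
        unfolding arc_eq[OF that] using u by (simp add: subpath_def)
    qed
    ultimately show ?thesis
      by (simp add: C_def W_def)
  qed
  have not_r: "G q \<notin> path_image r" if "q \<in> ball 0 1" for q
    using r_sub disj that by blast
  have lim: "((\<lambda>q. winding_number r (G q)) \<longlongrightarrow> C (r (1 / 2)) + k) (at x within ball 0 1)"
    if x: "x \<in> cball 0 1" "G x = r (1 / 2)" and P: "eventually (\<lambda>q. W (G q) = k) (at x within ball 0 1)" for x k
  proof -
    have "(G \<longlongrightarrow> r (1 / 2)) (at x within ball 0 1)"
      using cont x by (metis ball_subset_cball continuous_on_def tendsto_within_subset)
    then have "((\<lambda>q. C (G q) + k) \<longlongrightarrow> C (r (1 / 2)) + k) (at x within ball 0 1)"
      using C_cont isCont_tendsto_compose by (intro tendsto_intros) blast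
    moreover have "eventually (\<lambda>q. q \<in> ball 0 1) (at x within ball 0 1)"
      by (simp add: eventually_at_filter)
    then have "eventually (\<lambda>q. winding_number r (G q) = C (G q) + k) (at x within ball 0 1)"
      using P by eventually_elim (use main not_r in auto)
    ultimately show ?thesis
      by (simp add: tendsto_cong)
  qed
  have lev_lim: "(cap_level a b \<longlongrightarrow> cap_level a b x) (at x within ball 0 1)" for x
  proof -
    have "continuous_on UNIV (\<lambda>x. cap_level a b x)" by (intro continuous_intros)
    then show ?thesis by (metis UNIV_I continuous_on_def subset_UNIV tendsto_within_subset)
  qed
  have in_ball: "eventually (\<lambda>q. q \<in> ball 0 1) (at x within ball 0 1)" for x :: complex
    by (simp add: eventually_at_filter)
  show ?thesis
  proof (intro exI[of _ "C (r (1 / 2))"] conjI impI allI)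
    show "((\<lambda>q. winding_number r (G q)) \<longlongrightarrow> C (r (1 / 2)) + \<epsilon>) (at p within ball 0 1)"
    proof (rule lim)
      show "eventually (\<lambda>q. W (G q) = \<epsilon>) (at p within ball 0 1)"
        using order_tendstoD(1)[OF lev_lim lev_p] in_ball by eventually_elim (rule cap2)
    qed (use pm Gp in auto)
    show "((\<lambda>q. winding_number r (G q)) \<longlongrightarrow> C (r (1 / 2))) (at p' within ball 0 1)" if "G p' = r (1 / 2)"
    proof -
      have "eventually (\<lambda>q. W (G q) = 0) (at p' within ball 0 1)"
        using order_tendstoD(2)[OF lev_lim lev_p'] in_ball by eventually_elim (rule cap1)
      then show ?thesis using lim[of p' 0] p' that by simp
    qed
    fix f :: "complex \<Rightarrow> complex" and F
    assume f: "(f \<longlongrightarrow> r (1 / 2)) F" and out: "eventually (\<lambda>x. f x \<notin> G ` cball 0 1) F"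
    have "((\<lambda>x. C (f x)) \<longlongrightarrow> C (r (1 / 2))) F"
      using C_cont f isCont_tendsto_compose by blast
    moreover have "eventually (\<lambda>x. winding_number r (f x) = C (f x)) F"
      using out
    proof eventually_elim
      fix x assume "f x \<notin> G ` cball 0 1"
      then have "f x \<notin> path_image r" "W (f x) = 0"
        using r_sub cap0 by auto
      then show "winding_number r (f x) = C (f x)" using main by simp
    qed
    ultimately show "((\<lambda>x. winding_number r (f x)) \<longlongrightarrow> C (r (1 / 2))) F"
      by (simp add: tendsto_cong)
  qed
qed

section \<open>The universal covering of the torus\<close>

definition cov :: "complex \<Rightarrow> complex \<times> complex" where
  "cov z = (cis (Re z), cis (Im z))"

definition lattice :: "complex set" where
  "lattice = {z. \<exists>(m::int) (n::int). z = Complex (2 * pi * m) (2 * pi * n)}"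

lemma cis_eq_iff: "cis x = cis y \<longleftrightarrow> (\<exists>n::int. x = y + 2 * pi * n)"
proof
  assume "cis x = cis y"
  then have "sin y = sin x \<and> cos y = cos x" by (simp add: complex_eq_iff)
  then obtain n :: int where "y = x + 2 * pi * n" by (auto simp: sin_cos_eq_iff)
  then show "\<exists>n::int. x = y + 2 * pi * n" by (intro exI[of _ "- n"]) simp
next
  assume "\<exists>n::int. x = y + 2 * pi * n"
  then have "sin x = sin y \<and> cos x = cos y" by (auto simp: sin_cos_eq_iff)
  then show "cis x = cis y" by (simp add: complex_eq_iff)
qed

lemma cov_eq_iff: "cov z = cov w \<longleftrightarrow> z - w \<in> lattice"
proof -
  have "z - w = Complex (2 * pi * m) (2 * pi * n) \<longleftrightarrow> Re z = Re w + 2 * pi * m \<and> Im z = Im w + 2 * pi * n"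
    for m n :: int by (auto simp: complex_eq_iff)
  then show ?thesis
    by (auto simp: cov_def lattice_def cis_eq_iff)
qed

lemma lattice_0 [simp]: "0 \<in> lattice"
  by (auto simp: lattice_def complex_eq_iff intro!: exI[of _ 0])

lemma lattice_add: "a \<in> lattice \<Longrightarrow> b \<in> lattice \<Longrightarrow> a + b \<in> lattice"
proof -
  assume "a \<in> lattice" "b \<in> lattice"
  then obtain m n m' n' :: int where
    "a = Complex (2 * pi * m) (2 * pi * n)" "b = Complex (2 * pi * m') (2 * pi * n')"
    by (auto simp: lattice_def)
  then have "a + b = Complex (2 * pi * of_int (m + m')) (2 * pi * of_int (n + n'))"
    by (simp add: complex_eq_iff algebra_simps)
  then show ?thesis unfolding lattice_def by blast
qed

lemma lattice_uminus [simp]: "- a \<in> lattice \<longleftrightarrow> a \<in> lattice"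
proof -
  have "- a \<in> lattice" if "a \<in> lattice" for a
  proof -
    obtain m n :: int where "a = Complex (2 * pi * m) (2 * pi * n)"
      using \<open>a \<in> lattice\<close> by (auto simp: lattice_def)
    then have "- a = Complex (2 * pi * of_int (- m)) (2 * pi * of_int (- n))"
      by (simp add: complex_eq_iff)
    then show ?thesis unfolding lattice_def by blast
  qed
  from this[of a] this[of "- a"] show ?thesis by auto
qed

lemma lattice_diff: "a \<in> lattice \<Longrightarrow> b \<in> lattice \<Longrightarrow> a - b \<in> lattice"
  using lattice_add[of a "- b"] by simp

lemma lattice_of_int_mult: "a \<in> lattice \<Longrightarrow> of_int k * a \<in> lattice"
proof -
  assume "a \<in> lattice"
  then obtain m n :: int where "a = Complex (2 * pi * m) (2 * pi * n)"
    by (auto simp: lattice_def)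
  then have "of_int k * a = Complex (2 * pi * of_int (k * m)) (2 * pi * of_int (k * n))"
    by (simp add: complex_eq_iff)
  then show ?thesis unfolding lattice_def by blast
qed

lemma cov_add_lattice [simp]: "a \<in> lattice \<Longrightarrow> cov (z + a) = cov z"
  by (simp add: cov_eq_iff)

lemma lattice_discrete:
  assumes "a \<in> lattice" "norm a < 2 * pi"
  shows "a = 0"
proof -
  obtain m n :: int where a: "a = Complex (2 * pi * m) (2 * pi * n)"
    using assms(1) by (auto simp: lattice_def)
  have "\<bar>2 * pi * m\<bar> < 2 * pi * 1" "\<bar>2 * pi * n\<bar> < 2 * pi * 1"
    using abs_Re_le_cmod[of a] abs_Im_le_cmod[of a] assms(2) by (auto simp: a)
  then have "\<bar>real_of_int m\<bar> < 1" "\<bar>real_of_int n\<bar> < 1"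
    by (simp_all add: abs_mult)
  then have "m = 0" "n = 0" by linarith+
  then show ?thesis by (simp add: a complex_eq_iff)
qed

lemma finite_lattice_bounded: "finite {a \<in> lattice. norm a \<le> B}"
proof -
  define N where "N = \<lceil>B / (2 * pi)\<rceil>"
  have "{a \<in> lattice. norm a \<le> B} \<subseteq> (\<lambda>(m, n). Complex (2 * pi * of_int m) (2 * pi * of_int n)) ` ({-N..N} \<times> {-N..N})"
  proof
    fix a assume a: "a \<in> {a \<in> lattice. norm a \<le> B}"
    then obtain m n :: int where mn: "a = Complex (2 * pi * m) (2 * pi * n)"
      by (auto simp: lattice_def)
    have "\<bar>2 * pi * m\<bar> \<le> B" "\<bar>2 * pi * n\<bar> \<le> B"
      using abs_Re_le_cmod[of a] abs_Im_le_cmod[of a] a by (auto simp: mn)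
    then have "\<bar>real_of_int m\<bar> \<le> B / (2 * pi)" "\<bar>real_of_int n\<bar> \<le> B / (2 * pi)"
      by (simp_all add: abs_mult field_simps)
    then have "\<bar>m\<bar> \<le> N" "\<bar>n\<bar> \<le> N"
      unfolding N_def by linarith+
    then show "a \<in> (\<lambda>(m, n). Complex (2 * pi * of_int m) (2 * pi * of_int n)) ` ({-N..N} \<times> {-N..N})"
      by (intro image_eqI[of _ _ "(m, n)"]) (auto simp: mn)
  qed
  then show ?thesis by (rule finite_subset) simp
qed

lemma continuous_on_cov [continuous_intros]:
  "continuous_on S f \<Longrightarrow> continuous_on S (\<lambda>x. cov (f x))"
  unfolding cov_def by (intro continuous_intros)

lemma cov_in_torus [simp]: "cov z \<in> torus"
  by (simp add: cov_def torus_def)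

lemma cov_surj: assumes "y \<in> torus" obtains z where "cov z = y"
proof -
  have "cis (Arg (fst y)) = fst y" "cis (Arg (snd y)) = snd y"
  proof -
    have n: "norm (fst y) = 1" "norm (snd y) = 1" using assms by (auto simp: torus_def)
    then have "fst y \<noteq> 0" "snd y \<noteq> 0" by force+
    then show "cis (Arg (fst y)) = fst y" "cis (Arg (snd y)) = snd y"
      using n by (simp_all add: cis_Arg sgn_eq)
  qed
  then have "cov (Complex (Arg (fst y)) (Arg (snd y))) = y"
    by (simp add: cov_def prod_eq_iff)
  then show ?thesis using that by blast
qed

text \<open>On a contractible set both circle-valued coordinates have continuous logarithms; as the
  moduli are 1, the imaginary parts of these logarithms are the coordinates of the lift.\<close>

lemma cov_lift:
  fixes f :: "'a::real_normed_vector \<Rightarrow> complex \<times> complex"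
  assumes "continuous_on S f" "f ` S \<subseteq> torus" "contractible S"
  obtains g where "continuous_on S g" "\<And>x. x \<in> S \<Longrightarrow> cov (g x) = f x"
proof -
  have n: "norm (fst (f x)) = 1" "norm (snd (f x)) = 1" if "x \<in> S" for x
    using assms(2) that by (auto simp: torus_def image_subset_iff mem_Times_iff)
  obtain g1 where g1: "continuous_on S g1" "\<And>x. x \<in> S \<Longrightarrow> fst (f x) = exp (g1 x)"
    by (rule continuous_logarithm_on_contractible[of S "\<lambda>x. fst (f x)"])
      (use assms n in \<open>fastforce intro!: continuous_intros\<close>)+
  obtain g2 where g2: "continuous_on S g2" "\<And>x. x \<in> S \<Longrightarrow> snd (f x) = exp (g2 x)"
    by (rule continuous_logarithm_on_contractible[of S "\<lambda>x. snd (f x)"])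
      (use assms n in \<open>fastforce intro!: continuous_intros\<close>)+
  have e: "exp w = cis (Im w)" if "norm (exp w) = 1" for w
  proof -
    have "Re w = 0" using that by (simp add: norm_exp_eq_Re)
    then show ?thesis by (simp add: exp_eq_polar)
  qed
  show ?thesis
  proof
    show "continuous_on S (\<lambda>x. Complex (Im (g1 x)) (Im (g2 x)))"
      by (intro continuous_intros g1 g2)
    show "cov (Complex (Im (g1 x)) (Im (g2 x))) = f x" if "x \<in> S" for x
      using n[OF that] g1(2)[OF that] g2(2)[OF that] e[of "g1 x"] e[of "g2 x"]
      by (simp add: cov_def prod_eq_iff)
  qed
qed

lemma lattice_valued_constant:
  fixes g :: "'a::topological_space \<Rightarrow> complex"
  assumes "connected S" "continuous_on S g" "\<And>x. x \<in> S \<Longrightarrow> g x \<in> lattice" "x \<in> S" "y \<in> S"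
  shows "g x = g y"
proof -
  have "g constant_on S"
  proof (rule continuous_discrete_range_constant[OF assms(1,2)])
    fix x assume "x \<in> S"
    show "\<exists>e>0. \<forall>y. y \<in> S \<and> g y \<noteq> g x \<longrightarrow> e \<le> norm (g y - g x)"
    proof (intro exI[of _ "2 * pi"] conjI allI impI)
      fix y assume y: "y \<in> S \<and> g y \<noteq> g x"
      then have "g y - g x \<in> lattice" using assms(3) \<open>x \<in> S\<close> by (auto intro: lattice_diff)
      then show "2 * pi \<le> norm (g y - g x)"
        using lattice_discrete y by fastforce
    qed simp
  qed
  then show ?thesis using assms by (auto simp: constant_on_def)
qed

lemma lifts_differ_by_lattice:
  fixes f g :: "'a::topological_space \<Rightarrow> complex"
  assumes "connected S" "continuous_on S f" "continuous_on S g" "\<And>x. x \<in> S \<Longrightarrow> cov (f x) = cov (g x)"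
    "S \<noteq> {}"
  obtains c where "c \<in> lattice" "\<And>x. x \<in> S \<Longrightarrow> f x = g x + c"
proof -
  obtain x0 where x0: "x0 \<in> S" using assms by blast
  have "f x - g x = f x0 - g x0" if "x \<in> S" for x
    by (rule lattice_valued_constant[OF assms(1), of "\<lambda>x. f x - g x"])
      (use assms that x0 in \<open>auto intro!: continuous_intros simp flip: cov_eq_iff\<close>)
  then show ?thesis
    using assms(4)[OF x0] by (intro that[of "f x0 - g x0"]) (auto simp: cov_eq_iff algebra_simps)
qed

lemma cov_inj_on_ball: "inj_on cov (ball z pi)"
proof (rule inj_onI)
  fix x y assume "x \<in> ball z pi" "y \<in> ball z pi" "cov x = cov y"
  then have "norm (x - y) < 2 * pi" "x - y \<in> lattice"
    using dist_triangle_half_r[of z x "2 * pi" y] by (auto simp: dist_norm cov_eq_iff dist_commute)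
  then show "x = y" using lattice_discrete by fastforce
qed

text \<open>The covering is open. The principal logarithm, applied to the coordinates divided by
  those of \<open>cov z\<close>, yields a right inverse \<open>G\<close> of \<open>cov\<close> on
  the torus that is continuous at \<open>cov z\<close> and takes the value \<open>z\<close>
  there.\<close>

lemma cov_local_inverse:
  assumes "r > 0"
  obtains d where "d > 0" "\<And>y. y \<in> torus \<Longrightarrow> dist y (cov z) < d \<Longrightarrow> y \<in> cov ` ball z r"
proof -
  define G where "G = (\<lambda>y. z + (of_real (Im (Ln (fst y / fst (cov z)))) + \<i> * of_real (Im (Ln (snd y / snd (cov z))))))"
  have "isCont G (cov z)"
    unfolding G_def by (intro continuous_intros) (auto simp: cov_def)
  moreover have "G (cov z) = z"
    by (simp add: G_def cov_def)
  ultimately obtain d where d: "d > 0" "\<And>y. dist y (cov z) < d \<Longrightarrow> dist (G y) z < r"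
    unfolding continuous_at_eps_delta using assms by metis
  have "cov (G y) = y" if "y \<in> torus" for y
  proof -
    have n: "norm (fst y) = 1" "norm (snd y) = 1"
      using that by (auto simp: torus_def mem_Times_iff)
    have e: "cis (a + Im (Ln (w / cis a))) = w" if "norm w = 1" for w a
    proof -
      have "w / cis a \<noteq> 0" "norm (w / cis a) = 1" using that by (auto simp: norm_divide)
      then have "cis (Im (Ln (w / cis a))) = w / cis a"
        by (metis exp_Ln exp_eq_polar mult_1 norm_exp_eq_Re of_real_1)
      then show ?thesis by (simp flip: cis_mult)
    qed
    show ?thesis
      using n by (simp add: G_def cov_def prod_eq_iff e)
  qed
  then show ?thesis
    using d by (intro that[of d]) (force simp: dist_commute image_iff)+
qed

section \<open>Traversals of an edge and their reparametrizations\<close>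

lemma pathstart_traverses: "traverses V e p \<Longrightarrow> pathstart p \<in> V"
  and pathfinish_traverses: "traverses V e p \<Longrightarrow> pathfinish p \<in> V"
  by (auto simp: traverses_def)

lemma traverses_interior:
  assumes "traverses V e p"
  shows "p ` {0<..<1} = e - V" "inj_on p {0<..<1}"
proof -
  have sp: "simple_path p" and im: "p ` {0..1} = e" and V: "e \<inter> V = {p 0, p 1}"
    using assms by (auto simp: traverses_def path_image_def pathstart_def pathfinish_def)
  have lf: "x = y \<or> x = 0 \<and> y = 1 \<or> x = 1 \<and> y = 0" if "x \<in> {0..1}" "y \<in> {0..1}" "p x = p y" for x y
    using sp that by (auto simp: simple_path_def loop_free_def)
  show "inj_on p {0<..<1}"
  proof (rule inj_onI)
    fix x y :: real assume "x \<in> {0<..<1}" "y \<in> {0<..<1}" "p x = p y"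
    then show "x = y" using lf[of x y] by auto
  qed
  show "p ` {0<..<1} = e - V"
  proof safe
    fix s :: real assume s: "s \<in> {0<..<1}"
    then show "p s \<in> e" using im by auto
    assume "p s \<in> V"
    then have "p s = p 0 \<or> p s = p 1" using V im s by fastforce
    then show False using lf[of s 0] lf[of s 1] s by auto
  next
    fix y assume y: "y \<in> e" "y \<notin> V"
    then obtain s where "s \<in> {0..1}" "y = p s" using im by auto
    moreover have "s \<noteq> 0" "s \<noteq> 1" using y V calculation by auto
    ultimately show "y \<in> p ` {0<..<1}" by auto
  qed
qed

text \<open>A relatively closed subset of the open interval is the trace of a closed set, and the
  image of the compact part of that set in the closed interval is closed. The two end points that
  this adds are mapped into \<open>V\<close> and drop out of the open edge.\<close>

lemma traverses_homeomorphism: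
  fixes p :: "real \<Rightarrow> 'a::t2_space"
  assumes "traverses V e p"
  obtains g where "homeomorphism {0<..<1} (e - V) p g"
proof (rule homeomorphism_injective_closed_map)
  have p: "path p" "path_image p = e" using assms by (auto simp: traverses_def simple_path_imp_path)
  then have cp: "continuous_on {0..1} p" by (simp add: path_def)
  show "continuous_on {0<..<1} p" using cp by (rule continuous_on_subset) auto
  show "p ` {0<..<1} = e - V" "inj_on p {0<..<1}" using traverses_interior[OF assms] .
  fix U :: "real set" assume "closedin (top_of_set {0<..<1}) U"
  then obtain T where T: "closed T" "U = {0<..<1} \<inter> T" by (auto simp: closedin_closed)
  have "compact (p ` ({0..1} \<inter> T))"
    by (intro compact_continuous_image continuous_on_subset[OF cp] compact_Int_closed T) auto
  then have "closed (p ` ({0..1} \<inter> T))" by (rule compact_imp_closed)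
  moreover have "p ` U = (e - V) \<inter> p ` ({0..1} \<inter> T)"
  proof -
    have "p 0 \<in> V" "p 1 \<in> V"
      using pathstart_traverses[OF assms] pathfinish_traverses[OF assms] by (auto simp: pathstart_def pathfinish_def)
    then have "x \<in> {0<..<1}" if "x \<in> {0..1}" "p x \<notin> V" for x
      using that by (cases "x = 0 \<or> x = 1") auto
    then show ?thesis using traverses_interior(1)[OF assms] T by fastforce
  qed
  ultimately show "closedin (top_of_set (e - V)) (p ` U)"
    by (simp add: closedin_closed_Int)
qed (use that in auto)

lemma traverses_reversepath: "traverses V e p \<Longrightarrow> traverses V e (reversepath p)"
  by (auto simp: traverses_def simple_path_reversepath)

text \<open>Both paths parametrize the same open edge, so the change of parameter is a continuous
  bijection of the open unit interval and hence monotone. If it increases, \<open>r\<close> is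
  \<open>p\<close>; if it decreases, \<open>r\<close> is the reversal of \<open>p\<close>. This
  decides the direction also for a loop, where the end points do not.\<close>

lemma traverses_reparametrize:
  fixes p q :: "real \<Rightarrow> 'a::real_normed_vector"
  assumes "traverses V e p" "traverses V e q"
  obtains r h where "r = p \<or> r = reversepath p" "continuous_on UNIV h" "strict_mono h"
    "h 0 = (0::real)" "h 1 = 1" "\<And>s. s \<in> {0..1} \<Longrightarrow> q s = r (h s)"
proof -
  have step: "\<exists>h. continuous_on UNIV h \<and> strict_mono h \<and> h 0 = (0::real) \<and> h 1 = 1 \<and> (\<forall>s\<in>{0..1}. q s = r (h s))"
    if r: "traverses V e r" and k: "bij_betw k {0<..<1} {0<..<1}" "strict_mono_on {0<..<1} k"
      "\<And>s. s \<in> {0<..<1} \<Longrightarrow> q s = r (k s)" for r and k :: "real \<Rightarrow> real"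
  proof -
    \<comment> \<open>Extending \<open>k\<close> by the identity makes \<open>h\<close> a strictly
      increasing surjection of the whole line; continuity, also at 0 and 1, then comes for
      free.\<close>
    define h where "h = (\<lambda>s. if s \<in> {0<..<1} then k s else s)"
    have kin: "k s \<in> {0<..<1}" if "s \<in> {0<..<1}" for s
      using k(1) that by (auto simp: bij_betw_def)
    have mono: "strict_mono h"
    proof (rule strict_monoI)
      fix x y :: real assume "x < y"
      then show "h x < h y"
        using kin[of x] kin[of y] strict_mono_onD[OF k(2), of x y] by (auto simp: h_def)
    qed
    have "range h = UNIV"
    proof -
      have "\<exists>x. y = h x" for y
      proof (cases "y \<in> {0<..<1}")
        case True
        then obtain x where "x \<in> {0<..<1}" "k x = y" using k(1) unfolding bij_betw_def by (metis imageE)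
        then show ?thesis by (intro exI[of _ x]) (auto simp: h_def)
      qed (auto simp: h_def intro: exI[of _ y])
      then show ?thesis by auto
    qed
    then have cont: "continuous_on UNIV h"
      using mono by (intro continuous_onI_mono) (auto simp: strict_mono_less_eq)
    have h01: "h 0 = 0" "h 1 = 1" by (auto simp: h_def)
    have hin: "h s \<in> {0..1}" if "s \<in> {0..1}" for s
      using that mono h01 strict_mono_less_eq[OF mono] by (metis atLeastAtMost_iff)
    have "q s = r (h s)" if "s \<in> {0..1}" for s
    proof -
      have "q s - r (h s) = 0"
      proof (rule continuous_constant_on_closure[of "{0<..<1}" "\<lambda>x. q x - r (h x)"])
        show "continuous_on (closure {0<..<1}) (\<lambda>x. q x - r (h x))"
        proof (intro continuous_intros)
          show "continuous_on (closure {0<..<1}) q"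
            using assms(2) by (simp add: traverses_def simple_path_def path_def)
          show "continuous_on (closure {0<..<1}) (\<lambda>x. r (h x))"
          proof (rule continuous_on_compose2[of "{0..1}" r])
            show "continuous_on {0..1} r" using r by (simp add: traverses_def simple_path_def path_def)
            show "continuous_on (closure {0<..<1}) h" by (rule continuous_on_subset[OF cont]) simp
            show "h ` closure {0<..<1} \<subseteq> {0..1}" using hin by (simp add: image_subset_iff)
          qed
        qed
        show "q x - r (h x) = 0" if "x \<in> {0<..<1}" for x
          using k(3) that by (simp add: h_def)
        show "s \<in> closure {0<..<1}" using that by simp
      qed
      then show ?thesis by simp
    qed
    then show ?thesis using mono cont h01 by blast
  qed
  obtain g where g: "homeomorphism {0<..<1} (e - V) p g"
    using traverses_homeomorphism[OF assms(1)] .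
  define k where "k = g \<circ> q"
  have q: "q ` {0<..<1} = e - V" "inj_on q {0<..<1}"
    using traverses_interior[OF assms(2)] .
  have bk: "bij_betw k {0<..<1} {0<..<1}"
  proof -
    have "bij_betw q {0<..<1} (e - V)" using q by (simp add: bij_betw_def)
    moreover have "bij_betw g (e - V) {0<..<1}"
      by (rule bij_betw_byWitness[where f' = p]) (use g in \<open>auto simp: homeomorphism_def\<close>)
    ultimately show ?thesis unfolding k_def by (rule bij_betw_trans)
  qed
  have pk: "q s = p (k s)" if "s \<in> {0<..<1}" for s
  proof -
    have "q s \<in> e - V" using q(1) that by blast
    then show ?thesis using g by (simp add: k_def homeomorphism_def)
  qed
  have "continuous_on {0<..<1} k"
    unfolding k_def
    by (rule continuous_on_compose)
      (use g q assms(2) in \<open>auto simp: homeomorphism_def traverses_def simple_path_def path_def intro: continuous_on_subset\<close>)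
  then consider "strict_mono_on {0<..<1} k" | "strict_antimono_on {0<..<1} k"
    using bk injective_eq_monotone_map[of "{0<..<1}" k] by (auto simp: bij_betw_def)
  then show ?thesis
  proof cases
    case 1
    then show ?thesis using step[OF assms(1) bk 1 pk] that by blast
  next
    case 2
    have b: "bij_betw (\<lambda>s. 1 - k s) {0<..<1} {0<..<1}"
    proof -
      have "bij_betw (\<lambda>s::real. 1 - s) {0<..<1} {0<..<1}"
        by (rule bij_betwI[of _ _ _ "\<lambda>s. 1 - s"]) auto
      from bij_betw_trans[OF bk this] show ?thesis by (simp add: comp_def)
    qed
    have "strict_mono_on {0<..<1} (\<lambda>s. 1 - k s)"
      using 2 by (auto simp: monotone_on_def)
    from step[OF traverses_reversepath[OF assms(1)] b this] pk
    obtain h where h: "continuous_on UNIV h" "strict_mono h" "h 0 = 0" "h 1 = 1"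
      "\<forall>s\<in>{0..1}. q s = reversepath p (h s)"
      by (auto simp: reversepath_def)
    show ?thesis
      by (rule that[OF _ h(1-4)]) (use h(5) in auto)
  qed
qed


section \<open>A disc with two periods, seen on a cylinder\<close>

text \<open>The function z -> exp (2 pi i z / \<gamma>) identifies the cylinder
  \<complex>/\<int>\<gamma> with the punctured plane, which makes winding numbers available on the
  cylinder.\<close>

lemma exp_lattice_eqD:
  assumes "\<gamma> \<noteq> 0" "exp (2 * of_real pi * \<i> * z / \<gamma>) = exp (2 * of_real pi * \<i> * w / \<gamma>)"
  obtains k :: int where "z - w = of_int k * \<gamma>"
proof -
  obtain n :: int where "2 * of_real pi * \<i> * z / \<gamma> = 2 * of_real pi * \<i> * w / \<gamma> + (of_int (2 * n) * pi) * \<i>"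
    using assms(2) unfolding exp_eq by auto
  then have "2 * of_real pi * \<i> * z = 2 * of_real pi * \<i> * w + (of_int (2 * n) * pi) * \<i> * \<gamma>"
    using assms(1) by (simp add: field_simps)
  then have "(2 * of_real pi * \<i>) * (z - w) = (2 * of_real pi * \<i>) * (of_int n * \<gamma>)"
    by (simp add: algebra_simps)
  then have "z - w = of_int n * \<gamma>"
    using mult_left_cancel[of "2 * of_real pi * \<i>" "z - w"] by simp
  then show ?thesis using that by blast
qed

lemma exp_lattice_add:
  assumes "\<gamma> \<noteq> 0"
  shows "exp (2 * of_real pi * \<i> * (z + of_int k * \<gamma>) / \<gamma>) = exp (2 * of_real pi * \<i> * z / \<gamma>)"
proof -
  have "2 * of_real pi * \<i> * (z + of_int k * \<gamma>) / \<gamma> = 2 * of_real pi * \<i> * z / \<gamma> + (of_int (2 * k) * pi) * \<i>"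
    using assms by (simp add: field_simps)
  then show ?thesis unfolding exp_eq by blast
qed

lemma vertical_diameter: "path_image (linepath \<i> (- \<i>)) \<subseteq> (\<lambda>y. \<i> * of_real y) ` {-1..1}"
proof
  fix z assume "z \<in> path_image (linepath \<i> (- \<i>))"
  then obtain s where s: "s \<in> {0..1}" "z = linepath \<i> (- \<i>) s"
    unfolding path_image_def by blast
  then have "z = \<i> * of_real (1 - 2 * s)"
    by (simp add: linepath_def complex_eq_iff)
  then show "z \<in> (\<lambda>y. \<i> * of_real y) ` {-1..1}"
    using s by (intro image_eqI[of _ _ "1 - 2 * s"]) auto
qed

text \<open>The model of a lifted tile of type \<open>Q13_24\<close>: its corners sit at
  \<open>\<i>\<close>, -1, \<open>- \<i>\<close>, 1, opposite corners project to the same vertex by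
  \<open>A\<close> and \<open>B\<close>, and the two vertices differ by \<open>corners\<close>. The
  vertical and horizontal diameters are the diagonals of the tile.\<close>

locale handle_disc =
  fixes G :: "complex \<Rightarrow> complex"
  assumes cont: "continuous_on (cball 0 1) G"
    and cov_inj: "\<And>q q'. q \<in> ball 0 1 \<Longrightarrow> q' \<in> cball 0 1 \<Longrightarrow> cov (G q) = cov (G q') \<Longrightarrow> q = q'"
    and A: "G (- \<i>) - G \<i> \<in> lattice" and B: "G 1 - G (-1) \<in> lattice"
    and corners: "cov (G \<i>) \<noteq> cov (G 1)"
begin

definition "\<alpha> = G (- \<i>) - G \<i>"
definition "\<beta> = G 1 - G (-1)"

text \<open>If one of the two points is interior to the disc, \<open>cov_inj\<close> makes them
  equal, and the diameters have only the centre in common. If both are end points, they belong to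
  different vertices.\<close>

lemma diameters_cross:
  assumes "x \<in> {-1..1}" "y \<in> {-1..1}" "cov (G (of_real x)) = cov (G (\<i> * of_real y))"
  shows "x = 0"
proof -
  have cb: "of_real x \<in> cball (0::complex) 1" "\<i> * of_real y \<in> cball (0::complex) 1"
    using assms by (auto simp: norm_mult)
  have eq: "of_real x = \<i> * of_real y \<Longrightarrow> x = 0"
    by (simp add: complex_eq_iff)
  consider "\<bar>x\<bar> < 1" | "\<bar>y\<bar> < 1" | "(x = 1 \<or> x = -1) \<and> (y = 1 \<or> y = -1)"
  proof -
    have "\<bar>x\<bar> < 1 \<or> x = 1 \<or> x = -1" "\<bar>y\<bar> < 1 \<or> y = 1 \<or> y = -1"
      using assms(1,2) unfolding atLeastAtMost_iff by linarith+
    then show ?thesis using that by blast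
  qed
  then show ?thesis
  proof cases
    case 1
    then show ?thesis using cov_inj[of "of_real x" "\<i> * of_real y"] cb assms(3) eq by auto
  next
    case 2
    then show ?thesis using cov_inj[of "\<i> * of_real y" "of_real x"] cb assms(3) eq by (auto simp: norm_mult)
  next
    case 3
    have "cov (G (- \<i>)) = cov (G \<i>)" "cov (G 1) = cov (G (-1))"
      using A B by (auto simp: cov_eq_iff)
    then have False using 3 assms(3) corners by auto
    then show ?thesis ..
  qed
qed

text \<open>If both periods were multiples of one \<open>\<gamma>\<close>, both diameters would become closed curves on the
  cylinder \<open>\<complex>/\<int>\<gamma>\<close>, and they would cross exactly once.\<close>

lemma periods_not_dependent:
  assumes \<gamma>: "\<gamma> \<in> lattice" "\<gamma> \<noteq> 0" and k: "\<alpha> = of_int k * \<gamma>" "\<beta> = of_int l * \<gamma>"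
  shows False
proof -
  define E where "E = (\<lambda>z. exp (2 * of_real pi * \<i> * z / \<gamma>))"
  define g where "g = E \<circ> G"
  have contE: "continuous_on S E" for S
    unfolding E_def by (intro continuous_intros) (use \<gamma>(2) in auto)
  have contg: "continuous_on (cball 0 1) g"
    unfolding g_def by (intro continuous_on_compose cont contE)
  have gD: "cov (G z) = cov (G w)" if "g z = g w" for z w
  proof -
    obtain n :: int where "G z - G w = of_int n * \<gamma>"
      using exp_lattice_eqD[OF \<gamma>(2), of "G z" "G w"] \<open>g z = g w\<close> by (auto simp: g_def E_def)
    then show ?thesis using lattice_of_int_mult[OF \<gamma>(1)] by (simp add: cov_eq_iff)
  qed
  have injg: "inj_on g (ball 0 1)"
    by (rule inj_onI) (metis gD cov_inj ball_subset_cball subsetD)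
  have disj: "g ` ball 0 1 \<inter> g ` sphere 0 1 = {}"
  proof -
    have False if "q \<in> ball 0 1" "q' \<in> sphere 0 1" "g q = g q'" for q q'
    proof -
      have "q = q'" by (rule cov_inj[OF that(1) _ gD[OF that(3)]]) (use that(2) in auto)
      then show False using that by auto
    qed
    then show ?thesis unfolding disjoint_iff image_iff by metis
  qed
  obtain \<epsilon> :: complex where eps: "\<epsilon> = 1 \<or> \<epsilon> = -1"
    "\<And>a q. q \<in> ball 0 1 \<Longrightarrow> winding_number (g \<circ> arcp a (a + 2 * pi)) (g q) = \<epsilon>"
    by (rule disc_winding[OF contg injg disj]) (rule that)
  define a b where "a = pi / 2" and "b = pi + pi / 2"
  have ab: "a < b" "b < a + 2 * pi" by (auto simp: a_def b_def)
  have "cis (pi + pi / 2) = - \<i>"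
    by (simp only: cis_mult[symmetric]) simp
  then have cab: "cis a = \<i>" "cis b = - \<i>"
    by (simp_all only: a_def b_def cis_pi_half)
  have lev: "cap_level a b q = - Re q" for q
  proof -
    have h: "(a + b) / 2 = pi" "(b - a) / 2 = pi / 2" by (auto simp: a_def b_def)
    show ?thesis unfolding cap_level_def h by simp
  qed
  note cap = cap_winding[OF contg injg disj ab eps(2), unfolded cab lev]
  define P where "P = g \<circ> linepath \<i> (- \<i>)"
  have segP: "path_image (linepath \<i> (- \<i>)) \<subseteq> cball 0 1"
    using vertical_diameter by (fastforce simp: norm_mult)
  have pathP: "path P"
    unfolding P_def by (intro path_continuous_image continuous_on_subset[OF contg] segP) auto
  have gi: "g (- \<i>) = g \<i>"
    using exp_lattice_add[OF \<gamma>(2), of "G \<i>" k] k(1) by (simp add: g_def E_def \<alpha>_def algebra_simps)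
  have g1: "g 1 = g (-1)"
    using exp_lattice_add[OF \<gamma>(2), of "G (-1)" l] k(2) by (simp add: g_def E_def \<beta>_def algebra_simps)
  have loopP: "pathfinish P = pathstart P"
    by (simp add: P_def pathfinish_compose pathstart_compose gi)
  have off: "g (of_real x) \<notin> path_image P" if x: "x \<in> {-1..1}" "x \<noteq> 0" for x
  proof
    assume "g (of_real x) \<in> path_image P"
    then obtain y where "y \<in> {-1..1}" "g (of_real x) = g (\<i> * of_real y)"
      using vertical_diameter unfolding P_def path_image_compose by blast
    then show False using diameters_cross[OF x(1), of y] gD x(2) by blast
  qed
  have const: "winding_number P (g (of_real x)) = winding_number P (g (of_real y))"
    if S: "connected S" "S \<subseteq> {-1..1}" "0 \<notin> S" "x \<in> S" "y \<in> S" for S x y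
  proof -
    have "connected ((\<lambda>x. g (of_real x)) ` S)"
    proof (rule connected_continuous_image[OF _ S(1)])
      show "continuous_on S (\<lambda>x. g (complex_of_real x))"
        by (rule continuous_on_compose2[OF contg]) (use S in \<open>auto intro!: continuous_intros simp: abs_le_iff\<close>)
    qed
    then have "winding_number P constant_on ((\<lambda>x. g (of_real x)) ` S)"
    proof (intro winding_number_constant pathP loopP)
      have "g (of_real x) \<notin> path_image P" if "x \<in> S" for x
        by (rule off) (use S(2,3) that in auto)
      then show "(\<lambda>x. g (complex_of_real x)) ` S \<inter> path_image P = {}" by blast
    qed
    then show ?thesis using S unfolding constant_on_def by (metis imageI)
  qed
  \<comment> \<open>The closed curve \<open>P\<close> meets the horizontal diameter only at the
    centre. Both halves of that diameter lead to the same point \<open>g 1\<close>, which equals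
    \<open>g (-1)\<close>, so \<open>P\<close> winds equally often around both.\<close>
  define n where "n = winding_number P (g 1)"
  have left: "winding_number P (g (of_real x)) = n" if "x \<in> {-1..<0}" for x
  proof -
    have "{-1..<0} \<subseteq> {-1..1::real}" by auto
    then show ?thesis using const[of "{-1..<0}" x "-1"] that g1 by (simp add: n_def)
  qed
  have right: "winding_number P (g (of_real x)) = n" if "x \<in> {0<..1}" for x
  proof -
    have "{0<..1} \<subseteq> {-1..1::real}" by auto
    then show ?thesis using const[of "{0<..1}" x 1] that by (simp add: n_def)
  qed
  have rev: "winding_number (g \<circ> linepath (- \<i>) \<i>) w = - winding_number P w" if "w \<notin> path_image P" for w
  proof -
    have "g \<circ> linepath (- \<i>) \<i> = reversepath P"
      by (simp add: P_def fun_eq_iff reversepath_def linepath_def algebra_simps)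
    then show ?thesis using winding_number_reversepath[OF pathP that] by simp
  qed
  \<comment> \<open>\<open>Q\<close> belongs to the left half of the boundary, which avoids
    \<open>g 0\<close>, so \<open>Q\<close> is continuous there. But the left half closed up by the
    vertical diameter bounds the left half disc, which forces the values n + \<epsilon> on the left
    of the centre and n on the right.\<close>
  define Q where "Q = winding_number (g \<circ> arcp a b)"
  have Q1: "Q (g (of_real x)) = n + \<epsilon>" if "x \<in> {-1<..<0}" for x
  proof -
    have "Q (g (of_real x)) + winding_number (g \<circ> linepath (- \<i>) \<i>) (g (of_real x)) = \<epsilon>"
      unfolding Q_def by (rule cap(3)) (use that in auto)
    then show ?thesis using rev[OF off[of x]] left[of x] that by (simp add: algebra_simps)
  qed
  have Q2: "Q (g (of_real x)) = n" if "x \<in> {0<..<1}" for x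
  proof -
    have "Q (g (of_real x)) + winding_number (g \<circ> linepath (- \<i>) \<i>) (g (of_real x)) = 0"
      unfolding Q_def by (rule cap(2)) (use that in auto)
    then show ?thesis using rev[OF off[of x]] right[of x] that by simp
  qed
  have "isCont Q (g 0)"
    unfolding Q_def
  proof (rule continuous_at_winding_number)
    show "path (g \<circ> arcp a b)"
      by (intro path_continuous_image continuous_on_subset[OF contg])
        (use path_image_arcp_sphere in fastforce)+
    show "g 0 \<notin> path_image (g \<circ> arcp a b)"
    proof
      assume "g 0 \<in> path_image (g \<circ> arcp a b)"
      then have "g 0 \<in> g ` sphere 0 1"
        using path_image_arcp_sphere unfolding path_image_compose by blast
      moreover have "g 0 \<in> g ` ball 0 1" by simp
      ultimately show False using disj by blast
    qed
  qed
  moreover have "isCont (\<lambda>x. g (complex_of_real x)) 0"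
  proof -
    have "continuous_on {-1<..<1} (\<lambda>x. g (complex_of_real x))"
      by (rule continuous_on_compose2[OF contg]) (auto intro!: continuous_intros simp: abs_le_iff)
    then show ?thesis by (simp add: continuous_on_eq_continuous_at)
  qed
  ultimately have "isCont (\<lambda>x. Q (g (complex_of_real x))) 0"
    using isCont_o2[of 0 "\<lambda>x. g (complex_of_real x)" Q] by simp
  then have lim: "((\<lambda>x. Q (g (complex_of_real x))) \<longlongrightarrow> Q (g 0)) (at_left 0)"
    "((\<lambda>x. Q (g (complex_of_real x))) \<longlongrightarrow> Q (g 0)) (at_right 0)"
    unfolding isCont_def by (auto intro: tendsto_within_subset)
  have "eventually (\<lambda>x::real. x \<in> {-1<..<0}) (at_left 0)" "eventually (\<lambda>x::real. x \<in> {0<..<1}) (at_right 0)"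
    using eventually_at_left_real[of "-1" 0] eventually_at_right_real[of 0 1] by auto
  then have "((\<lambda>x. Q (g (complex_of_real x))) \<longlongrightarrow> n + \<epsilon>) (at_left 0)"
    "((\<lambda>x. Q (g (complex_of_real x))) \<longlongrightarrow> n) (at_right 0)"
    by (auto intro!: tendsto_eventually elim!: eventually_mono simp: Q1 Q2)
  then have "Q (g 0) = n + \<epsilon>" "Q (g 0) = n"
    using lim tendsto_unique trivial_limit_at_left_real trivial_limit_at_right_real by blast+
  then show False using eps(1) by auto
qed

text \<open>On the cylinder \<open>\<complex>/\<int>\<alpha>\<close> the first diameter is a closed curve separating the two ends, so
  it meets every translate of the periodic line made of copies of the second diameter.\<close>

lemma periods_span:
  assumes \<alpha>0: "\<alpha> \<noteq> 0" and indep: "Im (\<beta> / \<alpha>) \<noteq> 0" and w: "w \<in> lattice"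
  shows "\<exists>m n::int. w = of_int m * \<alpha> + of_int n * \<beta>"
proof (rule ccontr)
  assume not: "\<not> ?thesis"
  have al: "\<alpha> \<in> lattice" "\<beta> \<in> lattice" using A B by (simp_all add: \<alpha>_def \<beta>_def)
  define E where "E = (\<lambda>z. exp (2 * of_real pi * \<i> * z / \<alpha>))"
  define P where "P = E \<circ> (G \<circ> linepath \<i> (- \<i>))"
  have contE: "continuous_on S E" for S
    unfolding E_def by (intro continuous_intros) (use \<alpha>0 in auto)
  have segP: "path_image (linepath \<i> (- \<i>)) \<subseteq> cball 0 1"
    using vertical_diameter by (fastforce simp: norm_mult)
  have pathGl: "path (G \<circ> linepath \<i> (- \<i>))"
    by (intro path_continuous_image continuous_on_subset[OF cont] segP) auto
  have pathP: "path P"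
    unfolding P_def by (intro path_continuous_image contE pathGl)
  have loopP: "pathfinish P = pathstart P"
    using exp_lattice_add[OF \<alpha>0, of "G \<i>" 1]
    by (simp add: P_def pathfinish_compose pathstart_compose E_def \<alpha>_def)
  \<comment> \<open>For fixed \<open>k\<close> this is a copy of the horizontal diameter, translated
    by \<open>w\<close>. Consecutive copies join end to end, because \<open>z 1 k\<close> equals
    \<open>z (-1) (k + 1)\<close>.\<close>
  define z where "z x k = G (of_real x) + w + of_int k * \<beta>" for x :: real and k :: int
  \<comment> \<open>A meeting point projects to a crossing of the two diameters, hence to their
    centre, and this would express \<open>w\<close> by the periods.\<close>
  have off: "E (z x k) \<notin> path_image P" if x: "x \<in> {-1..1}" for x k
  proof
    assume "E (z x k) \<in> path_image P"
    then obtain y where y: "y \<in> {-1..1}" "E (z x k) = E (G (\<i> * of_real y))"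
      using vertical_diameter unfolding P_def path_image_compose by blast
    then obtain m :: int where m: "z x k - G (\<i> * of_real y) = of_int m * \<alpha>"
      using exp_lattice_eqD[OF \<alpha>0] unfolding E_def by blast
    then have "G (of_real x) - G (\<i> * of_real y) = of_int m * \<alpha> - (w + of_int k * \<beta>)"
      by (simp add: z_def algebra_simps)
    moreover have "\<dots> \<in> lattice"
      by (intro lattice_diff lattice_add lattice_of_int_mult al w)
    ultimately have c: "cov (G (of_real x)) = cov (G (\<i> * of_real y))"
      by (simp add: cov_eq_iff)
    then have "x = 0" using diameters_cross x y by blast
    then have "G 0 = G (\<i> * of_real y) \<or> y = 0"
      using cov_inj[of 0 "\<i> * of_real y"] c y by (auto simp: norm_mult abs_le_iff)
    then have "w = of_int m * \<alpha> + of_int (- k) * \<beta>"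
      using m \<open>x = 0\<close> by (auto simp: z_def algebra_simps)
    then show False using not by blast
  qed
  have const: "winding_number P (E (z x k)) = winding_number P (E (z y k))"
    if "x \<in> {-1..1}" "y \<in> {-1..1}" for x y k
  proof -
    have "connected ((\<lambda>x. E (z x k)) ` {-1..1})"
    proof (rule connected_continuous_image)
      have "continuous_on {-1..1} (\<lambda>x. G (complex_of_real x))"
        by (rule continuous_on_compose2[OF cont]) (auto intro!: continuous_intros simp: abs_le_iff)
      then show "continuous_on {-1..1} (\<lambda>x. E (z x k))"
        unfolding z_def by (intro continuous_on_compose2[OF contE[of UNIV]] continuous_intros) auto
    qed auto
    then have "winding_number P constant_on ((\<lambda>x. E (z x k)) ` {-1..1})"
      by (intro winding_number_constant pathP loopP) (use off in auto)
    then show ?thesis using that unfolding constant_on_def by (metis imageI)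
  qed
  define v where "v k = winding_number P (E (z (-1) k))" for k
  have step: "v k = v (k + 1)" for k
  proof -
    have "z 1 k = z (-1) (k + 1)"
      by (simp add: z_def \<beta>_def algebra_simps)
    then show ?thesis using const[of "-1" 1 k] by (simp add: v_def)
  qed
  have vconst: "v k = v 0" for k
    by (induction k rule: int_induct[of _ 0]) (use step step[of "_ - 1"] in auto)
  \<comment> \<open>On the cylinder the modulus of the k-th joint is exp (c + k t) with t nonzero,
    so the chain of copies runs between the two punctures 0 and infinity. The winding number of
    \<open>P\<close> is 1 near the former and 0 near the latter, yet it is constant along the
    chain.\<close>
  define t c where "t = Re (2 * of_real pi * \<i> * \<beta> / \<alpha>)" and "c = Re (2 * of_real pi * \<i> * z (-1) 0 / \<alpha>)"
  have t: "t \<noteq> 0"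
  proof -
    have "t = - (2 * pi) * Im (\<beta> / \<alpha>)"
      by (simp add: t_def Re_divide Im_divide field_simps)
    then show ?thesis using indep by simp
  qed
  have normE: "norm (E (z (-1) k)) = exp (c + k * t)" for k
  proof -
    have "2 * of_real pi * \<i> * z (-1) k / \<alpha> = 2 * of_real pi * \<i> * z (-1) 0 / \<alpha> + of_real (of_int k) * (2 * of_real pi * \<i> * \<beta> / \<alpha>)"
      using \<alpha>0 by (simp add: z_def field_simps)
    then have "Re (2 * of_real pi * \<i> * z (-1) k / \<alpha>) = c + k * t"
      by (simp only: plus_complex.sel Re_complex_of_real t_def c_def) (simp only: times_complex.sel Re_complex_of_real Im_complex_of_real)
    then show ?thesis by (simp only: E_def norm_exp_eq_Re)
  qed
  have arch: "\<exists>k::int. M \<le> k * u" if "u \<noteq> 0" for M u :: real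
  proof -
    obtain n :: nat where n: "M / \<bar>u\<bar> \<le> n" using real_arch_simple by blast
    then have "M \<le> n * \<bar>u\<bar>" using that by (simp add: field_simps)
    then have "M \<le> of_int (int n * (if u > 0 then 1 else -1)) * u" using that by auto
    then show ?thesis by blast
  qed
  obtain Bd where Bd: "\<And>y. Bd \<le> norm y \<Longrightarrow> winding_number P y = 0"
    using winding_number_zero_at_infinity[OF pathP loopP] by blast
  have "v 0 = 0"
  proof -
    obtain k :: int where "Bd - c \<le> k * t" using arch[OF t] by blast
    then have "Bd \<le> exp (c + k * t)" using exp_ge_add_one_self[of "c + k * t"] by linarith
    then have "v k = 0" unfolding v_def by (intro Bd) (simp add: normE)
    then show ?thesis using vconst[of k] by simp
  qed
  moreover have "v 0 = 1"
  proof -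
    have "P = exp \<circ> (\<lambda>s. 2 * of_real pi * \<i> / \<alpha> * (G \<circ> linepath \<i> (- \<i>)) s)"
      by (simp add: P_def E_def fun_eq_iff)
    moreover have "path (\<lambda>s. 2 * of_real pi * \<i> / \<alpha> * (G \<circ> linepath \<i> (- \<i>)) s)"
      using pathGl unfolding path_def by (rule continuous_on_mult_left)
    ultimately have "winding_number P 0 = (2 * of_real pi * \<i> / \<alpha> * G (- \<i>) - 2 * of_real pi * \<i> / \<alpha> * G \<i>) / (2 * of_real pi * \<i>)"
      by (simp add: winding_number_compose_exp pathfinish_def pathstart_def linepath_def)
    also have "\<dots> = (2 * of_real pi * \<i> / \<alpha> * \<alpha>) / (2 * of_real pi * \<i>)"
      by (simp only: \<alpha>_def right_diff_distrib)
    also have "\<dots> = 1" using \<alpha>0 by simp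
    finally have wn0: "winding_number P 0 = 1" .
    have P0: "0 \<notin> path_image P"
      by (auto simp: P_def path_image_def E_def)
    then obtain r where r: "r > 0" "ball 0 r \<subseteq> - path_image P"
      using closed_path_image[OF pathP] by (metis ComplI open_Compl openE)
    have "winding_number P constant_on ball 0 r"
      by (intro winding_number_constant pathP loopP) (use r in auto)
    then have near: "winding_number P y = 1" if "norm y < r" for y
      using wn0 r(1) that unfolding constant_on_def by (metis centre_in_ball dist_0_norm mem_ball)
    obtain k :: int where "c + 1 / r \<le> k * (- t)" using arch[of "-t"] t by auto
    then have "1 / r < exp (- (c + k * t))" using exp_ge_add_one_self[of "- (c + k * t)"] by (simp add: algebra_simps)
    then have "1 / r < 1 / exp (c + k * t)" by (simp only: exp_minus inverse_eq_divide)
    then have "exp (c + k * t) < r" using r(1) by (simp add: field_simps)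
    then have "v k = 1" unfolding v_def by (intro near) (simp add: normE)
    then show ?thesis using vconst[of k] by simp
  qed
  ultimately show False by simp
qed

text \<open>Unless the periods are linearly independent over the reals, their integer coordinates
  have determinant zero. Both are then integer multiples of one nonzero lattice vector, which
  \<open>periods_not_dependent\<close> excludes.\<close>

lemma periods_generate:
  assumes "w \<in> lattice"
  shows "\<exists>m n::int. w = of_int m * \<alpha> + of_int n * \<beta>"
proof (cases "\<alpha> \<noteq> 0 \<and> Im (\<beta> / \<alpha>) \<noteq> 0")
  case True
  then show ?thesis using periods_span assms by blast
next
  case False
  have "\<alpha> \<in> lattice" "\<beta> \<in> lattice" using A B by (simp_all add: \<alpha>_def \<beta>_def)
  then obtain a1 a2 b1 b2 :: int where ab: "\<alpha> = Complex (2 * pi * a1) (2 * pi * a2)" "\<beta> = Complex (2 * pi * b1) (2 * pi * b2)"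
    unfolding lattice_def by blast
  have det: "a1 * b2 = a2 * b1"
  proof (cases "\<alpha> = 0")
    case True
    then show ?thesis by (simp add: ab complex_eq_iff)
  next
    case al: False
    then have "Im (\<beta> / \<alpha>) = 0" using False by simp
    then have "Im \<beta> * Re \<alpha> - Re \<beta> * Im \<alpha> = 0"
      using al by (auto simp: Im_divide complex_neq_0)
    then have "(2 * pi)\<^sup>2 * (real_of_int b2 * a1 - b1 * a2) = 0"
      by (simp add: ab power2_eq_square algebra_simps)
    then have "real_of_int (a1 * b2) = real_of_int (a2 * b1)"
      by (simp add: algebra_simps)
    then show ?thesis by (simp only: of_int_eq_iff)
  qed
  obtain g1 g2 k l :: int where g: "g1 \<noteq> 0 \<or> g2 \<noteq> 0" "a1 = k * g1" "a2 = k * g2" "b1 = l * g1" "b2 = l * g2"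
  proof (cases "a1 = 0 \<and> a2 = 0")
    case True
    show ?thesis
    proof (cases "b1 = 0 \<and> b2 = 0")
      case True
      then show ?thesis using \<open>a1 = 0 \<and> a2 = 0\<close> that[of 1 0 0 0] by auto
    next
      case False
      then show ?thesis using \<open>a1 = 0 \<and> a2 = 0\<close> that[of b1 b2 0 1] by auto
    qed
  next
    case False
    define d where "d = gcd a1 a2"
    have "d \<noteq> 0" using False by (auto simp: d_def)
    obtain g1 g2 where g: "a1 = d * g1" "a2 = d * g2" unfolding d_def by (meson dvdE gcd_dvd1 gcd_dvd2)
    \<comment> \<open>Dividing by the gcd leaves a vector (g1, g2) with u g1 + v g2 = 1, and the
      same Bezout coefficients read off the multiple l = u b1 + v b2 for the second period.\<close>
    obtain u v where "u * a1 + v * a2 = d" unfolding d_def using bezout_int by blast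
    then have "d * (u * g1 + v * g2) = d * 1" by (simp add: g algebra_simps)
    then have uv: "u * g1 + v * g2 = 1" using \<open>d \<noteq> 0\<close> by simp
    have gb: "g1 * b2 = g2 * b1" using det \<open>d \<noteq> 0\<close> by (simp add: g)
    have "(u * b1 + v * b2) * g1 = b1 * (u * g1 + v * g2)" "(u * b1 + v * b2) * g2 = b2 * (u * g1 + v * g2)"
      using gb by algebra+
    then show ?thesis using that[of g1 g2 d "u * b1 + v * b2"] g uv False by (auto simp: mult.commute)
  qed
  let ?\<gamma> = "Complex (2 * pi * g1) (2 * pi * g2)"
  have "?\<gamma> \<in> lattice" unfolding lattice_def by blast
  moreover have "?\<gamma> \<noteq> 0" using g(1) by (auto simp: complex_eq_iff)
  moreover have "\<alpha> = of_int k * ?\<gamma>" "\<beta> = of_int l * ?\<gamma>"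
    by (simp_all add: ab g complex_eq_iff)
  ultimately show ?thesis using periods_not_dependent by blast
qed

end

section \<open>Lifted tilings\<close>

lemma corner4: "corner 4 j = cis (pi / 2 * real j)"
  by (simp add: corner_def field_simps)

lemma side4: "side 4 j = (\<lambda>s. cis (pi / 2 * (real j + s))) ` {0<..<1}"
proof -
  have "{2 * pi * real j / real 4 <..< 2 * pi * real (j + 1) / real 4} = (\<lambda>s. pi / 2 * (real j + s)) ` {0<..<1}"
  proof safe
    fix x assume "x \<in> {2 * pi * real j / real 4 <..< 2 * pi * real (j + 1) / real 4}"
    then show "x \<in> (\<lambda>s. pi / 2 * (real j + s)) ` {0<..<1}"
      by (intro image_eqI[of _ _ "2 * x / pi - real j"]) (auto simp: field_simps)
  next
    fix s :: real assume "s \<in> {0<..<1}"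
    then show "pi / 2 * (real j + s) \<in> {2 * pi * real j / real 4 <..< 2 * pi * real (j + 1) / real 4}"
      by (auto simp: field_simps)
  qed
  then show ?thesis by (simp add: side_def image_image)
qed

lemma cis_quarter_add4: "cis (pi / 2 * (x + 4)) = cis (pi / 2 * x)"
proof -
  have eq: "pi / 2 * (x + 4) = pi / 2 * x + 2 * pi" by (simp add: field_simps)
  show ?thesis unfolding eq by (rule cis_add_2pi)
qed

lemma corner4_add4 [simp]: "corner 4 (j + 4) = corner 4 j"
  using cis_quarter_add4[of "real j"] by (simp add: corner4)

lemma side4_add4 [simp]: "side 4 (j + 4) = side 4 j"
proof -
  have "cis (pi / 2 * (real (j + 4) + s)) = cis (pi / 2 * (real j + s))" for s
    using cis_quarter_add4[of "real j + s"] by (simp add: algebra_simps)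
  then show ?thesis by (simp add: side4)
qed

lemma mod4_eq: "(\<And>j. P (j + 4) = P j) \<Longrightarrow> P (j mod 4) = P (j::nat)"
proof -
  assume P: "\<And>j. P (j + 4) = P j"
  have "P (r + 4 * k) = P r" for r k
    by (induction k) (use P[of "r + 4 * _"] in \<open>simp_all add: algebra_simps\<close>)
  from this[of "j mod 4" "j div 4"] show ?thesis by simp
qed

lemma corner4_mod [simp]: "corner 4 (j mod 4) = corner 4 j"
  by (rule mod4_eq) auto

lemma side4_mod [simp]: "side 4 (j mod 4) = side 4 j"
  by (rule mod4_eq) auto

lemma cis_quarter_inj:
  assumes "cis (pi / 2 * (real j + s)) = cis (pi / 2 * (real j' + s'))" "j < 4" "j' < 4" "s \<in> {0..<1}" "s' \<in> {0..<1}"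
  shows "j = j' \<and> s = s'"
proof -
  obtain n :: int where "pi / 2 * (real j + s) = pi / 2 * (real j' + s') + 2 * pi * n"
    using assms(1) unfolding cis_eq_iff by blast
  then have "pi / 2 * (real j + s) = pi / 2 * (real j' + s' + 4 * n)"
    by (simp add: algebra_simps)
  then have eq: "real j + s = real j' + s' + 4 * n" by simp
  have "real j \<le> 3" "real j' \<le> 3" using assms(2,3) by auto
  then have "real_of_int n < 1" "real_of_int n > -1" using eq assms(4,5) by auto
  then have "n = 0" by linarith
  then have eq': "real j + s = real j' + s'" using eq by simp
  then have "real j < real j' + 1" "real j' < real j + 1" using assms(4,5) by auto
  then have "j = j'" by linarith
  then show ?thesis using eq' by simp
qed

lemma sphere_quarters:
  assumes "q \<in> sphere (0::complex) 1"
  obtains j s where "j < 4" "s \<in> {0..<1}" "q = cis (pi / 2 * (real j + s))"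
proof -
  define x where "x = Arg2pi q * 2 / pi"
  have q: "q = cis (Arg2pi q)"
    using assms Arg2pi_eq[of q] by (simp add: cis_conv_exp)
  have x: "0 \<le> x" "x < 4"
    using Arg2pi_ge_0[of q] Arg2pi_lt_2pi[of q] by (auto simp: x_def field_simps)
  define j where "j = nat \<lfloor>x\<rfloor>"
  have j: "real j = of_int \<lfloor>x\<rfloor>" using x by (simp add: j_def)
  show ?thesis
  proof
    show "j < 4" unfolding j_def using x by linarith
    show "x - real j \<in> {0..<1}" unfolding j by (simp) linarith
    have "pi / 2 * (real j + (x - real j)) = Arg2pi q" by (simp add: x_def)
    then show "q = cis (pi / 2 * (real j + (x - real j)))" using q by simp
  qed
qed

lemma image_closed_interval:
  fixes p :: "real \<Rightarrow> 'a::t2_space"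
  assumes "continuous_on {0..1} p"
  shows "p ` {0..1} = closure (p ` {0<..<1})"
proof
  have "p ` closure {0<..<1} \<subseteq> closure (p ` {0<..<1})"
    by (rule image_closure_subset) (use assms in \<open>auto simp: closure_subset\<close>)
  then show "p ` {0..1} \<subseteq> closure (p ` {0<..<1})" by simp
  show "closure (p ` {0<..<1}) \<subseteq> p ` {0..1}"
    by (rule closure_minimal) (use compact_imp_closed[OF compact_continuous_image[OF assms]] in auto)
qed

text \<open>An edge can be recovered from its open part, so the image of an open side of a polygon
  determines the edge.\<close>

lemma edge_closure:
  fixes p :: "real \<Rightarrow> 'a::t2_space"
  assumes "traverses V e p"
  shows "e = closure (e - V)"
proof -
  have "continuous_on {0..1} p" "p ` {0..1} = e"
    using assms by (auto simp: traverses_def path_image_def path_def dest: simple_path_imp_path)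
  then show ?thesis using image_closed_interval traverses_interior(1)[OF assms] by metis
qed

definition dpath :: "bool \<Rightarrow> (real \<Rightarrow> 'a::topological_space) \<Rightarrow> real \<Rightarrow> 'a" where
  "dpath b p = (if b then p else reversepath p)"

text \<open>\<open>\<Gamma>\<close> and \<open>L\<close> are lifts to the plane of the edges \<open>\<gamma>\<close> and of the polygon maps \<open>F\<close>.\<close>

locale tiling_maps =
  fixes V :: "(complex \<times> complex) set" and E :: "(complex \<times> complex) set set"
    and F :: "(complex \<times> complex) set \<Rightarrow> complex \<Rightarrow> complex \<times> complex"
    and \<gamma> :: "(complex \<times> complex) set \<Rightarrow> real \<Rightarrow> complex \<times> complex"
    and \<Gamma> :: "(complex \<times> complex) set \<Rightarrow> real \<Rightarrow> complex"
    and L :: "(complex \<times> complex) set \<Rightarrow> complex \<Rightarrow> complex"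
  assumes graph: "embedded_graph torus V E"
    and deg: "\<And>v. v \<in> V \<Longrightarrow> degree V E v \<ge> 3"
    and F: "\<And>t. t \<in> tiles torus V E \<Longrightarrow> polygon_map V E t 4 (F t)"
    and \<gamma>: "\<And>e. e \<in> E \<Longrightarrow> traverses V e (\<gamma> e)"
    and \<Gamma>: "\<And>e. e \<in> E \<Longrightarrow> path (\<Gamma> e)"
    and cov_\<Gamma>: "\<And>e s. e \<in> E \<Longrightarrow> s \<in> {0..1} \<Longrightarrow> cov (\<Gamma> e s) = \<gamma> e s"
    and contL: "\<And>t. t \<in> tiles torus V E \<Longrightarrow> continuous_on (cball 0 1) (L t)"
    and cov_L: "\<And>t q. t \<in> tiles torus V E \<Longrightarrow> q \<in> cball 0 1 \<Longrightarrow> cov (L t q) = F t q"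
begin

abbreviation "T \<equiv> tiles torus V E"
abbreviation "Gr \<equiv> V \<union> \<Union>E"
abbreviation "bp t j s \<equiv> F t (cis (pi / 2 * (real j + s)))"

lemma finiteV: "finite V" and finiteE: "finite E" and V_torus: "V \<subseteq> torus" and E_torus: "\<Union>E \<subseteq> torus"
  and edges_meet: "\<And>e e'. e \<in> E \<Longrightarrow> e' \<in> E \<Longrightarrow> e \<noteq> e' \<Longrightarrow> e \<inter> e' \<subseteq> V"
  using graph by (auto simp: embedded_graph_def)

lemma contF: "t \<in> T \<Longrightarrow> continuous_on (cball 0 1) (F t)"
  using F by (simp add: polygon_map_def)

lemma F_ball: assumes "t \<in> T" shows "F t ` ball 0 1 = t" "inj_on (F t) (ball 0 1)"
proof -
  obtain g where g: "homeomorphism (ball 0 1) t (F t) g"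
    using F[OF assms] by (auto simp: polygon_map_def)
  then show "F t ` ball 0 1 = t" by (simp add: homeomorphism_def)
  show "inj_on (F t) (ball 0 1)"
    using g by (metis homeomorphism_apply1 inj_on_inverseI)
qed

lemma F_corner: assumes "t \<in> T" shows "F t (corner 4 j) \<in> V"
proof -
  have "\<forall>k\<in>{1..4}. F t (corner 4 k) \<in> V"
    using F[OF assms] by (simp add: polygon_map_def)
  moreover have "j mod 4 \<in> {1..4} \<or> j mod 4 + 4 \<in> {1..4}" by auto
  moreover have "corner 4 (j mod 4 + 4) = corner 4 j" by simp
  ultimately show ?thesis by (metis corner4_mod)
qed

lemma F_side: assumes "t \<in> T"
  obtains e g where "e \<in> E" "homeomorphism (side 4 j) (e - V) (F t) g"
proof -
  have "\<forall>k\<in>{1..4}. \<exists>e\<in>E. \<exists>g. homeomorphism (side 4 k) (e - V) (F t) g"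
    using F[OF assms] by (simp add: polygon_map_def)
  moreover have "j mod 4 \<in> {1..4} \<or> j mod 4 + 4 \<in> {1..4}" by auto
  moreover have "side 4 (j mod 4 + 4) = side 4 j" by simp
  ultimately show ?thesis using that by (metis side4_mod)
qed

lemma cont_bp: "t \<in> T \<Longrightarrow> continuous_on {0..1} (bp t j)"
  by (rule continuous_on_compose2[OF contF]) (auto intro!: continuous_intros)

text \<open>A polygon map is controlled only on open sides. Passing to closures adds the images of
  the two corners; these lie in \<open>V\<close> while the open edge does not meet \<open>V\<close>,
  so the closed side is traversed simply, with a coincidence at most of its two ends.\<close>

lemma traverses_bp:
  assumes t: "t \<in> T" and e: "e \<in> E" "F t ` side 4 j = e - V"
  shows "traverses V e (bp t j)"
proof -
  obtain e' g where e': "e' \<in> E" "homeomorphism (side 4 j) (e' - V) (F t) g"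
    using F_side[OF t] .
  have im: "bp t j ` {0<..<1} = e - V"
    using e by (simp add: side4 image_image)
  have inj: "inj_on (bp t j) {0<..<1}"
  proof (rule inj_onI)
    fix x y :: real assume xy: "x \<in> {0<..<1}" "y \<in> {0<..<1}" "bp t j x = bp t j y"
    moreover have "inj_on (F t) (side 4 j)"
      using e'(2) by (metis homeomorphism_apply1 inj_on_inverseI)
    ultimately have "cis (pi / 2 * (real j + x)) = cis (pi / 2 * (real j + y))"
      unfolding side4 by (auto simp: inj_on_def)
    then have "cis (pi / 2 * real j) * cis (pi / 2 * x) = cis (pi / 2 * real j) * cis (pi / 2 * y)"
      by (simp add: cis_mult distrib_left)
    then have "cis (pi / 2 * (real 0 + x)) = cis (pi / 2 * (real 0 + y))" by simp
    then show "x = y" using cis_quarter_inj[of 0 x 0 y] xy by auto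
  qed
  have e_cl: "e = bp t j ` {0..1}"
    using image_closed_interval[OF cont_bp[OF t]] edge_closure[OF \<gamma>[OF e(1)]] im by metis
  have ends: "bp t j 0 \<in> V" "bp t j 1 \<in> V"
    using F_corner[OF t, of j] F_corner[OF t, of "j + 1"] by (simp_all add: corner4 add.commute)
  have notV: "bp t j s \<notin> V" if "s \<in> {0<..<1}" for s
    using im that by blast
  have "x = y \<or> x = 0 \<and> y = 1 \<or> x = 1 \<and> y = 0" if "x \<in> {0..1}" "y \<in> {0..1}" "bp t j x = bp t j y" for x y
  proof -
    have c: "s = 0 \<or> s = 1 \<or> s \<in> {0<..<1}" if "s \<in> {0..1}" for s :: real using that by auto
    show ?thesis
    proof (cases "x \<in> {0<..<1} \<and> y \<in> {0<..<1}")
      case True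
      then show ?thesis using inj that(3) by (auto simp: inj_on_def)
    next
      case False
      have "x \<notin> {0<..<1}" "y \<notin> {0<..<1}"
        using False notV[of x] notV[of y] ends that c[of x] c[of y] by metis+
      then show ?thesis using c[of x] c[of y] that by blast
    qed
  qed
  then have "simple_path (bp t j)"
    using cont_bp[OF t] by (auto simp: simple_path_def loop_free_def path_def)
  moreover have "e \<inter> V = {bp t j 0, bp t j 1}"
  proof
    show "e \<inter> V \<subseteq> {bp t j 0, bp t j 1}"
    proof
      fix y assume y: "y \<in> e \<inter> V"
      then obtain s where s: "s \<in> {0..1}" "y = bp t j s" using e_cl by blast
      then have "s = 0 \<or> s = 1" using notV[of s] y by fastforce
      then show "y \<in> {bp t j 0, bp t j 1}" using s by auto
    qed
    show "{bp t j 0, bp t j 1} \<subseteq> e \<inter> V"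
      using e_cl ends by (auto intro: image_eqI[of _ _ 0] image_eqI[of _ _ 1])
  qed
  ultimately show ?thesis
    using e_cl by (simp add: traverses_def path_image_def pathstart_def pathfinish_def)
qed

lemma tile_disjoint_graph: "t \<in> T \<Longrightarrow> t \<inter> Gr = {}"
  and tile_torus: "t \<in> T \<Longrightarrow> t \<subseteq> torus"
  using in_components_subset[of t "torus - Gr"] by (auto simp: tiles_def)

lemma tiles_disjoint: "t \<in> T \<Longrightarrow> t' \<in> T \<Longrightarrow> t \<inter> t' \<noteq> {} \<Longrightarrow> t = t'"
  using components_eq by (auto simp: tiles_def)

lemma Union_tiles: "\<Union>T = torus - Gr"
  by (simp add: tiles_def Union_components)

lemma F_sphere: assumes "t \<in> T" "q \<in> sphere 0 1" shows "F t q \<in> Gr"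
proof -
  obtain j s where q: "s \<in> {0..<1}" "q = cis (pi / 2 * (real j + s))"
    using sphere_quarters[OF assms(2)] by blast
  obtain e g where e: "e \<in> E" "homeomorphism (side 4 j) (e - V) (F t) g"
    using F_side[OF assms(1)] .
  show ?thesis
  proof (cases "s = 0")
    case True
    then show ?thesis using F_corner[OF assms(1), of j] q by (simp add: corner4)
  next
    case False
    then have "q \<in> side 4 j" using q by (auto simp: side4)
    then have "F t q \<in> e - V" using e(2) by (auto simp: homeomorphism_def)
    then show ?thesis using e(1) by blast
  qed
qed

lemma F_torus: assumes "t \<in> T" "q \<in> cball 0 1" shows "F t q \<in> torus"
proof (cases "q \<in> ball 0 1")
  case True
  then show ?thesis using F_ball(1)[OF assms(1)] tile_torus[OF assms(1)] by blast
next
  case False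
  then have "F t q \<in> Gr" using assms F_sphere by auto
  then show ?thesis using V_torus E_torus by blast
qed

lemma F_eqD:
  assumes "t \<in> T" "t' \<in> T" "q \<in> ball 0 1" "q' \<in> cball 0 1" "F t q = F t' q'"
  shows "t = t' \<and> q = q'"
proof -
  have t: "F t q \<in> t" using F_ball(1) assms by blast
  have "q' \<in> ball 0 1"
  proof (rule ccontr)
    assume "q' \<notin> ball 0 1"
    then have "F t' q' \<in> Gr" using assms F_sphere by auto
    then show False using t tile_disjoint_graph[OF assms(1)] assms(5) by auto
  qed
  then have "F t' q' \<in> t'" using F_ball(1) assms by blast
  then have "t = t'" using tiles_disjoint[OF assms(1,2)] t assms(5) by auto
  then show ?thesis using F_ball(2)[OF assms(1)] assms \<open>q' \<in> ball 0 1\<close> by (auto simp: inj_on_def)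
qed

text \<open>Consequently all translates of all lifted open tiles are pairwise disjoint and disjoint
  from every lifted tile boundary, however degenerate the tiles are on the torus.\<close>

lemma L_eqD:
  assumes "t \<in> T" "t' \<in> T" "q \<in> ball 0 1" "q' \<in> cball 0 1" "a \<in> lattice" "b \<in> lattice" "L t q + a = L t' q' + b"
  shows "t = t' \<and> q = q' \<and> a = b"
proof -
  have "cov (L t q + a) = cov (L t' q' + b)" using assms(7) by simp
  moreover have "cov (L t q) = F t q" "cov (L t' q') = F t' q'"
    using assms by (auto intro: cov_L)
  ultimately have "F t q = F t' q'" using assms(5,6) by simp
  then have "t = t' \<and> q = q'" using F_eqD assms by blast
  then show ?thesis using assms(7) by simp
qed

lemma L_inj: "t \<in> T \<Longrightarrow> inj_on (L t) (ball 0 1)"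
  by (rule inj_onI) (metis L_eqD ball_subset_cball lattice_0 subsetD)

lemma L_disj: "t \<in> T \<Longrightarrow> L t ` ball 0 1 \<inter> L t ` sphere 0 1 = {}"
proof -
  assume t: "t \<in> T"
  have False if "q \<in> ball 0 1" "q' \<in> sphere 0 1" "L t q = L t q'" for q q'
    using L_eqD[OF t t that(1) _ lattice_0 lattice_0, of q'] that by auto
  then show ?thesis unfolding disjoint_iff image_iff by metis
qed

text \<open>The sign tells whether the lifted polygon map keeps or reverses the orientation of the
  plane. Polygon maps may reflect the labels, so it varies from tile to tile; starting angle 0 and
  the centre of the disc are arbitrary choices.\<close>

definition ori :: "(complex \<times> complex) set \<Rightarrow> complex" where
  "ori t = winding_number (L t \<circ> arcp 0 (0 + 2 * pi)) (L t 0)"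

lemma ori: assumes "t \<in> T"
  shows "ori t = 1 \<or> ori t = -1"
    "q \<in> ball 0 1 \<Longrightarrow> winding_number (L t \<circ> arcp a (a + 2 * pi)) (L t q) = ori t"
proof -
  obtain \<epsilon> :: complex where eps: "\<epsilon> = 1 \<or> \<epsilon> = -1"
    "\<And>a q. q \<in> ball 0 1 \<Longrightarrow> winding_number (L t \<circ> arcp a (a + 2 * pi)) (L t q) = \<epsilon>"
    by (rule disc_winding[OF contL L_inj L_disj, OF assms assms assms]) (rule that)
  have "ori t = \<epsilon>" unfolding ori_def by (rule eps(2)) simp
  then show "ori t = 1 \<or> ori t = -1"
    "q \<in> ball 0 1 \<Longrightarrow> winding_number (L t \<circ> arcp a (a + 2 * pi)) (L t q) = ori t"
    using eps by auto
qed

text \<open>After a reparametrization on the torus, \<open>r\<close> and the reference lift of the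
  edge, possibly reversed, are two lifts of one path, and such lifts differ by a lattice
  constant.\<close>

lemma traversal_lift:
  assumes e: "e \<in> E" and q: "traverses V e q" and r: "continuous_on {0..1} r" "\<And>s. s \<in> {0..1} \<Longrightarrow> cov (r s) = q s"
  obtains sg h a where "continuous_on UNIV h" "strict_mono h" "h 0 = (0::real)" "h 1 = 1" "a \<in> lattice"
    "\<And>s. s \<in> {0..1} \<Longrightarrow> r s + a = dpath sg (\<Gamma> e) (h s)"
proof -
  obtain g h where h: "g = \<gamma> e \<or> g = reversepath (\<gamma> e)" "continuous_on UNIV h" "strict_mono h"
    "h 0 = (0::real)" "h 1 = 1" "\<And>s. s \<in> {0..1} \<Longrightarrow> q s = g (h s)"
    by (rule traverses_reparametrize[OF \<gamma>[OF e] q]) (rule that)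
  obtain sg where sg: "g = dpath sg (\<gamma> e)"
    using h(1) by (metis dpath_def)
  have h01: "h s \<in> {0..1}" if "s \<in> {0..1}" for s
    using that h strict_mono_less_eq[OF h(3)] by (metis atLeastAtMost_iff)
  have d01: "cov (dpath sg (\<Gamma> e) s) = dpath sg (\<gamma> e) s" if "s \<in> {0..1}" for s
    using that cov_\<Gamma>[OF e] by (auto simp: dpath_def reversepath_def)
  have cd: "continuous_on {0..1} (dpath sg (\<Gamma> e))"
    using \<Gamma>[OF e] path_reversepath[of "\<Gamma> e"] by (cases sg) (simp_all add: dpath_def path_def)
  obtain a where a: "a \<in> lattice" "\<And>s. s \<in> {0..1::real} \<Longrightarrow> dpath sg (\<Gamma> e) (h s) = r s + a"
  proof (rule lifts_differ_by_lattice[of "{0..1::real}" "\<lambda>s. dpath sg (\<Gamma> e) (h s)" r])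
    show "continuous_on {0..1} (\<lambda>s. dpath sg (\<Gamma> e) (h s))"
      by (rule continuous_on_compose2[OF cd continuous_on_subset[OF h(2)]])
        (use h01 in \<open>auto simp del: atLeastAtMost_iff\<close>)
    show "cov (dpath sg (\<Gamma> e) (h s)) = cov (r s)" if "s \<in> {0..1}" for s
      using that h(6)[OF that] d01[OF h01[OF that]] r(2) sg by simp
  qed (auto intro: that r)
  show ?thesis
    by (rule that[OF h(2-5) a(1)], rule sym, erule a(2))
qed

lemma side_param:
  assumes t: "t \<in> T"
  obtains e sg h a where "e \<in> E" "F t ` side 4 j = e - V" "continuous_on UNIV h" "strict_mono h"
    "h 0 = (0::real)" "h 1 = 1" "a \<in> lattice"
    "\<And>s. s \<in> {0..1} \<Longrightarrow> L t (cis (pi / 2 * (real j + s))) + a = dpath sg (\<Gamma> e) (h s)"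
proof -
  obtain e g where e: "e \<in> E" "homeomorphism (side 4 j) (e - V) (F t) g"
    using F_side[OF t] .
  then have e2: "F t ` side 4 j = e - V" by (simp add: homeomorphism_def)
  show ?thesis
  proof (rule traversal_lift[OF e(1) traverses_bp[OF t e(1) e2]])
    show "continuous_on {0..1} (\<lambda>s. L t (cis (pi / 2 * (real j + s))))"
      by (rule continuous_on_compose2[OF contL[OF t]]) (auto intro!: continuous_intros)
    show "cov (L t (cis (pi / 2 * (real j + s)))) = bp t j s" for s
      using cov_L[OF t] by simp
  qed (rule that[OF e(1) e2])
qed

end

text \<open>Side \<open>j\<close> of tile \<open>t\<close> lies on the edge \<open>ed t j\<close>, runs along it in the direction \<open>sg t j\<close> with
  reparametrization \<open>hh t j\<close>, and its lift is moved onto the lift of the edge by \<open>lam t j\<close>.\<close>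

locale lifted_tiling = tiling_maps +
  fixes ed :: "(complex \<times> complex) set \<Rightarrow> nat \<Rightarrow> (complex \<times> complex) set"
    and sg :: "(complex \<times> complex) set \<Rightarrow> nat \<Rightarrow> bool"
    and hh :: "(complex \<times> complex) set \<Rightarrow> nat \<Rightarrow> real \<Rightarrow> real"
    and lam :: "(complex \<times> complex) set \<Rightarrow> nat \<Rightarrow> complex"
  assumes ed: "\<And>t j. t \<in> T \<Longrightarrow> ed t j \<in> E" "\<And>t j. t \<in> T \<Longrightarrow> F t ` side 4 j = ed t j - V"
    and hh: "\<And>t j. t \<in> T \<Longrightarrow> continuous_on UNIV (hh t j)" "\<And>t j. t \<in> T \<Longrightarrow> strict_mono (hh t j)"
      "\<And>t j. t \<in> T \<Longrightarrow> hh t j 0 = 0" "\<And>t j. t \<in> T \<Longrightarrow> hh t j 1 = 1"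
    and lam: "\<And>t j. t \<in> T \<Longrightarrow> lam t j \<in> lattice"
    and L_side: "\<And>t j s. t \<in> T \<Longrightarrow> s \<in> {0..1} \<Longrightarrow>
      L t (cis (pi / 2 * (real j + s))) + lam t j = dpath (sg t j) (\<Gamma> (ed t j)) (hh t j s)"

text \<open>The polygon maps \<open>F\<close> are left to the caller, because a given subdivision
  brings its own maps, and so does a given tile of type \<open>Q13_24\<close>.\<close>

lemma lifted_tiling_exists:
  assumes "quadrilateral_tiling torus V E" "\<And>t. t \<in> tiles torus V E \<Longrightarrow> polygon_map V E t 4 (F t)"
  obtains \<gamma> \<Gamma> L ed sg hh lam where "lifted_tiling V E F \<gamma> \<Gamma> L ed sg hh lam"
proof -
  let ?T = "tiles torus V E"
  have graph: "embedded_graph torus V E" and deg: "\<forall>v\<in>V. degree V E v \<ge> 3"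
    using assms(1) by (auto simp: quadrilateral_tiling_def tiling_def)
  have VE: "V \<subseteq> torus" "\<Union>E \<subseteq> torus"
    using graph by (simp_all only: embedded_graph_def)
  define \<gamma> where "\<gamma> e = (SOME p. traverses V e p)" for e
  have \<gamma>: "traverses V e (\<gamma> e)" if "e \<in> E" for e
  proof -
    have "\<forall>e\<in>E. \<exists>p. traverses V e p" using graph unfolding embedded_graph_def by (elim conjE)
    then show ?thesis unfolding \<gamma>_def using that someI_ex by metis
  qed
  have "\<exists>G. path G \<and> (\<forall>s\<in>{0..1}. cov (G s) = \<gamma> e s)" if "e \<in> E" for e
  proof -
    have g: "continuous_on {0..1} (\<gamma> e)" "\<gamma> e ` {0..1} \<subseteq> torus"
      using \<gamma>[OF that] that VE(2)
      by (auto simp: traverses_def path_image_def path_def dest: simple_path_imp_path)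
    obtain G where "continuous_on {0..1} G" "\<And>x. x \<in> {0..1} \<Longrightarrow> cov (G x) = \<gamma> e x"
      using cov_lift[OF g convex_imp_contractible[OF convex_real_interval(5)]] by metis
    then show ?thesis by (auto simp: path_def)
  qed
  then obtain \<Gamma> where \<Gamma>: "\<And>e. e \<in> E \<Longrightarrow> path (\<Gamma> e) \<and> (\<forall>s\<in>{0..1}. cov (\<Gamma> e s) = \<gamma> e s)" by metis
  have F_t: "F t q \<in> torus" if t: "t \<in> ?T" and q: "q \<in> cball 0 1" for t q
  proof (cases "q \<in> ball 0 1")
    case True
    then have "F t q \<in> t" using assms(2)[OF t] by (auto simp: polygon_map_def homeomorphism_def)
    then show ?thesis using t in_components_subset unfolding tiles_def by blast
  next
    case False
    then have "q \<in> sphere 0 1" using q by auto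
    then obtain j s where js: "j < 4" "s \<in> {0..<1}" "q = cis (pi / 2 * (real j + s))"
      using sphere_quarters by blast
    \<comment> \<open>Sides are numbered 0 to 3 here, whereas \<open>polygon_map\<close> speaks of 1
      to 4; index 0 is index 4.\<close>
    define k where "k = (if j = 0 then 4 else j)"
    have k: "k \<in> {1..4}" "corner 4 k = corner 4 j" "side 4 k = side 4 j"
      using js(1) corner4_add4[of 0] side4_add4[of 0] by (auto simp: k_def)
    then have "F t (corner 4 j) \<in> V" "\<exists>e\<in>E. \<exists>g. homeomorphism (side 4 j) (e - V) (F t) g"
      using assms(2)[OF t] unfolding polygon_map_def by metis+
    moreover have "q = corner 4 j \<or> q \<in> side 4 j"
      using js by (cases "s = 0") (auto simp: corner4 side4)
    moreover have "\<exists>e\<in>E. F t ` side 4 j = e - V"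
      using calculation(2) by (metis homeomorphism_image1)
    ultimately have "F t q \<in> V \<or> F t q \<in> \<Union>E" by (metis DiffD1 UnionI imageI)
    then show ?thesis using VE by blast
  qed
  have "\<exists>G. continuous_on (cball 0 1) G \<and> (\<forall>q\<in>cball 0 1. cov (G q) = F t q)" if t: "t \<in> ?T" for t
  proof -
    have f: "continuous_on (cball 0 1) (F t)" "F t ` cball 0 1 \<subseteq> torus"
      using assms(2)[OF t] F_t[OF t] by (auto simp: polygon_map_def)
    obtain G where "continuous_on (cball 0 1) G" "\<And>x. x \<in> cball 0 1 \<Longrightarrow> cov (G x) = F t x"
      using cov_lift[OF f convex_imp_contractible[OF convex_cball]] by metis
    then show ?thesis by auto
  qed
  then obtain L where L: "\<And>t. t \<in> ?T \<Longrightarrow> continuous_on (cball 0 1) (L t) \<and> (\<forall>q\<in>cball 0 1. cov (L t q) = F t q)" by metis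
  interpret tiling_maps V E F \<gamma> \<Gamma> L
    by unfold_locales (use graph deg assms(2) \<gamma> \<Gamma> L in auto)
  have "\<exists>e sg h a. t \<in> ?T \<longrightarrow> (e \<in> E \<and> F t ` side 4 j = e - V \<and> continuous_on UNIV h \<and> strict_mono h \<and>
    h 0 = (0::real) \<and> h 1 = 1 \<and> a \<in> lattice \<and>
    (\<forall>s\<in>{0..1}. L t (cis (pi / 2 * (real j + s))) + a = dpath sg (\<Gamma> e) (h s)))" for t j
    by (cases "t \<in> ?T") (use side_param[of t j] in metis)+
  then obtain ed sg hh lam where "\<And>t j. t \<in> ?T \<longrightarrow> (ed t j \<in> E \<and> F t ` side 4 j = ed t j - V \<and> continuous_on UNIV (hh t j) \<and>
    strict_mono (hh t j) \<and> hh t j 0 = (0::real) \<and> hh t j 1 = 1 \<and> lam t j \<in> lattice \<and>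
    (\<forall>s\<in>{0..1}. L t (cis (pi / 2 * (real j + s))) + lam t j = dpath (sg t j) (\<Gamma> (ed t j)) (hh t j s)))"
    by metis
  then have "lifted_tiling V E F \<gamma> \<Gamma> L ed sg hh lam"
    by unfold_locales auto
  then show ?thesis using that by blast
qed

section \<open>The two sides of an edge\<close>

lemma finite_uniform_radius:
  fixes P :: "'a \<Rightarrow> real \<Rightarrow> bool"
  assumes "finite S" "\<And>x. x \<in> S \<Longrightarrow> \<exists>d>0. P x d" "\<And>x d d'. P x d \<Longrightarrow> d' \<le> d \<Longrightarrow> P x d'"
  obtains d where "d > 0" "\<And>x. x \<in> S \<Longrightarrow> P x d"
proof -
  obtain f where f: "\<And>x. x \<in> S \<Longrightarrow> f x > 0 \<and> P x (f x)" using assms(2) by metis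
  let ?d = "Min (insert 1 (f ` S))"
  have "?d > 0" using assms(1) f by auto
  moreover have "P x ?d" if "x \<in> S" for x
    using assms(1,3) f that by (meson Min_le finite.insertI finite_imageI imageI insertI2)
  ultimately show ?thesis using that by blast
qed

lemma interior_finite_Union_empty:
  fixes f :: "'i \<Rightarrow> 'a::topological_space set"
  assumes "finite I" "\<And>i. i \<in> I \<Longrightarrow> closed (f i)" "\<And>i. i \<in> I \<Longrightarrow> interior (f i) = {}"
  shows "interior (\<Union>i\<in>I. f i) = {}"
  using assms
proof (induction I rule: finite_induct)
  case (insert i I)
  have "interior (f i \<union> (\<Union>i\<in>I. f i)) = interior (f i)"
    by (rule interior_closed_Un_empty_interior) (use insert in auto)
  then show ?case using insert by simp
qed auto

lemma cis_quarter_mod: "cis (pi / 2 * (real (k mod 4) + s)) = cis (pi / 2 * (real k + s))"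
proof (rule mod4_eq)
  show P: "cis (pi / 2 * (real (j + 4) + s)) = cis (pi / 2 * (real j + s))" for j
    using cis_quarter_add4[of "real j + s"] by (simp add: algebra_simps)
qed

lemma sphere_from_corner:
  assumes "q \<in> sphere (0::complex) 1"
  obtains u where "u \<in> {0..<4}" "q = cis (pi / 2 * (real j + u))"
proof -
  have "q * cis (- (pi / 2 * real j)) \<in> sphere 0 1" using assms by (simp add: norm_mult)
  then obtain k s where k: "k < 4" "s \<in> {0..<1}" "q * cis (- (pi / 2 * real j)) = cis (pi / 2 * (real k + s))"
    by (rule sphere_quarters)
  have "q = q * cis (- (pi / 2 * real j)) * cis (pi / 2 * real j)"
    by (simp add: mult.assoc cis_mult)
  also have "\<dots> = cis (pi / 2 * (real j + (real k + s)))"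
  proof -
    have "pi / 2 * (real k + s) + pi / 2 * real j = pi / 2 * (real j + (real k + s))"
      by (simp add: distrib_left)
    then show ?thesis unfolding k(3) by (simp only: cis_mult)
  qed
  finally have "q = cis (pi / 2 * (real j + (real k + s)))" .
  moreover have "real k + s \<in> {0..<4}"
  proof -
    have "real k \<le> 3" using k(1) by simp
    then show ?thesis using k(2) by auto
  qed
  ultimately show ?thesis using that by blast
qed

lemma corner4_sphere [simp]: "corner 4 j \<in> sphere 0 1" "norm (corner 4 j) = 1"
  by (simp_all add: corner4)

lemma at_within_ball_nontrivial: "p \<in> sphere (0::complex) 1 \<Longrightarrow> at p within ball 0 1 \<noteq> bot"
proof -
  assume p: "p \<in> sphere (0::complex) 1"
  then have "ball 0 1 - {p} = ball 0 1" by auto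
  then show ?thesis using p by (simp add: at_within_eq_bot_iff)
qed

context lifted_tiling
begin

text \<open>The side passes the point of its edge with parameter 1/2 here. This gives all sides of
  an edge one common point at which they can be compared; \<open>pt\<close> is the corresponding
  point on the boundary of the polygon.\<close>

definition mid :: "(complex \<times> complex) set \<Rightarrow> nat \<Rightarrow> real" where
  "mid t j = (SOME s. s \<in> {0<..<1} \<and> hh t j s = 1 / 2)"

definition pt :: "(complex \<times> complex) set \<Rightarrow> nat \<Rightarrow> complex" where
  "pt t j = cis (pi / 2 * (real j + mid t j))"

text \<open>The direction in which a side runs along its edge if the boundary of the lifted tile is oriented
  counterclockwise in the plane.\<close>

definition sn :: "(complex \<times> complex) set \<Rightarrow> nat \<Rightarrow> complex" where
  "sn t j = (if sg t j then ori t else - ori t)"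

text \<open>The sides that lie on \<open>e\<close>. They are pairs of a tile and an index, since
  both sides of an edge may belong to the same tile.\<close>

definition K :: "(complex \<times> complex) set \<Rightarrow> ((complex \<times> complex) set \<times> nat) set" where
  "K e = {(t, j). t \<in> T \<and> j < 4 \<and> ed t j = e}"

text \<open>The parameter is always counted along \<open>\<Gamma>\<close>, whichever way the side
  runs.\<close>

definition hho :: "(complex \<times> complex) set \<Rightarrow> nat \<Rightarrow> real \<Rightarrow> real" where
  "hho t j s = (if sg t j then hh t j s else 1 - hh t j s)"

lemma mid: assumes "t \<in> T" shows "0 < mid t j" "mid t j < 1" "hh t j (mid t j) = 1 / 2"
proof -
  obtain s where s: "0 \<le> s" "s \<le> 1" "hh t j s = 1 / 2"
    using IVT'[of "hh t j" 0 "1/2" 1] hh[OF assms, of j] continuous_on_subset[OF hh(1)[OF assms]] by auto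
  have "s \<noteq> 0" "s \<noteq> 1" using s(3) hh[OF assms, of j] by auto
  then have "\<exists>s. s \<in> {0<..<1} \<and> hh t j s = 1 / 2" using s by (intro exI[of _ s]) auto
  from someI_ex[OF this] show "0 < mid t j" "mid t j < 1" "hh t j (mid t j) = 1 / 2"
    unfolding mid_def by auto
qed

lemma hh_in: "t \<in> T \<Longrightarrow> s \<in> {0..1} \<Longrightarrow> hh t j s \<in> {0..1}"
  using hh(3,4)[of t j] strict_mono_less_eq[OF hh(2), of t j 0 s] strict_mono_less_eq[OF hh(2), of t j s 1]
  by auto

lemma hh_in': "t \<in> T \<Longrightarrow> s \<in> {0<..<1} \<Longrightarrow> hh t j s \<in> {0<..<1}"
  using hh(3,4)[of t j] strict_mono_less[OF hh(2), of t j 0 s] strict_mono_less[OF hh(2), of t j s 1]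
  by auto

lemma L_side': "t \<in> T \<Longrightarrow> s \<in> {0..1} \<Longrightarrow>
    L t (cis (pi / 2 * (real j + s))) + lam t j = \<Gamma> (ed t j) (hho t j s)"
  using L_side[of t s j] by (simp add: dpath_def hho_def reversepath_def)

lemma hho_in: "t \<in> T \<Longrightarrow> s \<in> {0..1} \<Longrightarrow> hho t j s \<in> {0..1}"
  using hh_in[of t s j] by (simp add: hho_def)

lemma hho_in': "t \<in> T \<Longrightarrow> s \<in> {0<..<1} \<Longrightarrow> hho t j s \<in> {0<..<1}"
  using hh_in'[of t s j] by (simp add: hho_def)

lemma hho_ends: "t \<in> T \<Longrightarrow> hho t j 0 = (if sg t j then 0 else 1)" "t \<in> T \<Longrightarrow> hho t j 1 = (if sg t j then 1 else 0)"
  using hh(3,4)[of t j] by (auto simp: hho_def)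

lemma bp_\<gamma>: assumes "t \<in> T" "s \<in> {0..1}" shows "bp t j s = \<gamma> (ed t j) (hho t j s)"
proof -
  have "cov (L t (cis (pi / 2 * (real j + s))) + lam t j) = cov (\<Gamma> (ed t j) (hho t j s))"
    using L_side'[OF assms] by simp
  then show ?thesis
    using cov_L[OF assms(1), of "cis (pi / 2 * (real j + s))"] cov_\<Gamma>[OF ed(1)[OF assms(1)] hho_in[OF assms]] lam[OF assms(1)]
    by simp
qed

lemma pt_sphere: "pt t j \<in> sphere 0 1" "pt t j \<in> cball 0 1"
  by (simp_all add: pt_def)

lemma pt_inj: "t \<in> T \<Longrightarrow> j < 4 \<Longrightarrow> j' < 4 \<Longrightarrow> pt t j = pt t j' \<Longrightarrow> j = j'"
  using cis_quarter_inj[of j "mid t j" j' "mid t j'"] mid[of t j] mid[of t j'] by (auto simp: pt_def)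

lemma hho_mid: "t \<in> T \<Longrightarrow> hho t j (mid t j) = 1 / 2"
  using mid(3)[of t j] by (simp add: hho_def)

lemma L_pt: assumes "t \<in> T" shows "L t (pt t j) + lam t j = \<Gamma> (ed t j) (1 / 2)"
  using L_side'[OF assms, of "mid t j" j] mid[OF assms, of j] hho_mid[OF assms, of j] by (simp add: pt_def)

lemma F_pt: assumes "t \<in> T" shows "F t (pt t j) = \<gamma> (ed t j) (1 / 2)"
  using bp_\<gamma>[OF assms, of "mid t j" j] mid[OF assms, of j] hho_mid[OF assms, of j] by (simp add: pt_def)

lemma \<gamma>_interior: assumes "e \<in> E" "s \<in> {0<..<1}" shows "\<gamma> e s \<in> e - V"
  using traverses_interior(1)[OF \<gamma>[OF assms(1)]] assms(2) by blast

lemma \<gamma>_inj: assumes "e \<in> E" "s \<in> {0<..<1}" "u \<in> {0..1}" "\<gamma> e u = \<gamma> e s" shows "u = s"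
proof (cases "u \<in> {0<..<1}")
  case True
  then show ?thesis using traverses_interior(2)[OF \<gamma>[OF assms(1)]] assms by (auto simp: inj_on_def)
next
  case False
  then have "u = 0 \<or> u = 1" using assms(3) by auto
  then have "\<gamma> e u \<in> V"
    using pathstart_traverses[OF \<gamma>[OF assms(1)]] pathfinish_traverses[OF \<gamma>[OF assms(1)]]
    by (auto simp: pathstart_def pathfinish_def)
  then show ?thesis using \<gamma>_interior[OF assms(1,2)] assms(4) by auto
qed

lemma edge_eqI: "e \<in> E \<Longrightarrow> e' \<in> E \<Longrightarrow> y \<in> e - V \<Longrightarrow> y \<in> e' \<Longrightarrow> e = e'"
  using edges_meet by blast

lemma edge_preimage:
  assumes "t \<in> T" "q \<in> cball 0 1" "e \<in> E" "F t q \<in> e - V"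
  obtains j s where "j < 4" "ed t j = e" "s \<in> {0<..<1}" "q = cis (pi / 2 * (real j + s))" "F t q = \<gamma> e (hho t j s)"
proof -
  have "q \<notin> ball 0 1"
    using F_ball(1)[OF assms(1)] tile_disjoint_graph[OF assms(1)] assms(3,4) by blast
  then have "q \<in> sphere 0 1" using assms(2) by auto
  then obtain j s where js: "j < 4" "s \<in> {0..<1}" "q = cis (pi / 2 * (real j + s))"
    by (rule sphere_quarters)
  have "s \<noteq> 0" using F_corner[OF assms(1), of j] assms(4) js by (auto simp: corner4)
  then have s: "s \<in> {0<..<1}" using js by auto
  then have "F t q \<in> ed t j - V" using ed(2)[OF assms(1), of j] js(3) unfolding side4 by blast
  then have "ed t j = e" using edge_eqI ed(1)[OF assms(1)] assms(3,4) by blast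
  then show ?thesis using that js s bp_\<gamma>[OF assms(1), of s j] by auto
qed

lemma vertex_preimage:
  assumes "t \<in> T" "q \<in> cball 0 1" "F t q \<in> V"
  obtains j where "j < 4" "q = corner 4 j"
proof -
  have "q \<notin> ball 0 1"
    using F_ball(1)[OF assms(1)] tile_disjoint_graph[OF assms(1)] assms(3) by blast
  then have "q \<in> sphere 0 1" using assms(2) by auto
  then obtain j s where js: "j < 4" "s \<in> {0..<1}" "q = cis (pi / 2 * (real j + s))"
    by (rule sphere_quarters)
  have "s = 0"
  proof (rule ccontr)
    assume "s \<noteq> 0"
    then have "q \<in> side 4 j" using js by (auto simp: side4)
    then show False using ed(2)[OF assms(1), of j] assms(3) by blast
  qed
  then show ?thesis using that js by (simp add: corner4)
qed

lemma mid_preimage: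
  assumes "t \<in> T" "q \<in> cball 0 1" "e \<in> E" "F t q = \<gamma> e (1 / 2)"
  obtains j where "(t, j) \<in> K e" "q = pt t j"
proof -
  have "\<gamma> e (1/2) \<in> e - V" using \<gamma>_interior[OF assms(3)] by simp
  then obtain j s where js: "j < 4" "ed t j = e" "s \<in> {0<..<1}" "q = cis (pi / 2 * (real j + s))" "F t q = \<gamma> e (hho t j s)"
    using edge_preimage[OF assms(1-3)] assms(4) by metis
  then have "hho t j s = 1 / 2"
    using \<gamma>_inj[OF assms(3), of "1/2" "hho t j s"] hho_in[OF assms(1), of s j] assms(4) by auto
  then have "hh t j s = hh t j (mid t j)" using mid[OF assms(1), of j] by (auto simp: hho_def split: if_splits)
  then have "s = mid t j" using strict_mono_eq[OF hh(2)[OF assms(1)]] by blast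
  then show ?thesis using that js assms(1) by (auto simp: K_def pt_def)
qed

lemma L_pt_tendsto:
  assumes "t \<in> T" shows "((\<lambda>q. L t q + lam t j) \<longlongrightarrow> \<Gamma> (ed t j) (1 / 2)) (at (pt t j) within ball 0 1)"
proof -
  have "(L t \<longlongrightarrow> L t (pt t j)) (at (pt t j) within ball 0 1)"
    using contL[OF assms] pt_sphere(2) by (metis ball_subset_cball continuous_on_def tendsto_within_subset)
  then have "((\<lambda>q. L t q + lam t j) \<longlongrightarrow> L t (pt t j) + lam t j) (at (pt t j) within ball 0 1)"
    by (intro tendsto_intros)
  then show ?thesis using L_pt[OF assms] by simp
qed

lemma L_notin_edge: assumes "t \<in> T" "q \<in> ball 0 1" "e \<in> E" "a \<in> lattice" shows "L t q + a \<notin> path_image (\<Gamma> e)"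
proof
  assume "L t q + a \<in> path_image (\<Gamma> e)"
  then obtain s where s: "s \<in> {0..1}" "L t q + a = \<Gamma> e s" by (auto simp: path_image_def)
  then have "cov (L t q + a) = cov (\<Gamma> e s)" by simp
  then have "F t q = \<gamma> e s" using cov_L[OF assms(1), of q] assms cov_\<Gamma>[OF assms(3) s(1)] by simp
  moreover have "\<gamma> e s \<in> e" using \<gamma>[OF assms(3)] s(1) by (auto simp: traverses_def path_image_def)
  moreover have "F t q \<in> t" using F_ball(1) assms by blast
  ultimately show False using tile_disjoint_graph[OF assms(1)] assms(3) by auto
qed

text \<open>The translated lift of \<open>t\<close> has the lifted edge on its boundary, so
  \<open>jump\<close> applies to it. The other side either belongs to the same lifted disc and is
  then a second boundary point over the middle of the edge, or it belongs to another lifted tile,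
  whose interior avoids the whole closed disc. In both cases it sees the value without the
  jump.\<close>

lemma jump_side:
  assumes "(t, j) \<in> K e" "(t', j') \<in> K e" "(t, j) \<noteq> (t', j')"
  obtains c where
    "((\<lambda>q. winding_number (\<Gamma> e) (L t q + lam t j)) \<longlongrightarrow> c + sn t j) (at (pt t j) within ball 0 1)"
    "((\<lambda>q. winding_number (\<Gamma> e) (L t' q + lam t' j')) \<longlongrightarrow> c) (at (pt t' j') within ball 0 1)"
proof -
  have t: "t \<in> T" "t' \<in> T" "j < 4" "j' < 4" "ed t j = e" "ed t' j' = e" "e \<in> E"
    using assms ed(1) by (auto simp: K_def)
  define G where "G = (\<lambda>q. L t q + lam t j)"
  define r where "r = dpath (sg t j) (\<Gamma> e)"
  \<comment> \<open>For different tiles the antipode is only a placeholder; any boundary point other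
    than \<open>pt t j\<close> would do.\<close>
  define p' where "p' = (if t = t' then pt t' j' else - pt t j)"
  have p': "p' \<in> sphere 0 1" "p' \<noteq> pt t j"
  proof -
    show "p' \<in> sphere 0 1" using pt_sphere by (auto simp: p'_def)
    have "pt t j \<noteq> 0" using pt_sphere[of t j] by auto
    then show "p' \<noteq> pt t j" using pt_inj[OF t(1,3,4)] assms(3) by (auto simp: p'_def)
  qed
  have rhalf: "r (1 / 2) = \<Gamma> e (1 / 2)" by (simp add: r_def dpath_def reversepath_def)
  have path_r: "path r" using \<Gamma>[OF t(7)] by (simp add: r_def dpath_def)
  have "\<exists>c. ((\<lambda>q. winding_number r (G q)) \<longlongrightarrow> c + ori t) (at (pt t j) within ball 0 1) \<and>
    (G p' = r (1 / 2) \<longrightarrow> ((\<lambda>q. winding_number r (G q)) \<longlongrightarrow> c) (at p' within ball 0 1)) \<and>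
    (\<forall>f (F :: complex filter). (f \<longlongrightarrow> r (1 / 2)) F \<longrightarrow> eventually (\<lambda>x. f x \<notin> G ` cball 0 1) F \<longrightarrow>
       ((\<lambda>x. winding_number r (f x)) \<longlongrightarrow> c) F)"
  proof (rule jump)
    show "continuous_on (cball 0 1) G" unfolding G_def by (intro continuous_intros contL t)
    show "inj_on G (ball 0 1)" using L_inj[OF t(1)] by (simp add: G_def inj_on_def)
    show "G ` ball 0 1 \<inter> G ` sphere 0 1 = {}"
      using L_disj[OF t(1)] unfolding G_def disjoint_iff image_iff by auto
    show "winding_number (G \<circ> arcp a (a + 2 * pi)) (G q) = ori t" if "q \<in> ball 0 1" for a q
      using winding_number_translate[of "L t \<circ> arcp a (a + 2 * pi)" "lam t j" "L t q"] ori(2)[OF t(1) that, of a]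
      by (simp add: G_def comp_def)
    show "continuous_on {0..1} (hh t j)" using hh(1)[OF t(1)] continuous_on_subset by blast
    show "strict_mono_on {0..1} (hh t j)" using hh(2)[OF t(1)] by (rule monotone_on_subset) auto
    show "hh t j 0 = 0" "hh t j 1 = 1" using hh t by auto
    show "G (cis (pi / 2 * (real j + s))) = r (hh t j s)" if "s \<in> {0..1}" for s
      using L_side[OF t(1) that, of j] t by (simp add: G_def r_def)
    show "0 < mid t j" "mid t j < 1" "hh t j (mid t j) = 1 / 2" using mid[OF t(1)] by auto
    show "u = 1 / 2" if u: "u \<in> {0..1}" "r u = r (1 / 2)" for u
    proof -
      define u' where "u' = (if sg t j then u else 1 - u)"
      have u': "u' \<in> {0..1}" using u by (auto simp: u'_def)
      have "\<Gamma> e u' = \<Gamma> e (1 / 2)" using u(2) rhalf by (simp add: r_def dpath_def reversepath_def u'_def split: if_splits)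
      then have "\<gamma> e u' = \<gamma> e (1 / 2)" using cov_\<Gamma>[OF t(7) u'] cov_\<Gamma>[OF t(7), of "1/2"] by simp
      then have "u' = 1 / 2" using \<gamma>_inj[OF t(7) _ u', of "1/2"] by simp
      then show ?thesis by (simp add: u'_def split: if_splits)
    qed
    show "pt t j = cis (pi / 2 * (real j + mid t j))" by (rule pt_def)
  qed (use path_r p' in auto)
  then obtain c where c1: "((\<lambda>q. winding_number r (G q)) \<longlongrightarrow> c + ori t) (at (pt t j) within ball 0 1)"
    and c2: "G p' = r (1 / 2) \<Longrightarrow> ((\<lambda>q. winding_number r (G q)) \<longlongrightarrow> c) (at p' within ball 0 1)"
    and c3: "\<And>f (F :: complex filter). (f \<longlongrightarrow> r (1 / 2)) F \<Longrightarrow> eventually (\<lambda>x. f x \<notin> G ` cball 0 1) F \<Longrightarrow>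
       ((\<lambda>x. winding_number r (f x)) \<longlongrightarrow> c) F"
    by blast
  have in_ball: "eventually (\<lambda>q. q \<in> ball 0 1) (at x within ball 0 1)" for x :: complex
    by (simp add: eventually_at_filter)
  have c4: "((\<lambda>q. winding_number r (L t' q + lam t' j')) \<longlongrightarrow> c) (at (pt t' j') within ball 0 1)"
  proof (cases "t = t' \<and> lam t j = lam t' j'")
    case True
    then have "lam t j = lam t' j'" "t = t'" by auto
    then have "G p' = r (1 / 2)"
      unfolding G_def p'_def rhalf using L_pt[OF t(2), of j'] t(6) by simp
    from c2[OF this] \<open>lam t j = lam t' j'\<close> \<open>t = t'\<close> show ?thesis
      by (simp add: G_def p'_def)
  next
    case False
    show ?thesis
    proof (rule c3)
      show "((\<lambda>q. L t' q + lam t' j') \<longlongrightarrow> r (1 / 2)) (at (pt t' j') within ball 0 1)"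
        using L_pt_tendsto[OF t(2), of j'] t rhalf by simp
      show "eventually (\<lambda>q. L t' q + lam t' j' \<notin> G ` cball 0 1) (at (pt t' j') within ball 0 1)"
        using in_ball
      proof eventually_elim
        fix q :: complex assume q: "q \<in> ball 0 1"
        show "L t' q + lam t' j' \<notin> G ` cball 0 1"
        proof
          assume "L t' q + lam t' j' \<in> G ` cball 0 1"
          then obtain q' where "q' \<in> cball 0 1" "L t' q + lam t' j' = L t q' + lam t j" by (auto simp: G_def)
          then show False using L_eqD[OF t(2,1) q] lam[OF t(1)] lam[OF t(2)] False by metis
        qed
      qed
    qed
  qed
  have flip: "((\<lambda>q. winding_number (\<Gamma> e) (L u q + a)) \<longlongrightarrow> (if sg t j then x else - x)) (at y within ball 0 1)"
    if "((\<lambda>q. winding_number r (L u q + a)) \<longlongrightarrow> x) (at y within ball 0 1)" "u \<in> T" "a \<in> lattice" for u a x y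
  proof (cases "sg t j")
    case True
    then show ?thesis using that(1) by (simp add: r_def dpath_def)
  next
    case False
    have "eventually (\<lambda>q. - winding_number r (L u q + a) = winding_number (\<Gamma> e) (L u q + a)) (at y within ball 0 1)"
      using in_ball
    proof eventually_elim
      fix q :: complex assume "q \<in> ball 0 1"
      then show "- winding_number r (L u q + a) = winding_number (\<Gamma> e) (L u q + a)"
        using winding_number_reversepath[OF \<Gamma>[OF t(7)] L_notin_edge[OF that(2) _ t(7) that(3)]] False
        by (simp add: r_def dpath_def)
    qed
    from Lim_transform_eventually[OF tendsto_minus[OF that(1)] this] False show ?thesis by simp
  qed
  have eq: "(if sg t j then c + ori t else - (c + ori t)) = (if sg t j then c else - c) + sn t j"
    by (simp add: sn_def)
  show ?thesis
  proof (rule that)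
    show "((\<lambda>q. winding_number (\<Gamma> e) (L t q + lam t j)) \<longlongrightarrow> (if sg t j then c else - c) + sn t j) (at (pt t j) within ball 0 1)"
      unfolding eq[symmetric] by (rule flip[OF c1[unfolded G_def] t(1) lam[OF t(1)]])
    show "((\<lambda>q. winding_number (\<Gamma> e) (L t' q + lam t' j')) \<longlongrightarrow> (if sg t j then c else - c)) (at (pt t' j') within ball 0 1)"
      by (rule flip[OF c4 t(2) lam[OF t(2)]])
  qed
qed

lemma sn_cases: "t \<in> T \<Longrightarrow> sn t j = 1 \<or> sn t j = -1"
  using ori(1)[of t] by (auto simp: sn_def)

text \<open>Each of the two sides sees the winding number of the edge jump by its own sign relative
  to the other. Exchanging the roles gives c + sn = c' and c = c' + sn', hence sn + sn' = 0.\<close>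

lemma sides_opposite:
  assumes "(t, j) \<in> K e" "(t', j') \<in> K e" "(t, j) \<noteq> (t', j')"
  shows "sn t j = - sn t' j'"
proof -
  obtain c where c:
    "((\<lambda>q. winding_number (\<Gamma> e) (L t q + lam t j)) \<longlongrightarrow> c + sn t j) (at (pt t j) within ball 0 1)"
    "((\<lambda>q. winding_number (\<Gamma> e) (L t' q + lam t' j')) \<longlongrightarrow> c) (at (pt t' j') within ball 0 1)"
    using jump_side[OF assms] .
  obtain c' where c':
    "((\<lambda>q. winding_number (\<Gamma> e) (L t' q + lam t' j')) \<longlongrightarrow> c' + sn t' j') (at (pt t' j') within ball 0 1)"
    "((\<lambda>q. winding_number (\<Gamma> e) (L t q + lam t j)) \<longlongrightarrow> c') (at (pt t j) within ball 0 1)"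
    using jump_side[OF assms(2,1)] assms(3) by metis
  have "c + sn t j = c'" "c = c' + sn t' j'"
    using tendsto_unique[OF at_within_ball_nontrivial[OF pt_sphere(1)]] c c' by blast+
  then show ?thesis by (simp add: eq_neg_iff_add_eq_0 add.commute)
qed

text \<open>Three signs cannot be pairwise opposite.\<close>

lemma at_most_two_sides:
  assumes "x \<in> K e" "y \<in> K e" "z \<in> K e" "x \<noteq> y" "x \<noteq> z" "y \<noteq> z"
  shows False
proof -
  obtain t1 j1 t2 j2 t3 j3 where x: "x = (t1, j1)" "y = (t2, j2)" "z = (t3, j3)" by (metis prod.exhaust)
  have "sn t1 j1 = - sn t2 j2" "sn t1 j1 = - sn t3 j3" "sn t2 j2 = - sn t3 j3"
    using assms sides_opposite unfolding x by blast+
  then have "2 * sn t1 j1 = 0" by simp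
  then show False using sn_cases[of t1 j1] assms(1) by (auto simp: x K_def)
qed

lemma finite_K: "finite (K e)"
proof (cases "\<exists>x\<in>K e. \<exists>y\<in>K e. x \<noteq> y")
  case True
  then obtain x y where xy: "x \<in> K e" "y \<in> K e" "x \<noteq> y" by blast
  then have "K e \<subseteq> {x, y}" using at_most_two_sides by blast
  then show ?thesis by (rule finite_subset) simp
next
  case False
  then have "K e = {} \<or> (\<exists>x. K e = {x})" by blast
  then show ?thesis by auto
qed

text \<open>Every tile contributes its side 0 to some edge, and the finitely many edges carry
  finitely many sides each.\<close>

lemma finite_T: "finite T"
proof -
  have "T \<subseteq> fst ` (\<Union>e\<in>E. K e)"
  proof
    fix t assume "t \<in> T"
    then have "(t, 0) \<in> K (ed t 0)" "ed t 0 \<in> E" using ed(1) by (auto simp: K_def)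
    then show "t \<in> fst ` (\<Union>e\<in>E. K e)" by force
  qed
  then show ?thesis by (rule finite_subset) (intro finite_imageI finite_UN_I finiteE finite_K)
qed

lemma V_subset_edges: "V \<subseteq> \<Union>E"
proof
  fix v assume "v \<in> V"
  then have "degree V E v \<noteq> 0" using deg[of v] by linarith
  then have "{e \<in> E. v \<in> e} \<noteq> {}" unfolding degree_def by (metis (no_types) sum.empty)
  then show "v \<in> \<Union>E" by blast
qed

section \<open>The closed tiles cover the torus\<close>

lemma closed_vimage_cov: "closed S \<Longrightarrow> closed (cov -` S)"
  by (intro closed_vimage continuous_on_cov continuous_on_id)

text \<open>Otherwise a plane disc would map injectively and continuously into an open edge, hence
  into the real line, contradicting invariance of domain.\<close>

lemma edge_interior_empty:
  assumes e: "e \<in> E" shows "interior (cov -` e) = {}"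
proof (rule ccontr)
  assume "interior (cov -` e) \<noteq> {}"
  define U where "U = interior (cov -` e)"
  have cV: "closed (cov -` V)"
    by (rule closed_vimage_cov[OF finite_imp_closed[OF finiteV]])
  then have opU: "open (U - cov -` V)" by (simp add: U_def open_Diff)
  obtain w r where w: "0 < r" "ball w r \<subseteq> U"
    using \<open>interior (cov -` e) \<noteq> {}\<close> open_interior[of "cov -` e"] unfolding U_def
    by (meson ex_in_conv open_contains_ball)
  have "U - cov -` V \<noteq> {}"
  proof
    assume "U - cov -` V = {}"
    moreover have "ball w (min r pi) \<subseteq> U" using w by auto
    ultimately have sub: "cov ` ball w (min r pi) \<subseteq> V" by blast
    moreover have "inj_on cov (ball w (min r pi))"
      by (rule inj_on_subset[OF cov_inj_on_ball[of w]]) auto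
    ultimately have "finite (ball w (min r pi))"
      using finiteV by (metis finite_imageD finite_subset)
    then show False using w(1) uncountable_ball[of "min r pi" w] countable_finite by auto
  qed
  then obtain z d where z: "0 < d" "ball z d \<subseteq> U - cov -` V"
    using opU by (meson ex_in_conv open_contains_ball)
  define B where "B = ball z (min d pi)"
  have B: "cov ` B \<subseteq> e - V"
  proof -
    have "B \<subseteq> ball z d" by (auto simp: B_def)
    then show ?thesis using z(2) interior_subset[of "cov -` e"] unfolding U_def by blast
  qed
  obtain g where g: "homeomorphism {0<..<1} (e - V) (\<gamma> e) g"
    using traverses_homeomorphism[OF \<gamma>[OF e]] .
  \<comment> \<open>Regarding the edge parameter as a complex number makes the plane version of
    invariance of domain applicable; an open image cannot consist of real numbers.\<close>
  define f where "f = (\<lambda>x. complex_of_real (g (cov x)))"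
  have "continuous_on B f"
    unfolding f_def
    by (intro continuous_on_of_real continuous_on_compose2[OF homeomorphism_cont2[OF g] _ B]
        continuous_on_cov continuous_on_id)
  moreover have "inj_on f B"
  proof (rule inj_onI)
    fix x y assume xy: "x \<in> B" "y \<in> B" "f x = f y"
    then have "g (cov x) = g (cov y)" by (simp add: f_def)
    then have "\<gamma> e (g (cov x)) = \<gamma> e (g (cov y))" by simp
    moreover have "cov x \<in> e - V" "cov y \<in> e - V" using B xy by auto
    ultimately have "cov x = cov y" using g by (simp add: homeomorphism_def)
    moreover have "inj_on cov B"
      unfolding B_def by (rule inj_on_subset[OF cov_inj_on_ball[of z]]) auto
    ultimately show "x = y" using xy by (auto simp: inj_on_def)
  qed
  ultimately have "open (f ` B)" by (intro invariance_of_domain) (auto simp: B_def)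
  moreover have "f z \<in> f ` B" using z(1) by (auto simp: B_def)
  ultimately obtain k where k: "k > 0" "ball (f z) k \<subseteq> f ` B" by (meson open_contains_ball)
  have "f z + \<i> * of_real (k / 2) \<in> ball (f z) k" using k(1) by (simp add: dist_norm norm_mult)
  then have "f z + \<i> * of_real (k / 2) \<in> f ` B" using k(2) by blast
  then obtain y where "f z + \<i> * of_real (k / 2) = f y" by blast
  then have "Im (f z + \<i> * of_real (k / 2)) = Im (f y)" by simp
  then show False using k(1) by (simp add: f_def)
qed

lemma closed_F_image: "t \<in> T \<Longrightarrow> closed S \<Longrightarrow> S \<subseteq> cball 0 1 \<Longrightarrow> closed (F t ` S)"
proof -
  assume "t \<in> T" "closed S" "S \<subseteq> cball 0 1"
  then have "compact S" by (metis bounded_cball bounded_subset compact_eq_bounded_closed)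
  then have "compact (F t ` S)"
    using contF[OF \<open>t \<in> T\<close>] \<open>S \<subseteq> cball 0 1\<close> by (intro compact_continuous_image) (auto intro: continuous_on_subset)
  then show ?thesis by (rule compact_imp_closed)
qed

text \<open>The union of the finitely many closed tiles is closed. The lift of its complement is
  open and contained in the lifted edges, a finite union of closed sets with empty interior, so it
  is empty.\<close>

lemma cover:
  assumes "y \<in> torus" obtains t q where "t \<in> T" "q \<in> cball 0 1" "F t q = y"
proof -
  define R where "R = (\<Union>t\<in>T. F t ` cball 0 1)"
  have "closed R"
    unfolding R_def by (intro closed_UN finite_T ballI closed_F_image) auto
  have "y \<in> R"
  proof (rule ccontr)
    assume "y \<notin> R"
    obtain z where z: "cov z = y" using cov_surj[OF assms] .
    define O' where "O' = - (cov -` R)"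
    have "open O'" unfolding O'_def by (intro open_Compl closed_vimage_cov \<open>closed R\<close>)
    have "O' \<subseteq> (\<Union>e\<in>E. cov -` e)"
    proof
      fix w assume "w \<in> O'"
      then have "cov w \<notin> \<Union>T" using F_ball(1) unfolding O'_def R_def by fastforce
      then have "cov w \<in> Gr" using Union_tiles cov_in_torus by blast
      then show "w \<in> (\<Union>e\<in>E. cov -` e)" using V_subset_edges by auto
    qed
    moreover have "interior (\<Union>e\<in>E. cov -` e) = {}"
    proof (rule interior_finite_Union_empty[OF finiteE])
      fix e assume e: "e \<in> E"
      show "interior (cov -` e) = {}" by (rule edge_interior_empty[OF e])
      have "closed e" using edge_closure[OF \<gamma>[OF e]] closed_closure by metis
      then show "closed (cov -` e)" by (rule closed_vimage_cov)
    qed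
    ultimately have "O' = {}" using \<open>open O'\<close> by (metis interior_maximal subset_empty)
    then show False using z \<open>y \<notin> R\<close> by (auto simp: O'_def)
  qed
  then show ?thesis using that unfolding R_def by blast
qed

lemma K_nonempty: assumes e: "e \<in> E" obtains t j where "(t, j) \<in> K e"
proof -
  have "\<gamma> e (1 / 2) \<in> torus" using \<gamma>_interior[OF e, of "1/2"] e E_torus by auto
  then obtain t q where tq: "t \<in> T" "q \<in> cball 0 1" "F t q = \<gamma> e (1 / 2)" using cover by blast
  then show ?thesis using mid_preimage[OF tq(1,2) e tq(3)] that by metis
qed

text \<open>If an edge had a single side, the polygon would be locally homeomorphic to the plane at a
  boundary point.\<close>

lemma K_not_singleton: assumes e: "e \<in> E" and tj: "K e = {(t, j)}" shows False
proof -
  have "(t, j) \<in> K e" using tj by simp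
  then have t: "t \<in> T" "j < 4" "ed t j = e" by (auto simp: K_def)
  define p where "p = pt t j"
  define x where "x = \<Gamma> e (1 / 2)"
  have covx: "cov x = \<gamma> e (1 / 2)" "F t p = \<gamma> e (1 / 2)"
    using cov_\<Gamma>[OF e, of "1/2"] F_pt[OF t(1), of j] t by (auto simp: x_def p_def)
  \<comment> \<open>\<open>A\<close> is the circle without the open side \<open>j\<close>. Away from
    \<open>A\<close> the polygon map is injective also on the boundary, so it is an embedding on the
    half disc \<open>S\<close> around \<open>p\<close>.\<close>
  define A where "A = (\<lambda>u. cis (pi / 2 * (real j + u))) ` {1..4}"
  have "compact A" unfolding A_def by (intro compact_continuous_image continuous_intros) auto
  have pA: "p \<notin> A"
  proof
    assume "p \<in> A"
    then obtain u where u: "u \<in> {1..4}" "cis (pi / 2 * (real j + mid t j)) = cis (pi / 2 * (real j + u))"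
      by (auto simp: A_def p_def pt_def)
    obtain n :: int where "pi / 2 * (real j + mid t j) = pi / 2 * (real j + u) + 2 * pi * n"
      using u(2) unfolding cis_eq_iff by blast
    then have "pi / 2 * (real j + mid t j) = pi / 2 * (real j + u + 4 * n)" by (simp add: algebra_simps)
    then have "mid t j = u + 4 * n" by simp
    then have "real_of_int n < 0" "real_of_int n > -1" using u(1) mid[OF t(1), of j] by auto
    then have "n < 0" "n > -1" by linarith+
    then show False by linarith
  qed
  obtain \<rho> where \<rho>: "\<rho> > 0" "cball p \<rho> \<inter> A = {}"
  proof -
    have "open (- A)" using compact_imp_closed[OF \<open>compact A\<close>] by (rule open_Compl)
    then obtain \<rho> where "\<rho> > 0" "cball p \<rho> \<subseteq> - A"
      using pA by (meson ComplI open_contains_cball)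
    then show ?thesis using that by blast
  qed
  define S where "S = cball 0 1 \<inter> cball p \<rho>"
  have S_side: "q \<in> side 4 j" if "q \<in> S" "q \<notin> ball 0 1" for q
  proof -
    have "q \<in> sphere 0 1" using that by (auto simp: S_def)
    then obtain u where u: "u \<in> {0..<4}" "q = cis (pi / 2 * (real j + u))" by (rule sphere_from_corner)
    have "q \<notin> A" using that \<rho> by (auto simp: S_def)
    have "u \<noteq> 0"
    proof
      assume "u = 0"
      then have "q = cis (pi / 2 * (real j + 4))" using u(2) cis_quarter_add4[of "real j"] by simp
      then show False using \<open>q \<notin> A\<close> unfolding A_def by (auto intro: image_eqI[of _ _ 4])
    qed
    moreover have "u < 1"
    proof (rule ccontr)
      assume "\<not> u < 1"
      then have "q \<in> A" unfolding A_def u(2) using u(1) by (intro imageI) auto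
      then show False using \<open>q \<notin> A\<close> by blast
    qed
    ultimately show ?thesis using u by (auto simp: side4)
  qed
  have injS: "inj_on (F t) S"
  proof (rule inj_onI)
    fix q q' assume q: "q \<in> S" "q' \<in> S" "F t q = F t q'"
    have cb: "q \<in> cball 0 1" "q' \<in> cball 0 1" using q by (auto simp: S_def)
    show "q = q'"
    proof (cases "q \<in> ball 0 1 \<or> q' \<in> ball 0 1")
      case True
      then show ?thesis using F_eqD[OF t(1) t(1), of q q'] F_eqD[OF t(1) t(1), of q' q] cb q(3) by metis
    next
      case False
      obtain e' g where "homeomorphism (side 4 j) (e' - V) (F t) g" using F_side[OF t(1)] by metis
      then have "inj_on (F t) (side 4 j)" by (metis homeomorphism_apply1 inj_on_inverseI)
      then show ?thesis using False S_side q unfolding inj_on_def by blast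
    qed
  qed
  have compS: "compact S" unfolding S_def by (intro compact_Int compact_cball)
  have contS: "continuous_on S (F t)" using contF[OF t(1)] by (rule continuous_on_subset) (auto simp: S_def)
  obtain g where g: "homeomorphism S (F t ` S) (F t) g"
    using homeomorphism_compact[OF compS contS refl injS] by blast
  \<comment> \<open>\<open>R\<close> is the image of everything except a neighbourhood of
    \<open>p\<close> in its polygon. If \<open>(t, j)\<close> is the only side on \<open>e\<close>,
    then \<open>p\<close> is the only point over the middle of the edge, so the closed set
    \<open>R\<close> misses that middle.\<close>
  define R where "R = (\<Union>t'\<in>T - {t}. F t' ` cball 0 1) \<union> F t ` (cball 0 1 - ball p \<rho>)"
  have "closed R"
    unfolding R_def using finite_T by (intro closed_Un closed_UN ballI closed_F_image) (auto simp: t closed_Diff)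
  moreover have "x \<notin> cov -` R"
  proof
    assume "x \<in> cov -` R"
    then obtain t' q where q: "t' \<in> T" "q \<in> cball 0 1" "F t' q = \<gamma> e (1 / 2)" "t' \<noteq> t \<or> q \<notin> ball p \<rho>"
      using covx t unfolding R_def by fastforce
    obtain j' where "(t', j') \<in> K e" "q = pt t' j'" using mid_preimage[OF q(1,2) e q(3)] .
    then have "t' = t" "q = p" using tj by (auto simp: p_def)
    then show False using q(4) \<rho>(1) by simp
  qed
  ultimately obtain d where d: "d > 0" "ball x d \<subseteq> - (cov -` R)"
    using closed_vimage_cov by (metis ComplI open_Compl open_contains_ball)
  define B where "B = ball x (min d pi)"
  have B: "cov ` B \<subseteq> F t ` S"
  proof
    fix y assume "y \<in> cov ` B"
    then have y: "y \<in> torus" "y \<notin> R" using d by (auto simp: B_def)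
    obtain t' q where q: "t' \<in> T" "q \<in> cball 0 1" "F t' q = y" using cover[OF y(1)] .
    then have "t' = t" using y(2) unfolding R_def by blast
    moreover have "q \<in> ball p \<rho>"
    proof (rule ccontr)
      assume "q \<notin> ball p \<rho>"
      then have "F t q \<in> R" using q(2) unfolding R_def by blast
      then show False using q(3) y(2) calculation by simp
    qed
    ultimately have "t' = t" "q \<in> ball p \<rho>" by blast+
    then show "y \<in> F t ` S" using q by (auto simp: S_def)
  qed
  \<comment> \<open>A plane disc around \<open>x\<close> is mapped injectively into the closed unit
    disc. The image is open, so it lies in the open unit disc, although it contains the boundary
    point \<open>p\<close>.\<close>
  have "open ((g \<circ> cov) ` B)"
  proof (rule invariance_of_domain)
    show "continuous_on B (g \<circ> cov)"
      by (intro continuous_on_compose continuous_on_subset[OF homeomorphism_cont2[OF g] B] continuous_on_cov continuous_on_id)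
    show "open B" by (simp add: B_def)
    show "inj_on (g \<circ> cov) B"
    proof (rule comp_inj_on)
      show "inj_on cov B" unfolding B_def by (rule inj_on_subset[OF cov_inj_on_ball[of x]]) auto
      show "inj_on g (cov ` B)" using B g by (metis homeomorphism_apply2 inj_on_inverseI inj_on_subset)
    qed
  qed
  moreover have "(g \<circ> cov) ` B \<subseteq> cball 0 1"
    using B g unfolding homeomorphism_def S_def by fastforce
  ultimately have "(g \<circ> cov) ` B \<subseteq> ball 0 1"
    by (metis interior_cball interior_maximal)
  moreover have "p \<in> S" using pt_sphere[of t j] \<rho>(1) by (simp add: S_def p_def)
  then have "g (cov x) = p" using g covx by (metis homeomorphism_apply1)
  then have "p \<in> (g \<circ> cov) ` B" using d(1) by (force simp: B_def)
  ultimately show False using pt_sphere(1)[of t j] by (auto simp: p_def)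
qed

text \<open>The sign decides which side is listed first. The two limits are kept because the parity
  argument compares the winding number of a path from both sides of the edge.\<close>

lemma two_sides:
  assumes e: "e \<in> E"
  obtains t1 j1 t2 j2 c where "K e = {(t1, j1), (t2, j2)}" "(t1, j1) \<noteq> (t2, j2)" "sn t1 j1 = 1" "sn t2 j2 = -1"
    "((\<lambda>q. winding_number (\<Gamma> e) (L t1 q + lam t1 j1)) \<longlongrightarrow> c + 1) (at (pt t1 j1) within ball 0 1)"
    "((\<lambda>q. winding_number (\<Gamma> e) (L t2 q + lam t2 j2)) \<longlongrightarrow> c) (at (pt t2 j2) within ball 0 1)"
proof -
  obtain t j where tj: "(t, j) \<in> K e" using K_nonempty[OF e] .
  obtain t' j' where tj': "(t', j') \<in> K e" "(t', j') \<noteq> (t, j)"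
  proof -
    have "K e \<noteq> {(t, j)}" using K_not_singleton[OF e] by blast
    then obtain z where "z \<in> K e" "z \<noteq> (t, j)" using tj by blast
    then show ?thesis using that by (cases z) auto
  qed
  have Ke: "K e = {(t, j), (t', j')}"
    using at_most_two_sides[OF tj tj'(1)] tj tj' by blast
  have s: "sn t j = - sn t' j'" using sides_opposite[OF tj tj'(1)] tj'(2) by metis
  then have s': "sn t' j' = - sn t j" by simp
  consider "sn t j = 1" "sn t' j' = -1" | "sn t j = -1" "sn t' j' = 1"
    using sn_cases[of t j] tj s' by (auto simp: K_def)
  then show ?thesis
  proof cases
    case 1
    obtain c where "((\<lambda>q. winding_number (\<Gamma> e) (L t q + lam t j)) \<longlongrightarrow> c + sn t j) (at (pt t j) within ball 0 1)"
      "((\<lambda>q. winding_number (\<Gamma> e) (L t' q + lam t' j')) \<longlongrightarrow> c) (at (pt t' j') within ball 0 1)"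
      using jump_side[OF tj tj'(1)] tj'(2) by metis
    then show ?thesis by (intro that[of t j t' j' c]) (use Ke tj'(2) 1 in auto)
  next
    case 2
    obtain c where "((\<lambda>q. winding_number (\<Gamma> e) (L t' q + lam t' j')) \<longlongrightarrow> c + sn t' j') (at (pt t' j') within ball 0 1)"
      "((\<lambda>q. winding_number (\<Gamma> e) (L t q + lam t j)) \<longlongrightarrow> c) (at (pt t j) within ball 0 1)"
      using jump_side[OF tj'(1) tj] tj'(2) by metis
    then show ?thesis by (intro that[of t' j' t j c]) (use Ke tj'(2) 2 in auto)
  qed
qed

end

section \<open>Bipartite tilings and subdivisions\<close>

lemma mod4_pred: "x < 4 \<Longrightarrow> ((x + 1) mod 4 + 3) mod 4 = (x::nat)"
  by presburger

lemma mod4_succ: "x < 4 \<Longrightarrow> ((x + 3) mod 4 + 1) mod 4 = (x::nat)"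
  by presburger

lemma parity_mod4:
  fixes j r :: nat
  assumes "j < 4" "r < 4"
  shows "(j = r \<or> j = (r + 2) mod 4) \<longleftrightarrow> (even j \<longleftrightarrow> even r)"
proof -
  have "j = 0 \<or> j = 1 \<or> j = 2 \<or> j = 3" "r = 0 \<or> r = 1 \<or> r = 2 \<or> r = 3"
    using assms by linarith+
  then show ?thesis by (elim disjE) simp_all
qed

text \<open>For a loop the two end points coincide, so unequal colours also exclude loops.\<close>

definition bipartite :: "'a set \<Rightarrow> 'a set set \<Rightarrow> bool" where
  "bipartite V E \<longleftrightarrow> (\<exists>col. \<forall>e\<in>E. \<exists>u v. e \<inter> V = {u, v} \<and> col u \<noteq> (col v :: bool))"

lemma corner4_inj: "j < 4 \<Longrightarrow> j' < 4 \<Longrightarrow> corner 4 j = corner 4 j' \<Longrightarrow> j = j'"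
  using cis_quarter_inj[of j 0 j' 0] by (simp add: corner4)

context lifted_tiling
begin

section \<open>The corners around a vertex\<close>

definition CV :: "complex \<times> complex \<Rightarrow> ((complex \<times> complex) set \<times> nat) set" where
  "CV v = {(t, j). t \<in> T \<and> j < 4 \<and> F t (corner 4 j) = v}"

lemma finite_CV: "finite (CV v)"
proof -
  have "CV v \<subseteq> T \<times> {..<4}" by (auto simp: CV_def)
  then show ?thesis using finite_T by (meson finite_SigmaI finite_lessThan finite_subset)
qed

text \<open>A small punctured neighbourhood of a vertex is connected, so it is not the disjoint union of two
  nonempty closed families of corner sectors.\<close>

lemma vertex_link:
  assumes v: "v \<in> V" and K12: "K1 \<inter> K2 = {}" "K1 \<noteq> {}" "K2 \<noteq> {}" "K1 \<union> K2 = CV v" and "\<delta> > 0"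
  obtains t1 j1 t2 j2 q1 q2 where "(t1, j1) \<in> K1" "(t2, j2) \<in> K2" "q1 \<in> cball 0 1" "q2 \<in> cball 0 1"
    "dist q1 (corner 4 j1) < \<delta>" "dist q2 (corner 4 j2) < \<delta>" "F t1 q1 = F t2 q2" "F t1 q1 \<noteq> v"
proof (rule ccontr)
  assume "\<not> thesis"
  note no = this and intro = that
  define d where "d = \<delta> / 2"
  have d: "0 < d" "d < \<delta>" using \<open>\<delta> > 0\<close> by (auto simp: d_def)
  define N where "N k = (\<Union>(t, j)\<in>k. F t ` (cball 0 1 \<inter> cball (corner 4 j) d))" for k
  have sub: "K1 \<subseteq> CV v" "K2 \<subseteq> CV v" using K12 by auto
  have closedN: "closed (N k)" if "k \<subseteq> CV v" for k
  proof -
    have "finite k" using finite_CV that finite_subset by blast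
    moreover have "closed (F t ` (cball 0 1 \<inter> cball (corner 4 j) d))" if "(t, j) \<in> k" for t j
      using that \<open>k \<subseteq> CV v\<close> by (intro closed_F_image) (auto simp: CV_def)
    ultimately show ?thesis unfolding N_def by (intro closed_UN) auto
  qed
  have meet: "y = v" if y: "y \<in> N K1" "y \<in> N K2" for y
  proof (rule ccontr)
    assume "y \<noteq> v"
    obtain t1 j1 q1 where 1: "(t1, j1) \<in> K1" "q1 \<in> cball 0 1" "dist q1 (corner 4 j1) \<le> d" "y = F t1 q1"
    proof -
      obtain x q where "x \<in> K1" "q \<in> cball 0 1 \<inter> cball (corner 4 (snd x)) d" "y = F (fst x) q"
        using y(1) unfolding N_def split_beta by blast
      then show ?thesis by (intro that[of "fst x" "snd x" q]) (auto simp: dist_commute)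
    qed
    obtain t2 j2 q2 where 2: "(t2, j2) \<in> K2" "q2 \<in> cball 0 1" "dist q2 (corner 4 j2) \<le> d" "y = F t2 q2"
    proof -
      obtain x q where "x \<in> K2" "q \<in> cball 0 1 \<inter> cball (corner 4 (snd x)) d" "y = F (fst x) q"
        using y(2) unfolding N_def split_beta by blast
      then show ?thesis by (intro that[of "fst x" "snd x" q]) (auto simp: dist_commute)
    qed
    show False
    proof (rule notE[OF no], rule intro)
      show "dist q1 (corner 4 j1) < \<delta>" "dist q2 (corner 4 j2) < \<delta>" using 1 2 d by auto
      show "F t1 q1 = F t2 q2" "F t1 q1 \<noteq> v" using 1 2 \<open>y \<noteq> v\<close> by auto
    qed (fact 1 2)+
  qed
  \<comment> \<open>\<open>C\<close> is what the tiles leave outside the corner sectors of radius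
    \<open>d\<close> at \<open>v\<close>. It is closed and misses \<open>v\<close>, so near
    \<open>v\<close> only sectors remain.\<close>
  define C where "C = (\<Union>t\<in>T. F t ` (cball 0 1 - (\<Union>j\<in>{j. (t, j) \<in> CV v}. ball (corner 4 j) d)))"
  have "closed C"
    unfolding C_def by (intro closed_UN finite_T ballI closed_F_image closed_Diff open_UN) auto
  have "v \<notin> C"
  proof
    assume "v \<in> C"
    then obtain t q where tq: "t \<in> T" "q \<in> cball 0 1" "F t q = v" "\<And>j. (t, j) \<in> CV v \<Longrightarrow> q \<notin> ball (corner 4 j) d"
      unfolding C_def by blast
    obtain j where "j < 4" "q = corner 4 j" using vertex_preimage[OF tq(1,2)] tq(3) v by metis
    then have "(t, j) \<in> CV v" using tq by (auto simp: CV_def)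
    then show False using tq(4)[of j] \<open>q = corner 4 j\<close> d by simp
  qed
  obtain z where z: "cov z = v" using cov_surj V_torus v by blast
  have "open (- (cov -` C))" by (intro open_Compl closed_vimage_cov \<open>closed C\<close>)
  moreover have "z \<in> - (cov -` C)" using z \<open>v \<notin> C\<close> by auto
  ultimately obtain r0 where r0: "r0 > 0" "ball z r0 \<subseteq> - (cov -` C)" by (meson open_contains_ball)
  define r where "r = min r0 pi"
  have r: "r > 0" "ball z r \<subseteq> - (cov -` C)" "ball z r \<subseteq> ball z pi" using r0 by (auto simp: r_def)
  define P where "P = cov ` (ball z r - {z})"
  have connP: "connected P"
    unfolding P_def
    by (rule connected_continuous_image[OF continuous_on_cov[OF continuous_on_id] connected_punctured_ball]) simp
  have vP: "y \<noteq> v" if yP: "y \<in> P" for y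
  proof
    assume "y = v"
    obtain w where w: "w \<in> ball z r - {z}" "y = cov w" using yP unfolding P_def by blast
    then have "w \<in> ball z r" "w \<noteq> z" "cov w = cov z" using \<open>y = v\<close> z by auto
    moreover have "z \<in> ball z pi" by simp
    ultimately show False using inj_onD[OF cov_inj_on_ball, of w z z] r by blast
  qed
  have PN: "P \<subseteq> N K1 \<union> N K2"
  proof
    fix y assume "y \<in> P"
    then have y: "y \<in> torus" "y \<notin> C" using r(2) by (auto simp: P_def)
    obtain t q where tq: "t \<in> T" "q \<in> cball 0 1" "F t q = y" using cover[OF y(1)] .
    then have "\<exists>j. (t, j) \<in> CV v \<and> q \<in> ball (corner 4 j) d"
      using y(2) unfolding C_def by blast
    then obtain j where "(t, j) \<in> CV v" "q \<in> cball (corner 4 j) d" by auto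
    then have "(t, j) \<in> K1 \<or> (t, j) \<in> K2" "y \<in> F t ` (cball 0 1 \<inter> cball (corner 4 j) d)"
      using K12 tq by auto
    then show "y \<in> N K1 \<union> N K2" unfolding N_def by blast
  qed
  obtain dd where dd: "dd > 0" "\<And>y. y \<in> torus \<Longrightarrow> dist y (cov z) < dd \<Longrightarrow> y \<in> cov ` ball z r"
    by (rule cov_local_inverse[OF r(1), where z = z]) (rule that)
  \<comment> \<open>Points of an open tile close to the corner are mapped close to \<open>v\<close>,
    but not to \<open>v\<close> itself, since open tiles contain no vertices; so every sector
    reaches into the punctured neighbourhood \<open>P\<close>.\<close>
  have hit: "P \<inter> N k \<noteq> {}" if k: "k \<subseteq> CV v" "k \<noteq> {}" for k
  proof -
    obtain t j where tj: "(t, j) \<in> k" using k by auto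
    then have t: "t \<in> T" "j < 4" "F t (corner 4 j) = v" using k by (auto simp: CV_def)
    have "(F t \<longlongrightarrow> v) (at (corner 4 j) within ball 0 1)"
      using contF[OF t(1)] t(3) corner4_sphere
      by (metis ball_subset_cball continuous_on_def mem_cball_0 order_refl tendsto_within_subset)
    then have "eventually (\<lambda>q. dist (F t q) v < dd) (at (corner 4 j) within ball 0 1)"
      using dd(1) by (rule tendstoD)
    moreover have "eventually (\<lambda>q. q \<in> ball 0 1) (at (corner 4 j) within ball 0 1)"
      by (simp add: eventually_at_filter)
    moreover have "eventually (\<lambda>q. dist q (corner 4 j) < d) (at (corner 4 j) within ball 0 1)"
      using d(1) by (intro tendstoD[OF tendsto_ident_at])
    ultimately have "eventually (\<lambda>q. dist (F t q) v < dd \<and> q \<in> ball 0 1 \<and> dist q (corner 4 j) < d) (at (corner 4 j) within ball 0 1)"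
      by eventually_elim auto
    then obtain q where q: "dist (F t q) v < dd" "q \<in> ball 0 1" "dist q (corner 4 j) < d"
      using eventually_happens' at_within_ball_nontrivial[OF corner4_sphere(1)] by blast
    have ne: "F t q \<noteq> v"
      using F_ball(1)[OF t(1)] tile_disjoint_graph[OF t(1)] v q(2) by blast
    have "F t q \<in> torus" using F_torus[OF t(1), of q] q(2) by simp
    then have "F t q \<in> cov ` ball z r" using dd(2) q(1) z by auto
    then have "F t q \<in> P" using ne z unfolding P_def by blast
    moreover have "F t q \<in> N k"
      using tj q unfolding N_def by (fastforce simp: dist_commute)
    ultimately show ?thesis by blast
  qed
  have "N K1 \<inter> N K2 \<inter> P = {}" using meet vP by blast
  then show False
    using connected_closedD[OF connP _ PN closedN[OF sub(1)] closedN[OF sub(2)]] hit[OF sub(1) K12(2)] hit[OF sub(2) K12(3)]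
    by blast
qed

text \<open>Side \<open>i\<close> of \<open>t\<close> ends at corner \<open>j\<close>, and there its edge has parameter \<open>x\<close>.\<close>

definition at_side :: "(complex \<times> complex) set \<Rightarrow> nat \<Rightarrow> nat \<Rightarrow> real \<Rightarrow> bool" where
  "at_side t j i x \<longleftrightarrow> i = j \<and> x = hho t j 0 \<or> i = (j + 3) mod 4 \<and> x = hho t i 1"

lemma continuous_hho: "t \<in> T \<Longrightarrow> isCont (hho t j) s"
proof -
  assume "t \<in> T"
  then have c: "isCont (hh t j) s" using hh(1)[of t j] continuous_on_eq_continuous_at by blast
  show ?thesis by (cases "sg t j") (use c in \<open>auto simp: hho_def[abs_def] intro!: continuous_intros\<close>)
qed

text \<open>The part of the circle at a distance from the corner is compact and misses it, so nearby
  boundary points lie on the two adjacent sides. There the edge parameter is within 1/2 of its end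
  value 0 or 1, which is what identifies the end of the edge. The first clause keeps the
  neighbourhoods of different corners of one polygon apart.\<close>

lemma near_corner:
  assumes t: "t \<in> T" and j: "j < 4"
  shows "\<exists>\<delta>>0. \<forall>q\<in>cball 0 1. dist q (corner 4 j) < \<delta> \<longrightarrow>
    (\<forall>j'<4. j' \<noteq> j \<longrightarrow> \<delta> \<le> dist q (corner 4 j')) \<and>
    (q \<in> ball 0 1 \<or> q = corner 4 j \<or>
     (\<exists>i x s. at_side t j i x \<and> i < 4 \<and> s \<in> {0<..<1} \<and> q = cis (pi / 2 * (real i + s)) \<and> \<bar>hho t i s - x\<bar> < 1 / 2))"
proof -
  define j' where "j' = (j + 3) mod 4"
  obtain r1 where r1: "r1 > 0" "\<And>s. dist s 0 < r1 \<Longrightarrow> dist (hho t j s) (hho t j 0) < 1 / 2"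
    using continuous_hho[OF t, where j = j and s = 0] unfolding continuous_at_eps_delta by (metis half_gt_zero_iff zero_less_one)
  obtain r2 where r2: "r2 > 0" "\<And>s. dist s 1 < r2 \<Longrightarrow> dist (hho t j' s) (hho t j' 1) < 1 / 2"
    using continuous_hho[OF t, where j = j' and s = 1] unfolding continuous_at_eps_delta by (metis half_gt_zero_iff zero_less_one)
  define \<rho> where "\<rho> = min (min r1 r2) 1"
  have \<rho>: "\<rho> > 0" "\<rho> \<le> r1" "\<rho> \<le> r2" "\<rho> \<le> 1" using r1 r2 by (auto simp: \<rho>_def)
  define A where "A = (\<lambda>u. cis (pi / 2 * (real j + u))) ` {\<rho>..4 - \<rho>}"
  have "closed A" unfolding A_def by (intro compact_imp_closed compact_continuous_image continuous_intros) auto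
  have "corner 4 j \<notin> A"
  proof
    assume "corner 4 j \<in> A"
    then obtain u where u: "u \<in> {\<rho>..4 - \<rho>}" "cis (pi / 2 * real j) = cis (pi / 2 * (real j + u))"
      by (auto simp: A_def corner4)
    obtain n :: int where "pi / 2 * real j = pi / 2 * (real j + u) + 2 * pi * n"
      using u(2) unfolding cis_eq_iff by blast
    also have "\<dots> = pi / 2 * (real j + u + 4 * n)" by (simp add: algebra_simps)
    finally have "pi / 2 * real j = pi / 2 * (real j + u + 4 * n)" .
    then have "u = - 4 * n" by simp
    then have "real_of_int n < 0" "real_of_int n > -1" using u(1) \<rho>(1) by auto
    then have "n < 0" "n > -1" by linarith+
    then show False by linarith
  qed
  then obtain d1 where d1: "d1 > 0" "ball (corner 4 j) d1 \<subseteq> - A"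
    using \<open>closed A\<close> by (meson ComplI open_Compl open_contains_ball)
  obtain d2 where d2: "d2 > 0" "\<forall>x\<in>corner 4 ` {..<4}. x \<noteq> corner 4 j \<longrightarrow> d2 \<le> dist (corner 4 j) x"
    using finite_set_avoid[of "corner 4 ` {..<4}" "corner 4 j"] by auto
  define \<delta> where "\<delta> = min d1 (d2 / 2)"
  have \<delta>: "\<delta> > 0" "\<delta> \<le> d1" "2 * \<delta> \<le> d2" using d1 d2 by (auto simp: \<delta>_def)
  show ?thesis
  proof (intro exI[of _ \<delta>] conjI ballI impI allI)
    show "\<delta> > 0" by fact
    fix q :: complex assume q: "q \<in> cball 0 1" "dist q (corner 4 j) < \<delta>"
    show "\<delta> \<le> dist q (corner 4 k)" if "k < 4" "k \<noteq> j" for k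
    proof -
      have "d2 \<le> dist (corner 4 j) (corner 4 k)" using d2(2) corner4_inj[OF that(1) j] that by blast
      also have "\<dots> \<le> dist q (corner 4 j) + dist q (corner 4 k)" by (metis dist_commute dist_triangle)
      finally show ?thesis using q(2) \<delta>(3) by linarith
    qed
    show "q \<in> ball 0 1 \<or> q = corner 4 j \<or>
     (\<exists>i x s. at_side t j i x \<and> i < 4 \<and> s \<in> {0<..<1} \<and> q = cis (pi / 2 * (real i + s)) \<and> \<bar>hho t i s - x\<bar> < 1 / 2)"
    proof (cases "q \<in> ball 0 1")
      case False
      then have "q \<in> sphere 0 1" using q(1) by auto
      then obtain u where u: "u \<in> {0..<4}" "q = cis (pi / 2 * (real j + u))" by (rule sphere_from_corner)
      have "q \<notin> A" using d1(2) q(2) \<delta>(2) by (auto simp: dist_commute subset_iff)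
      then have "u \<notin> {\<rho>..4 - \<rho>}" using u(2) unfolding A_def by blast
      then consider "u = 0" | "0 < u" "u < \<rho>" | "4 - \<rho> < u" using u(1) by fastforce
      then show ?thesis
      proof cases
        case 1
        then show ?thesis using u by (simp add: corner4)
      next
        case 2
        then have "\<bar>hho t j u - hho t j 0\<bar> < 1 / 2" using r1(2)[of u] \<rho> by (simp add: dist_real_def)
        moreover have "u \<in> {0<..<1}" using 2 \<rho> by auto
        moreover have "at_side t j j (hho t j 0)" by (simp add: at_side_def)
        ultimately show ?thesis using u(2) j by blast
      next
        case 3
        have "\<bar>hho t j' (u - 3) - hho t j' 1\<bar> < 1 / 2"
          using r2(2)[of "u - 3"] 3 u(1) \<rho> by (simp add: dist_real_def)
        moreover have "u - 3 \<in> {0<..<1}" using 3 u(1) \<rho> by auto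
        moreover have "at_side t j j' (hho t j' 1)" by (simp add: at_side_def j'_def)
        moreover have "q = cis (pi / 2 * (real j' + (u - 3)))"
          unfolding j'_def cis_quarter_mod u(2) by (simp add: algebra_simps)
        moreover have "j' < 4" by (simp add: j'_def)
        ultimately show ?thesis by blast
      qed
    qed simp
  qed
qed

lemma at_side_01: "t \<in> T \<Longrightarrow> at_side t j i x \<Longrightarrow> x = 0 \<or> x = 1"
  unfolding at_side_def using hho_ends by metis

text \<open>Two sectors from the two families meet at a point other than \<open>v\<close>. It is not
  interior to a tile, as it would then be a single polygon point close to two corners; so it lies on
  an open edge, which is therefore common to both corners. Both end parameters are within 1/2 of its
  parameter and so agree. Comparing parameters instead of vertices keeps the two ends of a loop
  apart.\<close>

lemma shared_end:
  assumes v: "v \<in> V" and K12: "K1 \<inter> K2 = {}" "K1 \<noteq> {}" "K2 \<noteq> {}" "K1 \<union> K2 = CV v"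
  obtains t1 j1 t2 j2 i1 i2 x where "(t1, j1) \<in> K1" "(t2, j2) \<in> K2" "at_side t1 j1 i1 x" "at_side t2 j2 i2 x"
    "i1 < 4" "i2 < 4" "ed t1 i1 = ed t2 i2"
proof -
  define Q where "Q = (\<lambda>(t, j) \<delta>. \<forall>q\<in>cball 0 1. dist q (corner 4 j) < \<delta> \<longrightarrow>
    (\<forall>j'<4. j' \<noteq> j \<longrightarrow> \<delta> \<le> dist q (corner 4 j')) \<and>
    (q \<in> ball 0 1 \<or> q = corner 4 j \<or>
     (\<exists>i x s. at_side t j i x \<and> i < 4 \<and> s \<in> {0<..<1} \<and> q = cis (pi / 2 * (real i + s)) \<and> \<bar>hho t i s - x\<bar> < 1 / 2)))"
  obtain \<delta> where \<delta>: "\<delta> > 0" "\<And>x. x \<in> CV v \<Longrightarrow> Q x \<delta>"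
  proof (rule finite_uniform_radius[OF finite_CV, of v Q])
    show "\<exists>d>0. Q x d" if "x \<in> CV v" for x
      using near_corner that unfolding Q_def CV_def by fast
    show "Q x d'" if "Q x d" "d' \<le> d" for x d d'
      using that unfolding Q_def split_beta by (meson less_le_trans order_trans)
  qed (use that in auto)
  obtain t1 j1 t2 j2 q1 q2 where q: "(t1, j1) \<in> K1" "(t2, j2) \<in> K2" "q1 \<in> cball 0 1" "q2 \<in> cball 0 1"
    "dist q1 (corner 4 j1) < \<delta>" "dist q2 (corner 4 j2) < \<delta>" "F t1 q1 = F t2 q2" "F t1 q1 \<noteq> v"
    by (rule vertex_link[OF v K12 \<delta>(1)])
  have c: "(t1, j1) \<in> CV v" "(t2, j2) \<in> CV v" using q K12 by auto
  then have t: "t1 \<in> T" "t2 \<in> T" "j1 < 4" "j2 < 4" "F t1 (corner 4 j1) = v" "F t2 (corner 4 j2) = v"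
    by (auto simp: CV_def)
  have ne: "(t1, j1) \<noteq> (t2, j2)" using q K12 by blast
  have n1: "(\<forall>j'<4. j' \<noteq> j1 \<longrightarrow> \<delta> \<le> dist q1 (corner 4 j')) \<and>
    (q1 \<in> ball 0 1 \<or> q1 = corner 4 j1 \<or>
     (\<exists>i x s. at_side t1 j1 i x \<and> i < 4 \<and> s \<in> {0<..<1} \<and> q1 = cis (pi / 2 * (real i + s)) \<and> \<bar>hho t1 i s - x\<bar> < 1 / 2))"
    using \<delta>(2)[OF c(1)] q(3,5) unfolding Q_def by blast
  have n2: "(\<forall>j'<4. j' \<noteq> j2 \<longrightarrow> \<delta> \<le> dist q2 (corner 4 j')) \<and>
    (q2 \<in> ball 0 1 \<or> q2 = corner 4 j2 \<or>
     (\<exists>i x s. at_side t2 j2 i x \<and> i < 4 \<and> s \<in> {0<..<1} \<and> q2 = cis (pi / 2 * (real i + s)) \<and> \<bar>hho t2 i s - x\<bar> < 1 / 2))"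
    using \<delta>(2)[OF c(2)] q(4,6) unfolding Q_def by blast
  have notball: "\<not> (q1 \<in> ball 0 1 \<or> q2 \<in> ball 0 1)"
  proof
    assume "q1 \<in> ball 0 1 \<or> q2 \<in> ball 0 1"
    then have "t1 = t2 \<and> q1 = q2"
      using F_eqD[OF t(1,2) _ q(4,7)] F_eqD[OF t(2,1) _ q(3) q(7)[symmetric]] by blast
    then have "\<delta> \<le> dist q1 (corner 4 j2)" using n1 t(4) ne by blast
    then show False using q(6) \<open>t1 = t2 \<and> q1 = q2\<close> by simp
  qed
  have "q1 \<noteq> corner 4 j1" "q2 \<noteq> corner 4 j2" using q(7,8) t(5,6) by auto
  then obtain i1 x1 s1 i2 x2 s2 where
    1: "at_side t1 j1 i1 x1" "i1 < 4" "s1 \<in> {0<..<1}" "q1 = cis (pi / 2 * (real i1 + s1))" "\<bar>hho t1 i1 s1 - x1\<bar> < 1 / 2" and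
    2: "at_side t2 j2 i2 x2" "i2 < 4" "s2 \<in> {0<..<1}" "q2 = cis (pi / 2 * (real i2 + s2))" "\<bar>hho t2 i2 s2 - x2\<bar> < 1 / 2"
    using n1 n2 notball by blast
  have b: "F t1 q1 = \<gamma> (ed t1 i1) (hho t1 i1 s1)" "F t2 q2 = \<gamma> (ed t2 i2) (hho t2 i2 s2)"
    using bp_\<gamma>[OF t(1), of s1 i1] bp_\<gamma>[OF t(2), of s2 i2] 1 2 by auto
  have E12: "ed t1 i1 \<in> E" "ed t2 i2 \<in> E" using ed(1) t by auto
  have int: "hho t1 i1 s1 \<in> {0<..<1}" "hho t2 i2 s2 \<in> {0<..<1}" using hho_in' t 1(3) 2(3) by blast+
  have eq: "ed t1 i1 = ed t2 i2"
  proof (rule edge_eqI[OF E12])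
    show "F t1 q1 \<in> ed t1 i1 - V" using \<gamma>_interior[OF E12(1) int(1)] b by simp
    show "F t1 q1 \<in> ed t2 i2" using \<gamma>_interior[OF E12(2) int(2)] b q(7) by simp
  qed
  have "hho t1 i1 s1 = hho t2 i2 s2"
    by (rule \<gamma>_inj[OF E12(2) int(2)]) (use int b q(7) eq in auto)
  then have "\<bar>x1 - x2\<bar> < 1" using 1(5) 2(5) by linarith
  then have "x1 = x2" using at_side_01[OF t(1) 1(1)] at_side_01[OF t(2) 2(1)] by auto
  then show ?thesis using that q(1,2) 1 2 eq by blast
qed

lemma edge_ends: "e \<in> E \<Longrightarrow> e \<inter> V = {\<gamma> e 0, \<gamma> e 1}"
  using \<gamma>[of e] by (simp add: traverses_def pathstart_def pathfinish_def)

lemma corner_\<gamma>: assumes "t \<in> T"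
  shows "F t (corner 4 j) = \<gamma> (ed t j) (hho t j 0)" "F t (corner 4 (j + 1)) = \<gamma> (ed t j) (hho t j 1)"
  using bp_\<gamma>[OF assms, of 0 j] bp_\<gamma>[OF assms, of 1 j] by (simp_all add: corner4 add.commute)

lemma corner_ends: assumes "t \<in> T"
  shows "ed t j \<inter> V = {F t (corner 4 j), F t (corner 4 (j + 1))}"
  unfolding edge_ends[OF ed(1)[OF assms]] corner_\<gamma>(1)[OF assms, of j] corner_\<gamma>(2)[OF assms, of j]
  by (cases "sg t j") (simp_all add: hho_ends[OF assms] insert_commute)

lemma at_side_next: "j < 4 \<Longrightarrow> at_side t ((j + 1) mod 4) j (hho t j 1)"
proof -
  assume "j < 4"
  then have "((j + 1) mod 4 + 3) mod 4 = j" by presburger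
  then show ?thesis by (simp add: at_side_def)
qed

lemma sn_eq_1: "t \<in> T \<Longrightarrow> sn t j = 1 \<longleftrightarrow> (sg t j \<longleftrightarrow> ori t = 1)"
  using ori(1)[of t] by (auto simp: sn_def)

text \<open>Orient every edge as its selected side runs, with the boundary of each tile oriented
  counterclockwise. Both sides at a corner then point into the vertex or both point out of it, so
  every vertex is a source or a sink.\<close>

lemma bipartite_if_selection:
  assumes alt: "\<And>t j. t \<in> T \<Longrightarrow> j < 4 \<Longrightarrow> (t, (j + 1) mod 4) \<in> Ch \<longleftrightarrow> (t, j) \<notin> Ch"
    and one: "\<And>e. e \<in> E \<Longrightarrow> \<exists>!x. x \<in> K e \<and> x \<in> Ch"
  shows "bipartite V E"
proof -
  \<comment> \<open>\<open>pos e\<close> says that the orientation chosen for \<open>e\<close>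
    agrees with \<open>\<gamma> e\<close>, and \<open>\<tau> t j\<close> that the edges at corner
    \<open>j\<close> of \<open>t\<close> point away from the vertex.\<close>
  define pos where "pos e \<longleftrightarrow> (\<exists>t j. (t, j) \<in> K e \<and> (t, j) \<in> Ch \<and> sn t j = 1)" for e
  define \<tau> where "\<tau> t j \<longleftrightarrow> (ori t = 1 \<longleftrightarrow> (t, j) \<in> Ch)" for t j
  have claim1: "sn t i = 1 \<longleftrightarrow> (pos e \<longleftrightarrow> (t, i) \<in> Ch)" if e: "e \<in> E" "(t, i) \<in> K e" for e t i
  proof -
    obtain t1 j1 t2 j2 where k: "K e = {(t1, j1), (t2, j2)}" "(t1, j1) \<noteq> (t2, j2)" "sn t1 j1 = 1" "sn t2 j2 = -1"
      using two_sides[OF e(1)] by metis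
    have "(t1, j1) \<in> Ch \<longleftrightarrow> (t2, j2) \<notin> Ch" using one[OF e(1)] k(1,2) by auto
    moreover have "pos e \<longleftrightarrow> (t1, j1) \<in> Ch" unfolding pos_def k(1) using k(3,4) by auto
    moreover have "(t, i) = (t1, j1) \<or> (t, i) = (t2, j2)" using e(2) k(1) by auto
    ultimately show ?thesis using k(3,4) by auto
  qed
  \<comment> \<open>An end \<open>x\<close> of an edge is its tail exactly if x = 0 agrees with
    \<open>pos\<close>. Whichever of the two sides at the corner is consulted, the answer is
    \<open>\<tau> t j\<close>, because exactly one of them is selected.\<close>
  have claim2: "\<tau> t j \<longleftrightarrow> (x = 0 \<longleftrightarrow> pos (ed t i))" if t: "t \<in> T" "j < 4" and s: "at_side t j i x" for t j i x
  proof -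
    have i: "i < 4" using s t(2) by (auto simp: at_side_def)
    have c: "sn t i = 1 \<longleftrightarrow> (pos (ed t i) \<longleftrightarrow> (t, i) \<in> Ch)"
      by (rule claim1) (use ed(1)[OF t(1)] t i in \<open>auto simp: K_def\<close>)
    consider "i = j" "x = hho t j 0" | "i = (j + 3) mod 4" "x = hho t i 1"
      using s by (auto simp: at_side_def)
    then show ?thesis
    proof cases
      case 1
      then show ?thesis using c hho_ends[OF t(1), of j] sn_eq_1[OF t(1), of j] unfolding \<tau>_def by auto
    next
      case 2
      have "j = (i + 1) mod 4" using 2 t(2) by presburger
      then have "(t, j) \<in> Ch \<longleftrightarrow> (t, i) \<notin> Ch" using alt[OF t(1) i] by simp
      then show ?thesis using 2 c hho_ends[OF t(1), of i] sn_eq_1[OF t(1), of i] unfolding \<tau>_def by auto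
    qed
  qed
  \<comment> \<open>If \<open>\<tau>\<close> took both values at \<open>v\<close>, two corners with
    different values would share an end of an edge, where \<open>claim2\<close> forces them to
    agree.\<close>
  have claim3: "\<tau> t j \<longleftrightarrow> \<tau> t' j'" if "(t, j) \<in> CV v" "(t', j') \<in> CV v" for t j t' j' v
  proof (rule ccontr)
    assume ne: "\<not> (\<tau> t j \<longleftrightarrow> \<tau> t' j')"
    define K1 where "K1 = {(t, j) \<in> CV v. \<tau> t j}"
    define K2 where "K2 = {(t, j) \<in> CV v. \<not> \<tau> t j}"
    have "v \<in> V" using that F_corner by (auto simp: CV_def)
    moreover have "K1 \<inter> K2 = {}" "K1 \<noteq> {}" "K2 \<noteq> {}" "K1 \<union> K2 = CV v"
      using that ne by (auto simp: K1_def K2_def)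
    ultimately obtain t1 j1 t2 j2 i1 i2 x where "(t1, j1) \<in> K1" "(t2, j2) \<in> K2" "at_side t1 j1 i1 x" "at_side t2 j2 i2 x"
      "ed t1 i1 = ed t2 i2"
      using shared_end by metis
    then show False using claim2[of t1 j1 i1 x] claim2[of t2 j2 i2 x] by (auto simp: K1_def K2_def CV_def)
  qed
  define col where "col v \<longleftrightarrow> (\<exists>t j. (t, j) \<in> CV v \<and> \<tau> t j)" for v
  have col: "col v \<longleftrightarrow> \<tau> t j" if "(t, j) \<in> CV v" for t j v
    using claim3 that unfolding col_def by blast
  show ?thesis
    unfolding bipartite_def
  proof (intro exI[of _ col] ballI)
    fix e assume e: "e \<in> E"
    obtain t j where tj: "(t, j) \<in> K e" using K_nonempty[OF e] .
    then have t: "t \<in> T" "j < 4" "ed t j = e" by (auto simp: K_def)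
    let ?u = "F t (corner 4 j)" and ?v = "F t (corner 4 (j + 1))"
    have "(t, j) \<in> CV ?u" using t by (auto simp: CV_def)
    moreover have "(t, (j + 1) mod 4) \<in> CV ?v" using t corner4_mod[of "j + 1"] by (simp add: CV_def)
    ultimately have "col ?u \<longleftrightarrow> \<tau> t j" "col ?v \<longleftrightarrow> \<tau> t ((j + 1) mod 4)" using col by auto
    moreover have "\<tau> t j \<longleftrightarrow> (hho t j 0 = 0 \<longleftrightarrow> pos e)"
      using claim2[OF t(1,2), of j "hho t j 0"] t(3) by (simp add: at_side_def)
    moreover have "\<tau> t ((j + 1) mod 4) \<longleftrightarrow> (hho t j 1 = 0 \<longleftrightarrow> pos e)"
      using claim2[OF t(1) _ at_side_next[OF t(2)]] t(3) by simp
    ultimately have "col ?u \<noteq> col ?v" using hho_ends[OF t(1), of j] by auto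
    then show "\<exists>u v. e \<inter> V = {u, v} \<and> col u \<noteq> col v"
      using corner_ends[OF t(1), of j] t(3) by blast
  qed
qed

lemma bipartite_corners:
  assumes col: "\<And>e. e \<in> E \<Longrightarrow> \<exists>u v. e \<inter> V = {u, v} \<and> col u \<noteq> (col v :: bool)" and t: "t \<in> T"
  shows "col (F t (corner 4 (j + 1))) \<longleftrightarrow> \<not> col (F t (corner 4 j))"
proof -
  obtain u v where "ed t j \<inter> V = {u, v}" "col u \<noteq> col v" using col[OF ed(1)[OF t]] by blast
  then show ?thesis using corner_ends[OF t, of j] by (metis (full_types) doubleton_eq_iff)
qed

text \<open>Select the sides that run from one colour to the other when the boundary of each tile is
  oriented counterclockwise; the two sides of an edge run in opposite directions.\<close>

lemma selection_if_bipartite: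
  assumes "bipartite V E"
  obtains Ch where "\<And>t j. t \<in> T \<Longrightarrow> (t, j + 1) \<in> Ch \<longleftrightarrow> (t, j) \<notin> Ch"
    "\<And>e. e \<in> E \<Longrightarrow> \<exists>!x. x \<in> K e \<and> x \<in> Ch"
proof -
  obtain col where col: "\<And>e. e \<in> E \<Longrightarrow> \<exists>u v. e \<inter> V = {u, v} \<and> col u \<noteq> (col v :: bool)"
    using assms unfolding bipartite_def by blast
  define Ch where "Ch = {(t, j). col (F t (corner 4 j)) \<longleftrightarrow> ori t = 1}"
  have Ch: "(t, j) \<in> Ch \<longleftrightarrow> (sn t j = 1 \<longleftrightarrow> col (\<gamma> e 0))" if "(t, j) \<in> K e" for t j e
  proof -
    have t: "t \<in> T" "ed t j = e" "e \<in> E" using that ed(1) by (auto simp: K_def)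
    have "col (\<gamma> e 1) \<longleftrightarrow> \<not> col (\<gamma> e 0)"
      using col[OF t(3)] edge_ends[OF t(3)] by (metis (full_types) doubleton_eq_iff)
    then show ?thesis
      using corner_\<gamma>(1)[OF t(1), of j] hho_ends(1)[OF t(1), of j] sn_eq_1[OF t(1), of j] t(2) by (auto simp: Ch_def)
  qed
  show ?thesis
  proof
    show "(t, j + 1) \<in> Ch \<longleftrightarrow> (t, j) \<notin> Ch" if "t \<in> T" for t j
      using bipartite_corners[OF col that, of j] by (auto simp: Ch_def)
    fix e assume e: "e \<in> E"
    obtain t1 j1 t2 j2 where k: "K e = {(t1, j1), (t2, j2)}" "(t1, j1) \<noteq> (t2, j2)" "sn t1 j1 = 1" "sn t2 j2 = -1"
      using two_sides[OF e] by metis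
    have "(t1, j1) \<in> Ch \<longleftrightarrow> (t2, j2) \<notin> Ch"
      using Ch[of t1 j1 e] Ch[of t2 j2 e] k by auto
    then show "\<exists>!x. x \<in> K e \<and> x \<in> Ch" unfolding k(1) using k(2) by blast
  qed
qed

section \<open>Tiles of a bipartite tiling\<close>

text \<open>Gluing two consecutive sides uses up both sides of their edge. A further corner at the
  common vertex \<open>v\<close> would share an end of this edge and so be a neighbouring corner of
  the same tile, but that corner has the other colour. So \<open>v\<close> has a single corner and a
  single edge, and its degree is too small.\<close>

lemma bipartite_no_fold:
  assumes "bipartite V E" and t: "t \<in> T" "a < 4" and fold: "ed t a = ed t ((a + 1) mod 4)"
  shows False
proof -
  obtain col where col: "\<And>e. e \<in> E \<Longrightarrow> \<exists>u v. e \<inter> V = {u, v} \<and> col u \<noteq> (col v :: bool)"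
    using assms(1) unfolding bipartite_def by blast
  define b where "b = (a + 1) mod 4"
  define e where "e = ed t a"
  define v where "v = F t (corner 4 b)"
  have b: "b < 4" "a \<noteq> b" "(b + 3) mod 4 = a"
  proof -
    show "b < 4" by (simp add: b_def)
    show "(b + 3) mod 4 = a" using mod4_pred[OF t(2)] by (simp add: b_def)
    show "a \<noteq> b" unfolding b_def by presburger
  qed
  have e: "e \<in> E" "ed t b = e" using ed(1)[OF t(1)] fold by (auto simp: e_def b_def)
  have Ke: "K e = {(t, a), (t, b)}"
  proof -
    have "(t, a) \<in> K e" "(t, b) \<in> K e" using t b e by (auto simp: K_def e_def)
    then show ?thesis using at_most_two_sides[of "(t, a)" e "(t, b)"] b(2) by blast
  qed
  have v: "v \<in> V" using F_corner[OF t(1)] by (simp add: v_def)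
  have cols: "col (F t (corner 4 a)) \<noteq> col v" "col (F t (corner 4 (b + 1))) \<noteq> col v"
    using bipartite_corners[OF col t(1), of a] bipartite_corners[OF col t(1), of b] corner4_mod[of "a + 1"]
    by (auto simp: v_def b_def)
  have "CV v = {(t, b)}"
  proof (rule ccontr)
    assume ne: "CV v \<noteq> {(t, b)}"
    have tb: "(t, b) \<in> CV v" using t b by (auto simp: CV_def v_def)
    have h: "{(t, b)} \<inter> (CV v - {(t, b)}) = {}" "{(t, b)} \<noteq> {}" "CV v - {(t, b)} \<noteq> {}"
      "{(t, b)} \<union> (CV v - {(t, b)}) = CV v"
      using ne tb by auto
    obtain t1 j1 t2 j2 i1 i2 x where s: "(t1, j1) \<in> {(t, b)}" "(t2, j2) \<in> CV v - {(t, b)}"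
      "at_side t1 j1 i1 x" "at_side t2 j2 i2 x" "i1 < 4" "i2 < 4" "ed t1 i1 = ed t2 i2"
      by (rule shared_end[OF v h])
    have "ed t1 i1 = e" using s(1,3) b(3) e by (auto simp: at_side_def e_def)
    then have "(t2, i2) \<in> K e" using s by (auto simp: K_def CV_def)
    then have t2: "t2 = t" "i2 = a \<or> i2 = b" using Ke by auto
    have j2: "j2 < 4" "F t (corner 4 j2) = v" "j2 \<noteq> b" using s(2) t2 by (auto simp: CV_def)
    have "i2 = j2 \<or> j2 = (i2 + 1) mod 4"
    proof -
      have "i2 = j2 \<or> i2 = (j2 + 3) mod 4" using s(4) by (auto simp: at_side_def)
      then show ?thesis using mod4_succ[OF j2(1)] by auto
    qed
    then have "j2 = a \<or> j2 = (b + 1) mod 4" using t2(2) j2(3) b_def by auto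
    then have "col (F t (corner 4 j2)) \<noteq> col v" using cols corner4_mod[of "b + 1"] by metis
    then show False using j2(2) by simp
  qed
  have "e' = e" if e': "e' \<in> E" "v \<in> e'" for e'
  proof -
    obtain t' j' where k: "(t', j') \<in> K e'" using K_nonempty[OF e'(1)] .
    then have t': "t' \<in> T" "j' < 4" "ed t' j' = e'" by (auto simp: K_def)
    have "v = F t' (corner 4 j') \<or> v = F t' (corner 4 (j' + 1))"
      using corner_ends[OF t'(1), of j'] t'(3) e'(2) v by blast
    then have "(t', j') \<in> CV v \<or> (t', (j' + 1) mod 4) \<in> CV v"
      using t' corner4_mod[of "j' + 1"] by (auto simp: CV_def)
    then have "t' = t \<and> (j' = b \<or> (j' + 1) mod 4 = b)" unfolding \<open>CV v = {(t, b)}\<close> by auto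
    moreover have "j' = a" if "(j' + 1) mod 4 = b" using mod4_pred[OF t'(2)] that b(3) by simp
    ultimately show ?thesis using t'(3) e by (auto simp: e_def)
  qed
  then have "{e' \<in> E. v \<in> e'} \<subseteq> {e}" by blast
  then have "degree V E v \<le> (\<Sum>e'\<in>{e}. if e' \<inter> V = {v} then 2 else 1)"
    unfolding degree_def by (rule sum_mono2[rotated]) auto
  also have "\<dots> \<le> 2" by simp
  finally show False using deg[OF v] by simp
qed

text \<open>Consecutive sides are excluded by the degree condition. Glued opposite sides run along
  their edge in opposite directions, so the start of one is the end of the other; these are adjacent
  corners of the tile, which have different colours.\<close>

lemma bipartite_sides_distinct:
  assumes bip: "bipartite V E" and t: "t \<in> T" "i < 4" "j < 4" "i < j"
  shows "ed t i \<noteq> ed t j"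
proof
  assume eq: "ed t i = ed t j"
  obtain col where col: "\<And>e. e \<in> E \<Longrightarrow> \<exists>u v. e \<inter> V = {u, v} \<and> col u \<noteq> (col v :: bool)"
    using bip unfolding bipartite_def by blast
  consider "j = i + 1" | "i = 0" "j = 3" | "j = i + 2" using t by linarith
  then show False
  proof cases
    case 1
    then show False using bipartite_no_fold[OF bip t(1,2)] eq t by simp
  next
    case 2
    then show False using bipartite_no_fold[OF bip t(1,3)] eq by simp
  next
    case 3
    have "(t, i) \<in> K (ed t j)" "(t, j) \<in> K (ed t j)" "(t, i) \<noteq> (t, j)" using t eq by (auto simp: K_def)
    then have "sn t i = - sn t j" by (rule sides_opposite)
    then have "sg t i \<noteq> sg t j" using ori(1)[OF t(1)] by (auto simp: sn_def split: if_splits)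
    then have "hho t i 0 = hho t j 1" using hho_ends[OF t(1)] by auto
    then have "F t (corner 4 i) = F t (corner 4 (j + 1))"
      using corner_\<gamma>[OF t(1)] eq by simp
    moreover have "col (F t (corner 4 (j + 1 + 1))) \<noteq> col (F t (corner 4 (j + 1)))"
      using bipartite_corners[OF col t(1), of "j + 1"] by simp
    moreover have "corner 4 (j + 1 + 1) = corner 4 i"
    proof -
      have "j + 1 + 1 = i + 4" using 3 by simp
      then show ?thesis by (simp only: corner4_add4)
    qed
    ultimately show False by simp
  qed
qed


text \<open>\<open>ed\<close> was chosen separately for every index, but the image of a side depends
  only on the index modulo 4 and determines its edge.\<close>

lemma ed_mod: "t \<in> T \<Longrightarrow> ed t (j mod 4) = ed t j"
proof -
  assume t: "t \<in> T"
  have "ed t (j mod 4) - V = ed t j - V" using ed(2)[OF t, of "j mod 4"] ed(2)[OF t, of j] by simp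
  then show ?thesis using edge_closure[OF \<gamma>[OF ed(1)[OF t]]] by metis
qed

end

lemma corner4_Suc: "corner 4 (k + 1) = \<i> * corner 4 k"
proof -
  have "pi / 2 * real (k + 1) = pi / 2 + pi / 2 * real k" by (simp add: algebra_simps)
  then show ?thesis unfolding corner4 by (simp only: cis_mult[symmetric] cis_pi_half)
qed

lemma side4_Suc: "side 4 (k + 1) = (*) \<i> ` side 4 k"
proof -
  have "pi / 2 * (real (k + 1) + s) = pi / 2 + pi / 2 * (real k + s)" for s by (simp add: algebra_simps)
  then show ?thesis unfolding side4 image_image by (simp only: cis_mult[symmetric] cis_pi_half)
qed

text \<open>A quarter turn shifts the labels by one; this brings a tile whose corners 2 and 4 are
  identified into the normal form with corners 1 and 3.\<close>

lemma polygon_map_rotate: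
  assumes "polygon_map V E t 4 f"
  shows "polygon_map V E t 4 (f \<circ> (*) \<i>)"
proof -
  have f: "continuous_on (cball 0 1) f" "\<exists>g. homeomorphism (ball 0 1) t f g"
    "\<And>k. k \<in> {1..4} \<Longrightarrow> f (corner 4 k) \<in> V"
    "\<And>k. k \<in> {1..4} \<Longrightarrow> \<exists>e\<in>E. \<exists>g. homeomorphism (side 4 k) (e - V) f g"
    using assms by (auto simp: polygon_map_def)
  have rot: "homeomorphism S ((*) \<i> ` S) ((*) \<i>) ((*) (- \<i>))" for S :: "complex set"
    unfolding homeomorphism_def by (auto intro!: continuous_intros simp: image_image)
  have ball: "(*) \<i> ` ball 0 1 = ball (0::complex) 1"
  proof
    show "ball (0::complex) 1 \<subseteq> (*) \<i> ` ball 0 1"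
    proof
      fix z :: complex assume "z \<in> ball 0 1"
      then show "z \<in> (*) \<i> ` ball 0 1"
        by (intro image_eqI[of _ _ "- \<i> * z"]) (auto simp: norm_mult)
    qed
  qed (auto simp: norm_mult)
  have nxt: "\<exists>k'\<in>{1..4}. corner 4 (k + 1) = corner 4 k' \<and> side 4 (k + 1) = side 4 k'" if "k \<in> {1..4}" for k
  proof (cases "k = 4")
    case True
    then show ?thesis using corner4_add4[of 1] side4_add4[of 1] by (intro bexI[of _ 1]) auto
  next
    case False
    then show ?thesis using that by (intro bexI[of _ "k + 1"]) auto
  qed
  show ?thesis
    unfolding polygon_map_def
  proof (intro conjI ballI)
    have "(*) \<i> ` cball 0 1 \<subseteq> cball 0 1" by (auto simp: norm_mult)
    then show "continuous_on (cball 0 1) (f \<circ> (*) \<i>)"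
      by (intro continuous_on_compose continuous_on_subset[OF f(1)] continuous_intros)
    show "\<exists>g. homeomorphism (ball 0 1) t (f \<circ> (*) \<i>) g"
      using f(2) homeomorphism_compose[OF rot[of "ball 0 1", unfolded ball]] by blast
    fix k :: nat assume k: "k \<in> {1..4}"
    obtain k' where k': "k' \<in> {1..4}" "corner 4 (k + 1) = corner 4 k'" "side 4 (k + 1) = side 4 k'"
      using nxt[OF k] by blast
    show "(f \<circ> (*) \<i>) (corner 4 k) \<in> V"
      using f(3)[OF k'(1)] k'(2) corner4_Suc[of k] by simp
    show "\<exists>e\<in>E. \<exists>g. homeomorphism (side 4 k) (e - V) (f \<circ> (*) \<i>) g"
      using f(4)[OF k'(1)] homeomorphism_compose[OF rot[of "side 4 k", folded side4_Suc]] k'(3) by metis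
  qed
qed

lemma corner_identifications_eq:
  assumes adj: "\<And>k. f (corner 4 (k + 1)) \<noteq> f (corner 4 k)"
  shows "corner_identifications f = {(i, j). (i = 1 \<and> j = 3 \<and> f (corner 4 1) = f (corner 4 3)) \<or>
    (i = 2 \<and> j = 4 \<and> f (corner 4 2) = f (corner 4 4))}"
proof -
  have a: "f (corner 4 1) \<noteq> f (corner 4 2)" "f (corner 4 2) \<noteq> f (corner 4 3)" "f (corner 4 3) \<noteq> f (corner 4 4)"
    "f (corner 4 4) \<noteq> f (corner 4 1)"
    using adj[of 1] adj[of 2] adj[of 3] adj[of 4] corner4_add4[of 1] by (auto simp: numeral_eq_Suc)
  have "(1 \<le> i \<and> i < j \<and> j \<le> 4 \<and> f (corner 4 i) = f (corner 4 j)) \<longleftrightarrow>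
    (i = 1 \<and> j = 3 \<and> f (corner 4 1) = f (corner 4 3)) \<or> (i = 2 \<and> j = 4 \<and> f (corner 4 2) = f (corner 4 4))" for i j
  proof
    assume ij: "1 \<le> i \<and> i < j \<and> j \<le> 4 \<and> f (corner 4 i) = f (corner 4 j)"
    then consider "i = 1" "j = 2" | "i = 1" "j = 3" | "i = 1" "j = 4" | "i = 2" "j = 3" | "i = 2" "j = 4" | "i = 3" "j = 4"
    proof -
      have "i \<in> {1, 2, 3}" "j \<in> {2, 3, 4}" "i < j" using ij by auto
      then show ?thesis using that by auto
    qed
    then show "(i = 1 \<and> j = 3 \<and> f (corner 4 1) = f (corner 4 3)) \<or> (i = 2 \<and> j = 4 \<and> f (corner 4 2) = f (corner 4 4))"
      by cases (use ij a in metis)+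
  qed auto
  then show ?thesis unfolding corner_identifications_def by auto
qed

context lifted_tiling
begin

text \<open>Adjacent corners have different colours, which leaves only the two pairs of opposite
  corners to be identified. If only the corners 2 and 4 agree, the rotated map \<open>f'\<close>
  witnesses the type.\<close>

lemma bipartite_tile_types:
  assumes bip: "bipartite V E" and t: "t \<in> T"
  shows "tile_Q V E t \<or> tile_Q13 V E t \<or> tile_Q13_24 V E t"
proof -
  obtain col where col: "\<And>e. e \<in> E \<Longrightarrow> \<exists>u v. e \<inter> V = {u, v} \<and> col u \<noteq> (col v :: bool)"
    using bip unfolding bipartite_def by blast
  define f' where "f' = F t \<circ> (*) \<i>"
  have adj: "F t (corner 4 (k + 1)) \<noteq> F t (corner 4 k)" for k
    using bipartite_corners[OF col t, of k] by auto
  have f'c: "f' (corner 4 k) = F t (corner 4 (k + 1))" for k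
    by (simp only: f'_def comp_def corner4_Suc)
  have adj': "f' (corner 4 (k + 1)) \<noteq> f' (corner 4 k)" for k
    unfolding f'c by (rule adj)
  have "F t ` side 4 i \<noteq> F t ` side 4 j" if "i mod 4 \<noteq> j mod 4" for i j
  proof
    assume "F t ` side 4 i = F t ` side 4 j"
    then have "ed t i - V = ed t j - V" using ed(2)[OF t] by metis
    then have "ed t i = ed t j" using edge_closure[OF \<gamma>[OF ed(1)[OF t]]] by metis
    then have eq: "ed t (i mod 4) = ed t (j mod 4)" using ed_mod[OF t] by simp
    show False
    proof (cases "i mod 4 < j mod 4")
      case True
      then show False using bipartite_sides_distinct[OF bip t, of "i mod 4" "j mod 4"] eq by simp
    next
      case False
      then show False using bipartite_sides_distinct[OF bip t, of "j mod 4" "i mod 4"] eq that by simp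
    qed
  qed
  then have ne: "F t ` side 4 i \<noteq> F t ` side 4 j" if "a \<le> i" "i < j" "j < a + 4" for a i j
  proof -
    have "i mod 4 \<noteq> j mod 4"
    proof
      assume "i mod 4 = j mod 4"
      then have "4 dvd j - i" using mod_eq_dvd_iff_nat[of i j 4] that by simp
      then show False using dvd_imp_le[of 4 "j - i"] that by simp
    qed
    then show ?thesis using \<open>\<And>j i. i mod 4 \<noteq> j mod 4 \<Longrightarrow> F t ` side 4 i \<noteq> F t ` side 4 j\<close> by blast
  qed
  have e: "edge_identifications (F t) = {}"
  proof -
    have "F t ` side 4 i \<noteq> F t ` side 4 j" if "1 \<le> i" "i < j" "j \<le> 4" for i j
      using ne[of 1 i j] that by simp
    then show ?thesis unfolding edge_identifications_def by blast
  qed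
  have e': "edge_identifications f' = {}"
  proof -
    have "f' ` side 4 i = F t ` side 4 (i + 1)" for i
      unfolding f'_def image_comp[symmetric] side4_Suc ..
    moreover have "F t ` side 4 (i + 1) \<noteq> F t ` side 4 (j + 1)" if "1 \<le> i" "i < j" "j \<le> 4" for i j
      using ne[of 2 "i + 1" "j + 1"] that by simp
    ultimately show ?thesis unfolding edge_identifications_def by auto
  qed
  have ff: "polygon_map V E t 4 (F t)" "polygon_map V E t 4 f'"
    using F[OF t] polygon_map_rotate unfolding f'_def by blast+
  note ci = corner_identifications_eq[of "F t", OF adj] corner_identifications_eq[of f', OF adj']
  have "f' (corner 4 1) = F t (corner 4 2)" "f' (corner 4 2) = F t (corner 4 3)" "f' (corner 4 3) = F t (corner 4 4)"
    "f' (corner 4 4) = F t (corner 4 1)"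
    unfolding f'c using corner4_add4[of 1] by (simp_all add: numeral_eq_Suc)
  note ci = ci[unfolded this]
  consider "F t (corner 4 1) \<noteq> F t (corner 4 3)" "F t (corner 4 2) \<noteq> F t (corner 4 4)"
    | "F t (corner 4 1) = F t (corner 4 3)" "F t (corner 4 2) \<noteq> F t (corner 4 4)"
    | "F t (corner 4 1) \<noteq> F t (corner 4 3)" "F t (corner 4 2) = F t (corner 4 4)"
    | "F t (corner 4 1) = F t (corner 4 3)" "F t (corner 4 2) = F t (corner 4 4)" by blast
  then show ?thesis
  proof cases
    case 1
    then have "corner_identifications (F t) = {}" unfolding ci by auto
    then show ?thesis using e ff unfolding tile_of_type_def by blast
  next
    case 2
    then have "corner_identifications (F t) = {(1, 3)}" unfolding ci by auto
    then show ?thesis using e ff unfolding tile_of_type_def by blast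
  next
    case 3
    then have "corner_identifications f' = {(1, 3)}" unfolding ci by auto
    then show ?thesis using e' ff unfolding tile_of_type_def by blast
  next
    case 4
    then have "corner_identifications (F t) = {(1, 3), (2, 4)}" unfolding ci by auto
    then show ?thesis using e ff unfolding tile_of_type_def by blast
  qed
qed

section \<open>From two-colourings to subdivisions and back\<close>

lemma pt_side: "t \<in> T \<Longrightarrow> pt t j \<in> side 4 j"
  using mid[of t j] by (auto simp: pt_def side4)

lemma pt_chord:
  assumes t: "t \<in> T" "k \<le> 1"
  shows "arc (linepath (pt t k) (pt t (k + 2)))" "linepath (pt t k) (pt t (k + 2)) ` {0<..<1} \<subseteq> ball 0 1"
proof -
  have ne: "pt t k \<noteq> pt t (k + 2)" using pt_inj[OF t(1), of k "k + 2"] t(2) by auto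
  then show "arc (linepath (pt t k) (pt t (k + 2)))" by (rule arc_linepath)
  show "linepath (pt t k) (pt t (k + 2)) ` {0<..<1} \<subseteq> ball 0 1"
  proof safe
    fix s :: real assume "s \<in> {0<..<1}"
    then have "linepath (pt t k) (pt t (k + 2)) s \<in> open_segment (pt t k) (pt t (k + 2))"
      using ne by (auto simp: in_segment linepath_def intro!: exI[of _ s])
    then have "norm (linepath (pt t k) (pt t (k + 2)) s) < 1"
      using dist_decreases_open_segment[of _ "pt t k" "pt t (k + 2)" 0] pt_sphere[of t] by (auto simp: dist_norm)
    then show "linepath (pt t k) (pt t (k + 2)) s \<in> ball 0 1" by simp
  qed
qed

text \<open>As the selection alternates around a tile, it consists of two opposite sides
  \<open>k t\<close> and \<open>k t + 2\<close>, which a chord of the polygon joins. The middle of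
  an edge is used once because exactly one of its sides is selected.\<close>

lemma subdivisible_if_bipartite:
  assumes bip: "bipartite V E"
  shows "subdivisible torus V E"
proof -
  obtain Ch where Ch: "\<And>t j. t \<in> T \<Longrightarrow> (t, j + 1) \<in> Ch \<longleftrightarrow> (t, j) \<notin> Ch"
    "\<And>e. e \<in> E \<Longrightarrow> \<exists>!x. x \<in> K e \<and> x \<in> Ch"
    by (rule selection_if_bipartite[OF bip]) (rule that)
  define k :: "(complex \<times> complex) set \<Rightarrow> nat" where "k t = (if (t, 0) \<in> Ch then 0 else 1)" for t
  have kCh: "(t, j) \<in> Ch \<longleftrightarrow> j = k t \<or> j = k t + 2" if "t \<in> T" "j < 4" for t j
  proof -
    have "(t, 1) \<in> Ch \<longleftrightarrow> (t, 0) \<notin> Ch" "(t, 2) \<in> Ch \<longleftrightarrow> (t, 0) \<in> Ch" "(t, 3) \<in> Ch \<longleftrightarrow> (t, 0) \<notin> Ch"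
      using Ch(1)[OF that(1), of 0] Ch(1)[OF that(1), of 1] Ch(1)[OF that(1), of 2] by (auto simp: numeral_eq_Suc)
    moreover have "j = 0 \<or> j = 1 \<or> j = 2 \<or> j = 3" using that(2) by linarith
    ultimately show ?thesis by (auto simp: k_def)
  qed
  define m where "m e = \<gamma> e (1 / 2)" for e
  define c where "c t = F t \<circ> linepath (pt t (k t)) (pt t (k t + 2))" for t
  have m: "m e \<in> e - V" if "e \<in> E" for e
    using \<gamma>_interior[OF that, of "1/2"] by (simp add: m_def)
  have m_inj: "e = e'" if "e \<in> E" "e' \<in> E" "m e = m e'" for e e'
    using edge_eqI[OF that(1,2) m[OF that(1)]] m[OF that(2)] that(3) by simp
  have c01: "c t 0 = m (ed t (k t))" "c t 1 = m (ed t (k t + 2))" if "t \<in> T" for t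
    using F_pt[OF that] by (simp_all add: c_def m_def linepath_def)
  have k1: "k t \<le> 1" "k t < 4" "k t + 2 < 4" for t by (simp_all add: k_def)
  have "simple_pentagonal_subdivision torus V E m c"
    unfolding simple_pentagonal_subdivision_def
  proof (intro conjI ballI)
    show "m e \<in> e - V" if "e \<in> E" for e by (rule m[OF that])
    fix t assume t: "t \<in> T"
    show "joins_opposite_sides V E (m ` E) t (c t)"
      unfolding joins_opposite_sides_def
    proof (intro exI conjI)
      show "polygon_map V E t 4 (F t)" by (rule F[OF t])
      show "arc (linepath (pt t (k t)) (pt t (k t + 2)))"
        "linepath (pt t (k t)) (pt t (k t + 2)) ` {0<..<1} \<subseteq> ball 0 1"
        using pt_chord[OF t k1(1)] by blast+
      show "pathstart (linepath (pt t (k t)) (pt t (k t + 2))) \<in> side 4 (k t)"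
        "pathfinish (linepath (pt t (k t)) (pt t (k t + 2))) \<in> side 4 (k t + 2)"
        using pt_side[OF t] by auto
      show "c t = F t \<circ> linepath (pt t (k t)) (pt t (k t + 2))" by (rule c_def)
      show "pathstart (c t) \<in> m ` E" "pathfinish (c t) \<in> m ` E"
        using c01[OF t] ed(1)[OF t] by (simp_all add: pathstart_def pathfinish_def)
    qed
  next
    fix e assume e: "e \<in> E"
    let ?S = "{(t, s). t \<in> T \<and> s \<in> {0, 1} \<and> c t s = m e}"
    obtain t j where tj: "(t, j) \<in> K e" "(t, j) \<in> Ch" "\<And>x. x \<in> K e \<Longrightarrow> x \<in> Ch \<Longrightarrow> x = (t, j)"
      using Ch(2)[OF e] by (metis prod.exhaust)
    have t: "t \<in> T" "j < 4" "ed t j = e" using tj(1) by (auto simp: K_def)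
    have uniq: "u = t \<and> l = j" if "u \<in> T" "l = k u \<or> l = k u + 2" "ed u l = e" for u l
    proof -
      have "l < 4" using that(2) k1[of u] by auto
      then have "(u, l) \<in> K e" "(u, l) \<in> Ch" using that kCh[of u l] by (auto simp: K_def)
      then show ?thesis using tj(3) by blast
    qed
    have endp: "c u s = m e \<longleftrightarrow> ed u (if s = 0 then k u else k u + 2) = e" if "u \<in> T" "s \<in> {0, 1}" for u s
      using that(2) c01[OF that(1)] m_inj[OF ed(1)[OF that(1)] e] by auto
    define s0 :: real where "s0 = (if j = k t then 0 else 1)"
    have jk: "j = k t \<or> j = k t + 2" using kCh[OF t(1,2)] tj(2) by blast
    have "?S = {(t, s0)}"
    proof
      show "{(t, s0)} \<subseteq> ?S" using t jk endp[OF t(1), of s0] by (auto simp: s0_def)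
      show "?S \<subseteq> {(t, s0)}"
      proof
        fix x assume "x \<in> ?S"
        then obtain u s where us: "x = (u, s)" "u \<in> T" "s \<in> {0, 1}" "c u s = m e" by blast
        then have "ed u (if s = 0 then k u else k u + 2) = e" using endp by blast
        then have "u = t \<and> (if s = 0 then k u else k u + 2) = j" using uniq us(2) by (metis (full_types))
        then show "x \<in> {(t, s0)}" using us by (auto simp: s0_def split: if_splits)
      qed
    qed
    then show "card ?S = 1" by simp
  qed
  then show ?thesis unfolding subdivisible_def by blast
qed

end

text \<open>The polygon maps are those in which the arcs are drawn. The sides where the arc of a
  tile ends are opposite, so they form a class of sides of equal parity, which alternates; each new
  vertex being used once means one selected side per edge.\<close>

lemma bipartite_if_subdivisible:
  assumes "quadrilateral_tiling torus V E" "subdivisible torus V E"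
  shows "bipartite V E"
proof -
  let ?T = "tiles torus V E"
  obtain m c where mc: "\<And>e. e \<in> E \<Longrightarrow> m e \<in> e - V" "\<And>t. t \<in> ?T \<Longrightarrow> joins_opposite_sides V E (m ` E) t (c t)"
    "\<And>e. e \<in> E \<Longrightarrow> card {(t, s). t \<in> ?T \<and> s \<in> {0, 1} \<and> c t s = m e} = 1"
    using assms(2) unfolding subdivisible_def simple_pentagonal_subdivision_def by blast
  have "\<exists>f k p. t \<in> ?T \<longrightarrow> (polygon_map V E t 4 f \<and> pathstart p \<in> side 4 k \<and> pathfinish p \<in> side 4 (k + 2) \<and>
        c t = f \<circ> p \<and> pathstart (c t) \<in> m ` E \<and> pathfinish (c t) \<in> m ` E)" for t
    using mc(2)[of t] unfolding joins_opposite_sides_def by blast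
  then obtain F k p where Fk: "\<And>t. t \<in> ?T \<Longrightarrow> polygon_map V E t 4 (F t) \<and> pathstart (p t) \<in> side 4 (k t) \<and>
      pathfinish (p t) \<in> side 4 (k t + 2) \<and> c t = F t \<circ> p t \<and> pathstart (c t) \<in> m ` E \<and> pathfinish (c t) \<in> m ` E"
    by metis
  obtain \<gamma> \<Gamma> L ed sg hh lam where "lifted_tiling V E F \<gamma> \<Gamma> L ed sg hh lam"
    using lifted_tiling_exists[OF assms(1), of F] Fk by blast
  then interpret lifted_tiling V E F \<gamma> \<Gamma> L ed sg hh lam .
  \<comment> \<open>An end of an arc is a new vertex and lies on an open edge; open edges are
    disjoint, so it is the new vertex of that edge.\<close>
  have hit: "F t q = m (ed t (i mod 4))" if h: "t \<in> T" "q \<in> side 4 i" "F t q \<in> m ` E" for t q i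
  proof -
    obtain e where e: "e \<in> E" "F t q = m e" using h(3) by blast
    have "F t q \<in> ed t i - V" using ed(2)[OF h(1), of i] h(2) by blast
    then have "ed t i = e" using edge_eqI[OF ed(1)[OF h(1)] e(1)] mc(1)[OF e(1)] e(2) by auto
    then show ?thesis using e ed_mod[OF h(1), of i] by simp
  qed
  have c01: "c t 0 = m (ed t (k t mod 4))" "c t 1 = m (ed t ((k t + 2) mod 4))" if "t \<in> T" for t
    using hit[OF that, of "p t 0" "k t"] hit[OF that, of "p t 1" "k t + 2"] Fk[OF that]
    by (auto simp: pathstart_def pathfinish_def)
  define Ch where "Ch = {(t, j :: nat). even j \<longleftrightarrow> even (k t)}"
  show ?thesis
  proof (rule bipartite_if_selection[of Ch])
    show "(t, (j + 1) mod 4) \<in> Ch \<longleftrightarrow> (t, j) \<notin> Ch" if "j < 4" for t j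
    proof -
      have "even ((j + 1) mod 4) \<longleftrightarrow> odd j" by presburger
      then show ?thesis by (auto simp: Ch_def)
    qed
    fix e assume e: "e \<in> E"
    obtain x where x: "{(t, s). t \<in> T \<and> s \<in> {0, 1} \<and> c t s = m e} = {x}"
      by (rule card_1_singletonE[OF mc(3)[OF e]])
    \<comment> \<open>\<open>f\<close> turns a use of a new vertex, by the end \<open>s\<close> of
      the arc in \<open>t\<close>, into the side of \<open>t\<close> on which that end lies.\<close>
    define f where "f = (\<lambda>(t, s :: real). (t, if s = 0 then k t mod 4 else (k t + 2) mod 4))"
    have m_inj: "e = e'" if "e \<in> E" "e' \<in> E" "m e = m e'" for e e'
      using edge_eqI[OF that(1,2) mc(1)[OF that(1)]] mc(1)[OF that(2)] that(3) by simp
    have par: "j = k t mod 4 \<or> j = (k t + 2) mod 4 \<longleftrightarrow> (even j \<longleftrightarrow> even (k t))" if "j < 4" for j t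
    proof -
      have "(k t mod 4 + 2) mod 4 = (k t + 2) mod 4" by (rule mod_add_left_eq)
      moreover have "even (k t mod 4) \<longleftrightarrow> even (k t)" by presburger
      ultimately show ?thesis using parity_mod4[OF that, of "k t mod 4"] by simp
    qed
    show "\<exists>!y. y \<in> K e \<and> y \<in> Ch"
    proof (rule ex1I[of _ "f x"])
      obtain t s where ts: "x = (t, s)" by force
      then have "(t, s) \<in> {(t, s). t \<in> T \<and> s \<in> {0, 1} \<and> c t s = m e}" unfolding x by simp
      then have "t \<in> T" "s \<in> {0, 1}" "c t s = m e" by auto
      then have "ed t (snd (f x)) = e"
      proof (cases "s = 0")
        case True
        then have "m (ed t (k t mod 4)) = m e" using c01[of t] \<open>t \<in> T\<close> \<open>c t s = m e\<close> by simp
        then show ?thesis using m_inj[OF ed(1)[OF \<open>t \<in> T\<close>] e] True by (simp add: f_def ts)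
      next
        case False
        then have "m (ed t ((k t + 2) mod 4)) = m e"
          using c01[of t] \<open>t \<in> T\<close> \<open>c t s = m e\<close> \<open>s \<in> {0, 1}\<close> by simp
        then show ?thesis using m_inj[OF ed(1)[OF \<open>t \<in> T\<close>] e] False by (simp add: f_def ts)
      qed
      moreover have "snd (f x) < 4" "fst (f x) = t" by (auto simp: f_def ts)
      moreover have "even (snd (f x)) \<longleftrightarrow> even (k t)"
        using par[of "snd (f x)" t] by (auto simp: f_def ts)
      ultimately show "f x \<in> K e \<and> f x \<in> Ch"
        using \<open>t \<in> T\<close> by (auto simp: K_def Ch_def split_beta)
      fix y assume y: "y \<in> K e \<and> y \<in> Ch"
      obtain u j where uj: "y = (u, j)" by force
      then have u: "u \<in> T" "j < 4" "ed u j = e" "j = k u mod 4 \<or> j = (k u + 2) mod 4"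
        using y par[of j u] by (auto simp: K_def Ch_def)
      show "y = f x"
      proof (cases "j = k u mod 4")
        case True
        then have "(u, 0) \<in> {(t, s). t \<in> T \<and> s \<in> {0, 1} \<and> c t s = m e}" using u c01 by auto
        then have "x = (u, 0)" unfolding x by simp
        then show ?thesis using uj True by (simp add: f_def)
      next
        case False
        then have "(u, 1) \<in> {(t, s). t \<in> T \<and> s \<in> {0, 1} \<and> c t s = m e}" using u c01 by auto
        then have "x = (u, 1)" unfolding x by simp
        then show ?thesis using uj u False by (simp add: f_def)
      qed
    qed
  qed
qed

section \<open>Parity of edge paths\<close>

text \<open>Edge paths in the lifted graph, recorded by their number of edges and their end points.\<close>

inductive lpath :: "(complex \<times> complex) set \<Rightarrow> (complex \<times> complex) set set \<Rightarrow> nat \<Rightarrow> complex \<Rightarrow> complex \<Rightarrow> bool"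
  for V E where
  base: "cov z \<in> V \<Longrightarrow> lpath V E 0 z z"
| step: "lpath V E n z z' \<Longrightarrow> e \<in> E \<Longrightarrow> traverses V e q \<Longrightarrow> path r \<Longrightarrow> (\<And>s. s \<in> {0..1} \<Longrightarrow> cov (r s) = q s) \<Longrightarrow>
    pathstart r = z' \<Longrightarrow> lpath V E (Suc n) z (pathfinish r)"

lemma lpath_V: assumes "lpath V E n z z'" shows "cov z \<in> V" "cov z' \<in> V"
proof -
  from assms have "cov z \<in> V \<and> cov z' \<in> V"
  proof induction
    case (step n z z' e q r)
    then have "cov (pathfinish r) = pathfinish q" by (simp add: pathfinish_def)
    then show ?case using step pathfinish_traverses by metis
  qed auto
  then show "cov z \<in> V" "cov z' \<in> V" by auto
qed

lemma lpath_trans: "lpath V E m z' z'' \<Longrightarrow> lpath V E n z z' \<Longrightarrow> lpath V E (n + m) z z''"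
proof (induction arbitrary: n z rule: lpath.induct)
  case (step m z1 z2 e q r)
  have "lpath V E (Suc (n + m)) z (pathfinish r)"
    by (rule lpath.step[OF step.IH[OF step.prems] step(2-6)])
  then show ?case by simp
qed simp

lemma lpath_single:
  assumes "e \<in> E" "traverses V e q" "path r" "\<And>s. s \<in> {0..1} \<Longrightarrow> cov (r s) = q s"
  shows "lpath V E 1 (pathstart r) (pathfinish r)"
proof -
  have "cov (pathstart r) = pathstart q" using assms(4)[of 0] by (simp add: pathstart_def)
  then have "lpath V E 0 (pathstart r) (pathstart r)"
    using pathstart_traverses[OF assms(2)] by (intro lpath.base) simp
  from lpath.step[OF this assms(1-4) refl] show ?thesis by simp
qed

lemma lpath_sym: "lpath V E n z z' \<Longrightarrow> lpath V E n z' z"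
proof (induction rule: lpath.induct)
  case (step n z z' e q r)
  have "lpath V E 1 (pathstart (reversepath r)) (pathfinish (reversepath r))"
  proof (rule lpath_single[OF step(2) traverses_reversepath[OF step(3)]])
    show "path (reversepath r)" using step by simp
    show "cov (reversepath r s) = reversepath q s" if "s \<in> {0..1}" for s
      using step(5)[of "1 - s"] that by (simp add: reversepath_def)
  qed
  then have "lpath V E 1 (pathfinish r) z'" using step by simp
  from lpath_trans[OF step.IH this] show ?case by simp
qed (auto intro: lpath.base)

lemma lpath_translate: "lpath V E n z z' \<Longrightarrow> a \<in> lattice \<Longrightarrow> lpath V E n (z + a) (z' + a)"
proof (induction rule: lpath.induct)
  case (step n z z' e q r)
  have "lpath V E (Suc n) (z + a) (pathfinish (\<lambda>s. r s + a))"
  proof (rule lpath.step[OF step.IH step(2,3)])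
    show "path (\<lambda>s. r s + a)" using step(4) unfolding path_def by (intro continuous_intros)
  qed (use step in \<open>auto simp: pathstart_def\<close>)
  then show ?case by (simp add: pathfinish_def)
qed (auto intro: lpath.base)

lemma edge_path_of_lpath:
  "lpath V E n z z' \<Longrightarrow> \<exists>p r. edge_path V E n p \<and> path r \<and> pathstart r = z \<and> pathfinish r = z' \<and>
     (\<forall>s\<in>{0..1}. cov (r s) = p s)"
proof (induction rule: lpath.induct)
  case (base z)
  then show ?case
    by (intro exI[of _ "\<lambda>_. cov z"] exI[of _ "\<lambda>_. z"])
      (auto intro: edge_path.trivial simp: path_def pathstart_def pathfinish_def)
next
  case (step n z z' e q r)
  then obtain p r' where p: "edge_path V E n p" "path r'" "pathstart r' = z" "pathfinish r' = z'"
    "\<And>s. s \<in> {0..1} \<Longrightarrow> cov (r' s) = p s" by blast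
  have "pathfinish p = pathstart q"
    using p(4) p(5)[of 1] step(5)[of 0] step(6) by (simp add: pathfinish_def pathstart_def)
  then have "edge_path V E (Suc n) (p +++ q)" using p(1) step by (intro edge_path.step)
  moreover have "path (r' +++ r)" using p step by simp
  moreover have "cov ((r' +++ r) s) = (p +++ q) s" if "s \<in> {0..1}" for s
    using p(5)[of "2 * s"] step(5)[of "2 * s - 1"] that by (auto simp: joinpaths_def)
  ultimately show ?case using p(3) by (intro exI[of _ "p +++ q"] exI[of _ "r' +++ r"]) auto
qed

lemma traverses_lift:
  fixes q :: "real \<Rightarrow> complex \<times> complex"
  assumes "traverses V e q" "e \<subseteq> torus"
  obtains r where "path r" "\<And>s. s \<in> {0..1} \<Longrightarrow> cov (r s) = q s"
proof -
  have "continuous_on {0..1} q" "q ` {0..1} \<subseteq> torus"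
    using assms by (auto simp: traverses_def path_image_def path_def dest: simple_path_imp_path)
  from cov_lift[OF this convex_imp_contractible[OF convex_real_interval(5)]] show ?thesis
    using that unfolding path_def by metis
qed

lemma lpath_of_edge_path:
  assumes "V \<subseteq> torus" "\<Union>E \<subseteq> torus"
  shows "edge_path V E n p \<Longrightarrow> \<exists>r. path r \<and> (\<forall>s\<in>{0..1}. cov (r s) = p s) \<and> lpath V E n (pathstart r) (pathfinish r)"
proof (induction rule: edge_path.induct)
  case (trivial v)
  then obtain z where "cov z = v" using cov_surj assms(1) by blast
  then show ?case using trivial
    by (intro exI[of _ "\<lambda>_. z"]) (auto intro: lpath.base simp: path_def pathstart_def pathfinish_def)
next
  case (step n p e q)
  then obtain r where r: "path r" "\<And>s. s \<in> {0..1} \<Longrightarrow> cov (r s) = p s" "lpath V E n (pathstart r) (pathfinish r)"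
    by blast
  obtain r' where r': "path r'" "\<And>s. s \<in> {0..1} \<Longrightarrow> cov (r' s) = q s"
    using traverses_lift[OF step(3)] step(2) assms(2) by (metis Sup_upper order_trans)
  define a where "a = pathfinish r - pathstart r'"
  have "cov (pathfinish r) = cov (pathstart r')"
    using r(2)[of 1] r'(2)[of 0] step(4) by (simp add: pathfinish_def pathstart_def)
  then have a: "a \<in> lattice" by (simp add: a_def cov_eq_iff)
  define r'' where "r'' = (\<lambda>s. r' s + a)"
  have r'': "path r''" "\<And>s. s \<in> {0..1} \<Longrightarrow> cov (r'' s) = q s" "pathstart r'' = pathfinish r"
  proof -
    show "path r''" using r'(1) unfolding path_def r''_def by (intro continuous_intros)
    show "\<And>s. s \<in> {0..1} \<Longrightarrow> cov (r'' s) = q s" using r'(2) a by (simp add: r''_def)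
    show "pathstart r'' = pathfinish r" by (simp add: r''_def a_def pathstart_def)
  qed
  have "lpath V E (Suc n) (pathstart r) (pathfinish r'')"
    by (rule lpath.step[OF r(3) step(2,3) r''])
  moreover have "cov ((r +++ r'') s) = (p +++ q) s" if "s \<in> {0..1}" for s
    using r(2)[of "2 * s"] r''(2)[of "2 * s - 1"] that by (auto simp: joinpaths_def)
  ultimately show ?case
    using r r'' by (intro exI[of _ "r +++ r''"]) auto
qed

context lifted_tiling
begin

abbreviation "G' \<equiv> cov -` Gr"

lemma mid_in_G': "e \<in> E \<Longrightarrow> \<mu> \<in> lattice \<Longrightarrow> \<Gamma> e (1 / 2) + \<mu> \<in> G'"
  using \<gamma>_interior[of e "1/2"] cov_\<Gamma>[of e "1/2"] by auto

lemma lift_in_G':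
  assumes "e \<in> E" "traverses V e q" "\<And>s. s \<in> {0..1} \<Longrightarrow> cov (r s) = q s"
  shows "path_image r \<subseteq> G'"
proof
  fix x assume "x \<in> path_image r"
  then obtain s where s: "s \<in> {0..1}" "x = r s" by (auto simp: path_image_def)
  have "q s \<in> e" using assms(2) s(1) by (auto simp: traverses_def path_image_def)
  then show "x \<in> G'" using assms(1,3) s by auto
qed

lemma L_notin_G': "t \<in> T \<Longrightarrow> q \<in> ball 0 1 \<Longrightarrow> a \<in> lattice \<Longrightarrow> L t q + a \<notin> G'"
proof -
  assume t: "t \<in> T" and q: "q \<in> ball 0 1" and a: "a \<in> lattice"
  have "cov (L t q + a) = F t q" using cov_L[OF t, of q] q a by simp
  moreover have "F t q \<in> t" using F_ball(1)[OF t] q by blast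
  ultimately show ?thesis using tile_disjoint_graph[OF t] by auto
qed

text \<open>The winding number of an edge path jumps at the middle of a lifted edge by the signed number of
  times that the path traverses this edge.\<close>

lemma lpath_winding:
  "lpath V E n z z' \<Longrightarrow> \<exists>p (k :: _ \<Rightarrow> int) A. path p \<and> pathstart p = z \<and> pathfinish p = z' \<and> path_image p \<subseteq> G' \<and>
    finite A \<and> A \<subseteq> E \<times> lattice \<and> (\<forall>x. x \<notin> A \<longrightarrow> k x = 0) \<and> even (sum k A - int n) \<and>
    (\<forall>e\<in>E. \<forall>\<mu>\<in>lattice. \<exists>l. ((\<lambda>w. winding_number p w - of_int (k (e, \<mu>)) * winding_number (\<Gamma> e) (w - \<mu>)) \<longlongrightarrow> l)
       (at (\<Gamma> e (1 / 2) + \<mu>) within - G'))"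
proof (induction rule: lpath.induct)
  case (base z)
  have "((\<lambda>w. winding_number (\<lambda>_. z) w - of_int 0 * winding_number (\<Gamma> e) (w - \<mu>)) \<longlongrightarrow> 0)
       (at (\<Gamma> e (1 / 2) + \<mu>) within - G')" for e \<mu>
  proof (rule tendsto_eventually)
    have "eventually (\<lambda>w. w \<in> - G') (at (\<Gamma> e (1 / 2) + \<mu>) within - G')" by (simp add: eventually_at_filter)
    then show "eventually (\<lambda>w. winding_number (\<lambda>_. z) w - of_int 0 * winding_number (\<Gamma> e) (w - \<mu>) = 0)
       (at (\<Gamma> e (1 / 2) + \<mu>) within - G')"
    proof eventually_elim
      case (elim w)
      then have "w \<noteq> z" using base by auto
      then show ?case by (simp add: winding_number_zero_const)
    qed
  qed
  then show ?case using base
    by (intro exI[of _ "\<lambda>_. z"] exI[of _ "\<lambda>_. 0"] exI[of _ "{}"]) (auto simp: path_def pathstart_def pathfinish_def path_image_def)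
next
  case (step n z z' e q r)
  obtain p and k :: "_ \<Rightarrow> int" and A where p: "path p" "pathstart p = z" "pathfinish p = z'" "path_image p \<subseteq> G'"
    and A0: "finite A" "A \<subseteq> E \<times> lattice" "\<forall>x. x \<notin> A \<longrightarrow> k x = 0" "even (sum k A - int n)"
    and lim0: "\<forall>e\<in>E. \<forall>\<mu>\<in>lattice.
      \<exists>l. ((\<lambda>w. winding_number p w - of_int (k (e, \<mu>)) * winding_number (\<Gamma> e) (w - \<mu>)) \<longlongrightarrow> l)
       (at (\<Gamma> e (1 / 2) + \<mu>) within - G')"
    using step.IH by (elim exE conjE) (rule that)
  have A: "finite A" "A \<subseteq> E \<times> lattice" "\<And>x. x \<notin> A \<Longrightarrow> k x = 0" "even (sum k A - int n)"
    using A0 by auto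
  note lim = lim0[rule_format]
  have rc: "continuous_on {0..1} r" using step(4) by (simp add: path_def)
  have rG: "path_image r \<subseteq> G'" by (rule lift_in_G'[OF step(2,3,5)])
  obtain b h a where h: "continuous_on UNIV h" "strict_mono h" "h 0 = (0::real)" "h 1 = 1" "a \<in> lattice"
    "\<And>s. s \<in> {0..1} \<Longrightarrow> r s + a = dpath b (\<Gamma> e) (h s)"
    by (rule traversal_lift[OF step(2,3) rc step(5)]) (auto intro: that)
  define \<mu> where "\<mu> = - a"
  have mu: "\<mu> \<in> lattice" using h(5) by (simp add: \<mu>_def)
  have r_eq: "r s = dpath b (\<Gamma> e) (h s) + \<mu>" if "s \<in> {0..1}" for s
    using h(6)[OF that] by (simp add: \<mu>_def algebra_simps)
  have h01: "h s \<in> {0..1}" if "s \<in> {0..1}" for s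
    using that h strict_mono_less_eq[OF h(2)] by (metis atLeastAtMost_iff)
  define \<sigma> :: int where "\<sigma> = (if b then 1 else -1)"
  \<comment> \<open>Up to reparametrization, \<open>r\<close> is a translate of the reference lift
    \<open>\<Gamma> e\<close> or of its reversal; only the direction affects the winding number, by
    the sign \<open>\<sigma>\<close>.\<close>
  have wr: "winding_number r w = of_int \<sigma> * winding_number (\<Gamma> e) (w - \<mu>)" if w: "w \<notin> path_image r" for w
  proof -
    define P where "P = dpath b (\<Gamma> e)"
    have pP: "path P" using \<Gamma>[OF step(2)] by (simp add: P_def dpath_def)
    have img: "path_image (\<lambda>s. P s + \<mu>) = path_image r"
    proof -
      have "h ` {0..1} = {0..1}"
      proof
        show "{0..1} \<subseteq> h ` {0..1}"
        proof
          fix y :: real assume "y \<in> {0..1}"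
          then obtain x where "0 \<le> x" "x \<le> 1" "h x = y"
            using IVT'[of h 0 y 1] h continuous_on_subset[OF h(1)] by auto
          then show "y \<in> h ` {0..1}" by auto
        qed
      qed (use h01 in blast)
      then have "(\<lambda>s. P s + \<mu>) ` {0..1} = (\<lambda>s. P s + \<mu>) ` h ` {0..1}" by simp
      also have "\<dots> = (\<lambda>s. P (h s) + \<mu>) ` {0..1}" by (rule image_image)
      also have "\<dots> = r ` {0..1}" using r_eq by (intro image_cong) (auto simp: P_def)
      finally show ?thesis by (simp add: path_image_def)
    qed
    have "homotopic_paths (- {w}) (\<lambda>s. P s + \<mu>) r"
    proof (rule homotopic_paths_reparametrize)
      show "path (\<lambda>s. P s + \<mu>)" using pP unfolding path_def by (intro continuous_intros)
      show "continuous_on {0..1} h" by (rule continuous_on_subset[OF h(1)]) simp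
    qed (use h h01 r_eq img w in \<open>auto simp: P_def\<close>)
    then have "winding_number r w = winding_number (\<lambda>s. P s + \<mu>) ((w - \<mu>) + \<mu>)"
      by (simp add: winding_number_homotopic_paths)
    also have "\<dots> = winding_number P (w - \<mu>)" by (rule winding_number_translate)
    also have "\<dots> = of_int \<sigma> * winding_number (\<Gamma> e) (w - \<mu>)"
    proof (cases b)
      case False
      have "w - \<mu> \<notin> path_image (\<Gamma> e)"
      proof
        assume "w - \<mu> \<in> path_image (\<Gamma> e)"
        then have "w - \<mu> \<in> path_image P" by (simp add: P_def dpath_def)
        then obtain s where s: "s \<in> {0..1}" "w - \<mu> = P s" by (auto simp: path_image_def)
        then have "w = P s + \<mu>" by (simp add: diff_eq_eq)
        then have "w \<in> path_image (\<lambda>s. P s + \<mu>)" using s(1) by (auto simp: path_image_def)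
        then show False using w img by simp
      qed
      then show ?thesis using False winding_number_reversepath[OF \<Gamma>[OF step(2)]] by (simp add: P_def dpath_def \<sigma>_def)
    qed (simp add: P_def dpath_def \<sigma>_def)
    finally show ?thesis .
  qed
  \<comment> \<open>At the middle of every other lifted edge the new piece \<open>r\<close> is
    absent and its winding number is continuous, so only the coefficient at
    \<open>(e, \<mu>)\<close> changes.\<close>
  have off: "\<Gamma> e' (1 / 2) + \<mu>' \<notin> path_image r" if e': "e' \<in> E" "\<mu>' \<in> lattice" "(e', \<mu>') \<noteq> (e, \<mu>)" for e' \<mu>'
  proof
    assume "\<Gamma> e' (1 / 2) + \<mu>' \<in> path_image r"
    then obtain s where s: "s \<in> {0..1}" "\<Gamma> e' (1 / 2) + \<mu>' = r s" by (auto simp: path_image_def)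
    then have "cov (\<Gamma> e' (1 / 2) + \<mu>') = cov (r s)" by simp
    then have "\<gamma> e' (1 / 2) = q s" using step(5)[OF s(1)] cov_\<Gamma>[OF e'(1), of "1/2"] e'(2) by simp
    moreover have "q s \<in> e" using step(3) s(1) by (auto simp: traverses_def path_image_def)
    ultimately have ee: "e' = e" using edge_eqI[OF e'(1) step(2)] \<gamma>_interior[OF e'(1), of "1/2"] by simp
    define u where "u = (if b then h s else 1 - h s)"
    have u: "u \<in> {0..1}" "r s = \<Gamma> e u + \<mu>"
      using h01[OF s(1)] r_eq[OF s(1)] by (auto simp: u_def dpath_def reversepath_def)
    then have "cov (\<Gamma> e (1 / 2) + \<mu>') = cov (\<Gamma> e u + \<mu>)" using s(2) ee by simp
    then have "\<gamma> e u = \<gamma> e (1 / 2)"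
      using cov_\<Gamma>[OF step(2) u(1)] cov_\<Gamma>[OF step(2), of "1/2"] e'(2) mu by simp
    then have "u = 1 / 2" using \<gamma>_inj[OF step(2) _ u(1), of "1/2"] by simp
    then have "\<Gamma> e (1 / 2) + \<mu>' = \<Gamma> e (1 / 2) + \<mu>" using s(2) u(2) ee by metis
    then have "\<mu>' = \<mu>" by simp
    then show False using e'(3) ee by simp
  qed
  \<comment> \<open>A coefficient changes by 1 or -1 with every edge of the path, so the sum of all
    coefficients has the parity of the length.\<close>
  define k' where "k' = (\<lambda>y. k y + (if y = (e, \<mu>) then \<sigma> else 0))"
  define A' where "A' = insert (e, \<mu>) A"
  have "sum k' A' = sum k A' + \<sigma>"
    using A(1) by (simp add: k'_def A'_def sum.distrib)
  moreover have "sum k A' = sum k A"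
    unfolding A'_def by (rule sum.mono_neutral_right) (use A in auto)
  moreover have "odd \<sigma>" by (simp add: \<sigma>_def)
  ultimately have par: "even (sum k' A' - int (Suc n))" using A(4) by simp
  have wj: "winding_number (p +++ r) w = winding_number p w + winding_number r w" if "w \<in> - G'" for w
    by (rule winding_number_join) (use p step(4,6) rG that in auto)
  have ev: "eventually (\<lambda>w. w \<in> - G') (at x within - G')" for x by (simp add: eventually_at_filter)
  have "\<exists>l. ((\<lambda>w. winding_number (p +++ r) w - of_int (k' (e', \<mu>')) * winding_number (\<Gamma> e') (w - \<mu>')) \<longlongrightarrow> l)
       (at (\<Gamma> e' (1 / 2) + \<mu>') within - G')" if e': "e' \<in> E" "\<mu>' \<in> lattice" for e' \<mu>'
  proof -
    let ?F = "at (\<Gamma> e' (1 / 2) + \<mu>') within - G'"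
    obtain l where l: "((\<lambda>w. winding_number p w - of_int (k (e', \<mu>')) * winding_number (\<Gamma> e') (w - \<mu>')) \<longlongrightarrow> l) ?F"
      using lim[OF e'] by blast
    have "\<exists>l'. ((\<lambda>w. winding_number r w - of_int (k' (e', \<mu>') - k (e', \<mu>')) * winding_number (\<Gamma> e') (w - \<mu>')) \<longlongrightarrow> l') ?F"
    proof (cases "(e', \<mu>') = (e, \<mu>)")
      case True
      have "eventually (\<lambda>w. winding_number r w - of_int (k' (e', \<mu>') - k (e', \<mu>')) * winding_number (\<Gamma> e') (w - \<mu>') = 0) ?F"
        using ev
      proof eventually_elim
        case (elim w)
        then have "winding_number r w = of_int \<sigma> * winding_number (\<Gamma> e) (w - \<mu>)" using rG by (intro wr) auto
        then show ?case using True by (simp add: k'_def)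
      qed
      then show ?thesis by (intro exI[of _ 0] tendsto_eventually)
    next
      case False
      have "isCont (winding_number r) (\<Gamma> e' (1 / 2) + \<mu>')"
        by (rule continuous_at_winding_number[OF step(4) off[OF e' False]])
      then have "(winding_number r \<longlongrightarrow> winding_number r (\<Gamma> e' (1 / 2) + \<mu>')) ?F"
        unfolding isCont_def by (rule tendsto_within_subset) simp
      then show ?thesis using False by (intro exI) (auto simp: k'_def)
    qed
    then obtain l' where l': "((\<lambda>w. winding_number r w - of_int (k' (e', \<mu>') - k (e', \<mu>')) * winding_number (\<Gamma> e') (w - \<mu>')) \<longlongrightarrow> l') ?F"
      by blast
    have "((\<lambda>w. winding_number (p +++ r) w - of_int (k' (e', \<mu>')) * winding_number (\<Gamma> e') (w - \<mu>')) \<longlongrightarrow> l + l') ?F"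
    proof (rule Lim_transform_eventually[OF tendsto_add[OF l l']])
      show "eventually (\<lambda>w. winding_number p w - of_int (k (e', \<mu>')) * winding_number (\<Gamma> e') (w - \<mu>') +
          (winding_number r w - of_int (k' (e', \<mu>') - k (e', \<mu>')) * winding_number (\<Gamma> e') (w - \<mu>')) =
          winding_number (p +++ r) w - of_int (k' (e', \<mu>')) * winding_number (\<Gamma> e') (w - \<mu>')) ?F"
        using ev by eventually_elim (simp add: wj algebra_simps)
    qed
    then show ?thesis by blast
  qed
  moreover have "path (p +++ r)" "pathstart (p +++ r) = z" "pathfinish (p +++ r) = pathfinish r" "path_image (p +++ r) \<subseteq> G'"
    using p step(4,6) rG by (auto simp: path_image_join)
  moreover have "finite A'" "A' \<subseteq> E \<times> lattice" "\<forall>x. x \<notin> A' \<longrightarrow> k' x = 0"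
    using A step(2) mu by (auto simp: A'_def k'_def)
  ultimately show ?case using par by blast
qed

text \<open>The length of a closed edge path in the plane is congruent modulo 2 to the sum, over all sides
  of all lifted tiles, of the winding numbers around the tiles, and every tile has four sides.\<close>

lemma lpath_closed_even:
  assumes "lpath V E n z z"
  shows "even n"
proof -
  obtain p and k :: "_ \<Rightarrow> int" and A where p: "path p" "pathstart p = z" "pathfinish p = z" "path_image p \<subseteq> G'"
    and A0: "finite A" "A \<subseteq> E \<times> lattice" "\<forall>x. x \<notin> A \<longrightarrow> k x = 0" "even (sum k A - int n)"
    and lim0: "\<forall>e\<in>E. \<forall>\<mu>\<in>lattice.
      \<exists>l. ((\<lambda>w. winding_number p w - of_int (k (e, \<mu>)) * winding_number (\<Gamma> e) (w - \<mu>)) \<longlongrightarrow> l)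
       (at (\<Gamma> e (1 / 2) + \<mu>) within - G')"
    using lpath_winding[OF assms] by (elim exE conjE) (rule that)
  have A: "finite A" "A \<subseteq> E \<times> lattice" "\<And>x. x \<notin> A \<Longrightarrow> k x = 0" "even (sum k A - int n)"
    using A0 by auto
  note lim = lim0[rule_format]
  have loop: "pathfinish p = pathstart p" using p by simp
  \<comment> \<open>A closed path has an integer winding number around a tile that it avoids; the
    floor of the real part only reads it off as an element of \<open>int\<close>.\<close>
  define N where "N t \<nu> = \<lfloor>Re (winding_number p (L t 0 + \<nu>))\<rfloor>" for t \<nu>
  have N: "winding_number p (L t q + \<nu>) = of_int (N t \<nu>)" if t: "t \<in> T" "q \<in> ball 0 1" "\<nu> \<in> lattice" for t q \<nu>
  proof -
    have "connected ((\<lambda>q. L t q + \<nu>) ` ball 0 1)"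
      by (intro connected_continuous_image continuous_intros continuous_on_subset[OF contL[OF t(1)]]) auto
    moreover have "(\<lambda>q. L t q + \<nu>) ` ball 0 1 \<inter> path_image p = {}"
      using L_notin_G'[OF t(1) _ t(3)] p(4) by blast
    ultimately have "winding_number p constant_on ((\<lambda>q. L t q + \<nu>) ` ball 0 1)"
      by (intro winding_number_constant p(1) loop)
    then have "winding_number p (L t q + \<nu>) = winding_number p (L t 0 + \<nu>)"
      using t(2) unfolding constant_on_def by (metis centre_in_ball image_eqI zero_less_one)
    moreover have "winding_number p (L t 0 + \<nu>) \<in> \<int>"
      using integer_winding_number[OF p(1) loop] L_notin_G'[OF t(1) _ t(3), of 0] p(4) by auto
    ultimately show ?thesis by (auto simp: N_def elim!: Ints_cases)
  qed
  \<comment> \<open>Approaching the middle of the edge from its two sides, the winding number of the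
    edge tends to c + 1 and c, while that of \<open>p\<close> is constant on each tile. Equating the
    two limits gives \<open>k (e, \<mu>)\<close> as a difference of two values of \<open>N\<close>,
    which modulo 2 is their sum.\<close>
  have jump: "even (k (e, \<mu>) - (\<Sum>x\<in>K e. N (fst x) (lam (fst x) (snd x) + \<mu>)))" if e: "e \<in> E" "\<mu> \<in> lattice" for e \<mu>
  proof -
    obtain t1 j1 t2 j2 c where K2: "K e = {(t1, j1), (t2, j2)}" "(t1, j1) \<noteq> (t2, j2)" and
      l1: "((\<lambda>q. winding_number (\<Gamma> e) (L t1 q + lam t1 j1)) \<longlongrightarrow> c + 1) (at (pt t1 j1) within ball 0 1)" and
      l2: "((\<lambda>q. winding_number (\<Gamma> e) (L t2 q + lam t2 j2)) \<longlongrightarrow> c) (at (pt t2 j2) within ball 0 1)"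
      using two_sides[OF e(1)] by metis
    obtain l where l: "((\<lambda>w. winding_number p w - of_int (k (e, \<mu>)) * winding_number (\<Gamma> e) (w - \<mu>)) \<longlongrightarrow> l)
       (at (\<Gamma> e (1 / 2) + \<mu>) within - G')"
      using lim[OF e] by blast
    have eq: "of_int (N t (lam t j + \<mu>)) - of_int (k (e, \<mu>)) * d = l"
      if tj: "(t, j) \<in> K e" and d: "((\<lambda>q. winding_number (\<Gamma> e) (L t q + lam t j)) \<longlongrightarrow> d) (at (pt t j) within ball 0 1)" for t j d
    proof -
      let ?F = "at (pt t j) within ball 0 1"
      have t: "t \<in> T" "ed t j = e" using tj by (auto simp: K_def)
      have inb: "eventually (\<lambda>q. q \<in> ball 0 1) ?F" by (simp add: eventually_at_filter)
      have la: "lam t j + \<mu> \<in> lattice" using lam[OF t(1)] e(2) by (rule lattice_add)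
      have "filterlim (\<lambda>q. L t q + lam t j + \<mu>) (at (\<Gamma> e (1 / 2) + \<mu>) within - G') ?F"
        unfolding filterlim_at
      proof
        show "((\<lambda>q. L t q + lam t j + \<mu>) \<longlongrightarrow> \<Gamma> e (1 / 2) + \<mu>) ?F"
          using L_pt_tendsto[OF t(1), of j] t(2) by (intro tendsto_intros) auto
        show "eventually (\<lambda>q. L t q + lam t j + \<mu> \<in> - G' \<and> L t q + lam t j + \<mu> \<noteq> \<Gamma> e (1 / 2) + \<mu>) ?F"
          using inb
        proof eventually_elim
          case (elim q)
          then have "L t q + (lam t j + \<mu>) \<notin> G'" using L_notin_G'[OF t(1) _ la] by blast
          moreover have "\<Gamma> e (1 / 2) + \<mu> \<in> G'" by (rule mid_in_G'[OF e])
          ultimately show ?case by (metis ComplI add.assoc)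
        qed
      qed
      from filterlim_compose[OF l this]
      have "((\<lambda>q. winding_number p (L t q + lam t j + \<mu>) - of_int (k (e, \<mu>)) * winding_number (\<Gamma> e) (L t q + lam t j)) \<longlongrightarrow> l) ?F"
        by simp
      moreover have "((\<lambda>q. winding_number p (L t q + lam t j + \<mu>) - of_int (k (e, \<mu>)) * winding_number (\<Gamma> e) (L t q + lam t j)) \<longlongrightarrow>
          of_int (N t (lam t j + \<mu>)) - of_int (k (e, \<mu>)) * d) ?F"
      proof (intro tendsto_intros d tendsto_eventually)
        show "eventually (\<lambda>q. winding_number p (L t q + lam t j + \<mu>) = of_int (N t (lam t j + \<mu>))) ?F"
          using inb by eventually_elim (use N[OF t(1) _ la] in \<open>simp add: add.assoc\<close>)
      qed
      ultimately show ?thesis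
        using tendsto_unique[OF at_within_ball_nontrivial[OF pt_sphere(1)]] by blast
    qed
    have "of_int (N t1 (lam t1 j1 + \<mu>)) - of_int (k (e, \<mu>)) * (c + 1) = l"
      "of_int (N t2 (lam t2 j2 + \<mu>)) - of_int (k (e, \<mu>)) * c = l"
      using eq[OF _ l1] eq[OF _ l2] K2(1) by auto
    then have "(of_int (k (e, \<mu>)) :: complex) = of_int (N t1 (lam t1 j1 + \<mu>) - N t2 (lam t2 j2 + \<mu>))"
      by (simp add: algebra_simps)
    then have "k (e, \<mu>) = N t1 (lam t1 j1 + \<mu>) - N t2 (lam t2 j2 + \<mu>)"
      by (simp only: of_int_eq_iff)
    then show ?thesis using K2 by simp
  qed
  obtain B where B: "\<And>y. B \<le> norm y \<Longrightarrow> winding_number p y = 0"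
    using winding_number_zero_at_infinity[OF p(1) loop] by blast
  \<comment> \<open>Only finitely many translates of a tile count, because \<open>p\<close> does not
    wind around points far away.\<close>
  define S where "S t = {\<nu> \<in> lattice. N t \<nu> \<noteq> 0}" for t
  have finS: "finite (S t)" for t
  proof -
    have "norm \<nu> \<le> B + norm (L t 0)" if "\<nu> \<in> S t" for \<nu>
    proof (rule ccontr)
      assume "\<not> norm \<nu> \<le> B + norm (L t 0)"
      then have "B \<le> norm (L t 0 + \<nu>)" using norm_diff_ineq[of \<nu> "L t 0"] by (simp add: add.commute)
      then have "N t \<nu> = 0" using B by (simp add: N_def)
      then show False using that by (simp add: S_def)
    qed
    then have "S t \<subseteq> {a \<in> lattice. norm a \<le> B + norm (L t 0)}" by (auto simp: S_def)
    then show ?thesis using finite_lattice_bounded finite_subset by blast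
  qed
  define R where "R t = (\<Sum>\<nu>\<in>S t. N t \<nu>)" for t
  \<comment> \<open>A finite set of translations outside of which neither a coefficient
    \<open>k (e, \<mu>)\<close> nor a value \<open>N t (lam t j + \<mu>)\<close>
    contributes.\<close>
  define M where "M = snd ` A \<union> (\<Union>x\<in>T \<times> {..<4}. (\<lambda>\<nu>. \<nu> - lam (fst x) (snd x)) ` S (fst x))"
  have finM: "finite M" using A(1) finite_T finS by (auto simp: M_def)
  have Ml: "M \<subseteq> lattice" using A(2) lam lattice_diff by (fastforce simp: M_def S_def)
  \<comment> \<open>Shifting by \<open>lam t j\<close> only renames the translates of
    \<open>t\<close>, so all four sides of \<open>t\<close> contribute the same number
    \<open>R t\<close>.\<close>
  have G: "(\<Sum>\<mu>\<in>M. N t (lam t j + \<mu>)) = R t" if tj: "t \<in> T" "j < 4" for t j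
  proof -
    have "(\<Sum>\<mu>\<in>M. N t (lam t j + \<mu>)) = (\<Sum>\<nu>\<in>(+) (lam t j) ` M. N t \<nu>)"
      by (subst sum.reindex) (auto simp: comp_def)
    also have "\<dots> = R t"
      unfolding R_def
    proof (rule sum.mono_neutral_right)
      show "finite ((+) (lam t j) ` M)" using finM by simp
      show "S t \<subseteq> (+) (lam t j) ` M"
      proof
        fix \<nu> assume "\<nu> \<in> S t"
        then have "\<nu> - lam t j \<in> M" using tj unfolding M_def by force
        then show "\<nu> \<in> (+) (lam t j) ` M" by (intro image_eqI[of _ _ "\<nu> - lam t j"]) auto
      qed
      show "\<forall>\<nu>\<in>(+) (lam t j) ` M - S t. N t \<nu> = 0"
        using Ml lam[OF tj(1)] lattice_add by (auto simp: S_def)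
    qed
    finally show ?thesis .
  qed
  have "sum k A = sum k (E \<times> M)"
  proof (rule sum.mono_neutral_left)
    show "finite (E \<times> M)" using finM finiteE by simp
    show "A \<subseteq> E \<times> M"
    proof
      fix x assume x: "x \<in> A"
      then have "fst x \<in> E" using A(2) by auto
      moreover have "snd x \<in> M" unfolding M_def using x by blast
      ultimately show "x \<in> E \<times> M" by (simp add: mem_Times_iff)
    qed
    show "\<forall>x\<in>E \<times> M - A. k x = 0" using A(3) by blast
  qed
  also have "\<dots> = (\<Sum>e\<in>E. \<Sum>\<mu>\<in>M. k (e, \<mu>))"
    using sum.cartesian_product[of "\<lambda>e \<mu>. k (e, \<mu>)" M E] by simp
  finally have s1: "sum k A = (\<Sum>e\<in>E. \<Sum>\<mu>\<in>M. k (e, \<mu>))" .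
  have "even ((\<Sum>e\<in>E. \<Sum>\<mu>\<in>M. k (e, \<mu>)) - (\<Sum>e\<in>E. \<Sum>\<mu>\<in>M. \<Sum>x\<in>K e. N (fst x) (lam (fst x) (snd x) + \<mu>)))"
    unfolding sum_subtractf[symmetric] using jump Ml by (intro dvd_sum) blast
  moreover have "(\<Sum>e\<in>E. \<Sum>\<mu>\<in>M. \<Sum>x\<in>K e. N (fst x) (lam (fst x) (snd x) + \<mu>)) = (\<Sum>e\<in>E. \<Sum>x\<in>K e. R (fst x))"
  proof (rule sum.cong[OF refl])
    fix e
    have "(\<Sum>\<mu>\<in>M. \<Sum>x\<in>K e. N (fst x) (lam (fst x) (snd x) + \<mu>)) = (\<Sum>x\<in>K e. \<Sum>\<mu>\<in>M. N (fst x) (lam (fst x) (snd x) + \<mu>))"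
      by (rule sum.swap)
    also have "\<dots> = (\<Sum>x\<in>K e. R (fst x))"
      by (rule sum.cong) (auto simp: K_def G)
    finally show "(\<Sum>\<mu>\<in>M. \<Sum>x\<in>K e. N (fst x) (lam (fst x) (snd x) + \<mu>)) = (\<Sum>x\<in>K e. R (fst x))" .
  qed
  \<comment> \<open>The sets \<open>K e\<close> partition the sides of all tiles according to their
    edge, so the sum may be taken tile by tile.\<close>
  moreover have "(\<Sum>e\<in>E. \<Sum>x\<in>K e. R (fst x)) = (\<Sum>x\<in>T \<times> {..<4::nat}. R (fst x))"
  proof -
    have Ke: "K e = {x \<in> T \<times> {..<4}. (\<lambda>(t, j). ed t j) x = e}" for e by (auto simp: K_def)
    have "(\<lambda>(t, j). ed t j) ` (T \<times> {..<4::nat}) \<subseteq> E" using ed(1) by auto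
    from sum.group[OF _ finiteE this, of "\<lambda>x. R (fst x)"] show ?thesis
      unfolding Ke using finite_T by simp
  qed
  moreover have "(\<Sum>x\<in>T \<times> {..<4::nat}. R (fst x)) = (\<Sum>t\<in>T. 4 * R t)"
    using sum.cartesian_product[of "\<lambda>t j. R t" "{..<4::nat}" T] by (simp add: split_beta)
  moreover have "even (\<Sum>t\<in>T. 4 * R t)" by (intro dvd_sum) simp
  ultimately have "even (sum k A)" using s1 by simp
  then show ?thesis using A(4) by simp
qed


section \<open>Connectedness of the lifted graph\<close>

lemma lpath_side:
  assumes t: "t \<in> T" and \<nu>: "\<nu> \<in> lattice"
  shows "lpath V E 1 (L t (corner 4 j) + \<nu>) (L t (corner 4 (j + 1)) + \<nu>)"
proof -
  let ?r = "\<lambda>s. L t (cis (pi / 2 * (real j + s))) + \<nu>"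
  have "lpath V E 1 (pathstart ?r) (pathfinish ?r)"
  proof (rule lpath_single[OF ed(1)[OF t] traverses_bp[OF t ed[OF t]]])
    show "path ?r"
      unfolding path_def
      by (intro continuous_intros continuous_on_compose2[OF contL[OF t]]) (auto intro!: continuous_intros)
    show "cov (?r s) = bp t j s" for s
      using cov_L[OF t] \<nu> by simp
  qed
  then show ?thesis by (simp add: pathstart_def pathfinish_def corner4 add.commute)
qed

lemma lpath_corners:
  assumes t: "t \<in> T" and \<nu>: "\<nu> \<in> lattice"
  shows "\<exists>n. lpath V E n (L t (corner 4 0) + \<nu>) (L t (corner 4 j) + \<nu>)"
proof (induction j)
  case 0
  have "cov (L t (corner 4 0) + \<nu>) \<in> V"
    using F_corner[OF t, of 0] cov_L[OF t, of "corner 4 0"] \<nu> by simp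
  then show ?case by (blast intro: lpath.base)
next
  case (Suc j)
  then show ?case using lpath_trans[OF lpath_side[OF t \<nu>, of j]] by auto
qed

text \<open>Closed lifted tiles that meet are equal or have a common corner. The case to consider is
  a meeting point on an open edge: equality of the edge parameters places both tiles on the same
  lift of the edge, whose starting point is then a corner of both.\<close>

lemma lifts_meet:
  assumes t: "t \<in> T" "t' \<in> T" and q: "q \<in> cball 0 1" "q' \<in> cball 0 1" and \<nu>: "\<nu> \<in> lattice" "\<nu>' \<in> lattice"
    and eq: "L t q + \<nu> = L t' q' + \<nu>'"
  shows "t = t' \<and> \<nu> = \<nu>' \<or> (\<exists>j j'. L t (corner 4 j) + \<nu> = L t' (corner 4 j') + \<nu>')"
proof -
  have covs: "F t q = F t' q'"
  proof -
    have "cov (L t q + \<nu>) = cov (L t' q' + \<nu>')" using eq by simp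
    then show ?thesis using cov_L[OF t(1) q(1)] cov_L[OF t(2) q(2)] \<nu> by simp
  qed
  consider "q \<in> ball 0 1 \<or> q' \<in> ball 0 1" | "F t q \<in> V" | "q \<in> sphere 0 1" "F t q \<notin> V" using q by force
  then show ?thesis
  proof cases
    case 1
    then show ?thesis using L_eqD[OF t(1,2) _ q(2) \<nu> eq] L_eqD[OF t(2,1) _ q(1) \<nu>(2,1) eq[symmetric]] by blast
  next
    case 2
    then show ?thesis using vertex_preimage[OF t(1) q(1)] vertex_preimage[OF t(2) q(2)] covs eq by metis
  next
    case 3
    then obtain e where e: "e \<in> E" "F t q \<in> e - V" using F_sphere[OF t(1)] by blast
    obtain j s where js: "ed t j = e" "s \<in> {0<..<1}" "q = cis (pi / 2 * (real j + s))" "F t q = \<gamma> e (hho t j s)"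
      using edge_preimage[OF t(1) q(1) e] by metis
    obtain j' s' where js': "ed t' j' = e" "s' \<in> {0<..<1}" "q' = cis (pi / 2 * (real j' + s'))" "F t' q' = \<gamma> e (hho t' j' s')"
      using edge_preimage[OF t(2) q(2) e(1)] e(2) covs by metis
    have s01: "s \<in> {0..1}" "s' \<in> {0..1}" using js(2) js'(2) by auto
    have "hho t j s = hho t' j' s'"
      using \<gamma>_inj[OF e(1) hho_in'[OF t(2) js'(2)] hho_in[OF t(1) s01(1)]] js(4) js'(4) covs by metis
    then have "L t q + lam t j = L t' q' + lam t' j'"
      using L_side'[OF t(1) s01(1), of j] L_side'[OF t(2) s01(2), of j'] js js' by simp
    then have d: "\<nu> - lam t j = \<nu>' - lam t' j'" using eq by (simp add: algebra_simps) (metis add_diff_cancel_left' diff_add_eq diff_diff_eq2)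
    have c: "\<exists>i. L u (corner 4 i) + lam u l = \<Gamma> (ed u l) 0" if u: "u \<in> T" for u l
    proof (cases "sg u l")
      case True
      then show ?thesis using L_side'[OF u, of 0 l] hho_ends[OF u, of l] by (intro exI[of _ l]) (simp add: corner4)
    next
      case False
      then show ?thesis using L_side'[OF u, of 1 l] hho_ends[OF u, of l]
        by (intro exI[of _ "l + 1"]) (simp add: corner4 add.commute)
    qed
    obtain i i' where i: "L t (corner 4 i) + lam t j = \<Gamma> e 0" "L t' (corner 4 i') + lam t' j' = \<Gamma> e 0"
      using c[OF t(1), of j] c[OF t(2), of j'] js(1) js'(1) by metis
    have "L t (corner 4 i) + \<nu> = (L t (corner 4 i) + lam t j) + (\<nu> - lam t j)" by simp
    also have "\<dots> = (L t' (corner 4 i') + lam t' j') + (\<nu>' - lam t' j')" using i d by simp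
    also have "\<dots> = L t' (corner 4 i') + \<nu>'" by simp
    finally show ?thesis by blast
  qed
qed

text \<open>A segment between the two vertices meets only finitely many closed lifted tiles, and
  they cover it. Those with corners reachable from \<open>z0\<close> and those without form two
  closed sets, which are disjoint because meeting tiles share corners; since the segment is
  connected, only reachable tiles occur.\<close>

lemma lifted_graph_connected:
  assumes z0: "cov z0 \<in> V" and z1: "cov z1 \<in> V"
  shows "\<exists>n. lpath V E n z0 z1"
proof -
  define R where "R z \<longleftrightarrow> (\<exists>n. lpath V E n z0 z)" for z
  have R_lpath: "R z' \<longleftrightarrow> R z" if "lpath V E n z z'" for n z z'
    unfolding R_def using lpath_trans[OF that] lpath_trans[OF lpath_sym[OF that]] by blast
  have R_corner: "R (L t (corner 4 j) + \<nu>) \<longleftrightarrow> R (L t (corner 4 0) + \<nu>)" if "t \<in> T" "\<nu> \<in> lattice" for t \<nu> j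
    using lpath_corners[OF that, of j] R_lpath by blast
  define seg where "seg = closed_segment z0 z1"
  define im where "im x = (\<lambda>q. L (fst x) q + snd x) ` cball 0 1" for x
  define J where "J = {x \<in> T \<times> lattice. im x \<inter> seg \<noteq> {}}"
  define J1 where "J1 = {x \<in> J. R (L (fst x) (corner 4 0) + snd x)}"
  define J2 where "J2 = {x \<in> J. \<not> R (L (fst x) (corner 4 0) + snd x)}"
  have comp: "compact (im x)" if "x \<in> J" for x
    unfolding im_def
    by (intro compact_continuous_image continuous_intros contL) (use that in \<open>auto simp: J_def\<close>)
  have "finite J"
  proof -
    obtain Bs where Bs: "\<And>y. y \<in> seg \<Longrightarrow> norm y \<le> Bs"
      using bounded_closed_segment[of z0 z1] unfolding seg_def bounded_iff by blast
    have "\<exists>B. \<forall>q\<in>cball 0 1. norm (L t q) \<le> B" if "t \<in> T" for t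
      using compact_imp_bounded[OF compact_continuous_image[OF contL[OF that] compact_cball]]
      unfolding bounded_iff by blast
    then obtain B where B: "\<And>t q. t \<in> T \<Longrightarrow> q \<in> cball 0 1 \<Longrightarrow> norm (L t q) \<le> B t" by metis
    have "J \<subseteq> (SIGMA t:T. {\<nu> \<in> lattice. norm \<nu> \<le> B t + Bs})"
    proof
      fix x assume x: "x \<in> J"
      obtain t \<nu> where tn: "x = (t, \<nu>)" by force
      then obtain q where q: "t \<in> T" "\<nu> \<in> lattice" "q \<in> cball 0 1" "L t q + \<nu> \<in> seg"
        using x by (auto simp: J_def im_def)
      have "norm \<nu> \<le> norm (L t q + \<nu>) + norm (L t q)"
        using norm_triangle_ineq4[of "L t q + \<nu>" "L t q"] by simp
      then have "norm \<nu> \<le> B t + Bs" using B[OF q(1,3)] Bs[OF q(4)] by linarith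
      then show "x \<in> (SIGMA t:T. {\<nu> \<in> lattice. norm \<nu> \<le> B t + Bs})" using tn q by simp
    qed
    then show ?thesis
      by (rule finite_subset) (intro finite_SigmaI finite_T finite_lattice_bounded)
  qed
  define A1 where "A1 = (\<Union>x\<in>J1. im x)"
  define A2 where "A2 = (\<Union>x\<in>J2. im x)"
  have "closed A1" "closed A2"
    unfolding A1_def A2_def using \<open>finite J\<close>
    by (intro closed_UN ballI compact_imp_closed comp; auto simp: J1_def J2_def)+
  have tile_at: "\<exists>t \<nu> q. t \<in> T \<and> \<nu> \<in> lattice \<and> q \<in> cball 0 1 \<and> y = L t q + \<nu>" for y
  proof -
    obtain t q where tq: "t \<in> T" "q \<in> cball 0 1" "F t q = cov y" using cover cov_in_torus by metis
    then have "y - L t q \<in> lattice" using cov_L[OF tq(1,2)] by (simp flip: cov_eq_iff)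
    then show ?thesis using tq by (intro exI[of _ t] exI[of _ "y - L t q"] exI[of _ q]) auto
  qed
  have cov12: "seg \<subseteq> A1 \<union> A2"
  proof
    fix y assume y: "y \<in> seg"
    obtain t \<nu> q where tq: "t \<in> T" "\<nu> \<in> lattice" "q \<in> cball 0 1" "y = L t q + \<nu>" using tile_at by blast
    then have "y \<in> im (t, \<nu>)" by (auto simp: im_def)
    moreover have "(t, \<nu>) \<in> J" using tq y calculation by (auto simp: J_def)
    then have "(t, \<nu>) \<in> J1 \<or> (t, \<nu>) \<in> J2" by (auto simp: J1_def J2_def)
    ultimately show "y \<in> A1 \<union> A2" unfolding A1_def A2_def by blast
  qed
  have "A1 \<inter> A2 = {}"
  proof (rule ccontr)
    assume "A1 \<inter> A2 \<noteq> {}"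
    then obtain x x' y where x: "x \<in> J1" "x' \<in> J2" "y \<in> im x" "y \<in> im x'" unfolding A1_def A2_def by blast
    obtain t \<nu> t' \<nu>' where tn: "x = (t, \<nu>)" "x' = (t', \<nu>')" by force
    then have t: "t \<in> T" "t' \<in> T" "\<nu> \<in> lattice" "\<nu>' \<in> lattice"
      and R: "R (L t (corner 4 0) + \<nu>)" "\<not> R (L t' (corner 4 0) + \<nu>')"
      using x by (auto simp: J1_def J2_def J_def)
    obtain q q' where q: "q \<in> cball 0 1" "q' \<in> cball 0 1" "L t q + \<nu> = L t' q' + \<nu>'"
      using x(3,4) tn by (auto simp: im_def)
    show False
      using lifts_meet[OF t(1,2) q(1,2) t(3,4) q(3)] R R_corner[OF t(1,3)] R_corner[OF t(2,4)] by metis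
  qed
  moreover have "connected seg" by (simp add: seg_def)
  ultimately have sep: "A1 \<inter> seg = {} \<or> A2 \<inter> seg = {}"
    using connected_closedD[of seg A1 A2] \<open>closed A1\<close> \<open>closed A2\<close> cov12 by blast
  have vert: "R y \<longleftrightarrow> R (L t (corner 4 0) + \<nu>)" if y: "cov y \<in> V" "t \<in> T" "\<nu> \<in> lattice" "q \<in> cball 0 1" "y = L t q + \<nu>" for y t \<nu> q
  proof -
    have "F t q \<in> V" using y cov_L[OF y(2,4)] by simp
    then obtain j where "q = corner 4 j" using vertex_preimage[OF y(2,4)] by metis
    then show ?thesis using R_corner[OF y(2,3), of j] y(5) by simp
  qed
  have "z0 \<in> seg" "z1 \<in> seg" by (simp_all add: seg_def)
  have "R z0" unfolding R_def using lpath.base[OF z0] by blast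
  have "z0 \<notin> A2"
  proof
    assume "z0 \<in> A2"
    then obtain x where x: "x \<in> J2" "z0 \<in> im x" unfolding A2_def by blast
    obtain t \<nu> where tn: "x = (t, \<nu>)" by force
    then show False using x vert[OF z0, of t \<nu>] \<open>R z0\<close> by (auto simp: J2_def J_def im_def)
  qed
  then have "z0 \<in> A1" using cov12 \<open>z0 \<in> seg\<close> by blast
  then have "A2 \<inter> seg = {}" using sep \<open>z0 \<in> seg\<close> by blast
  then have "z1 \<in> A1" using cov12 \<open>z1 \<in> seg\<close> by blast
  then obtain x where x: "x \<in> J1" "z1 \<in> im x" unfolding A1_def by blast
  obtain t \<nu> where tn: "x = (t, \<nu>)" by force
  then have "R z1" using x vert[OF z1, of t \<nu>] by (auto simp: J1_def J_def im_def)
  then show ?thesis by (simp add: R_def)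
qed

section \<open>Lattice displacements of even parity\<close>

definition evens :: "complex set" where
  "evens = {\<mu> \<in> lattice. \<forall>n z. lpath V E n z (z + \<mu>) \<longrightarrow> even n}"

lemma vertex_lift: obtains z where "cov z \<in> V"
proof -
  obtain t where "t \<in> T" using cover[OF cov_in_torus] by metis
  then have "cov (L t (corner 4 0)) \<in> V" using F_corner[of t 0] cov_L[of t "corner 4 0"] by simp
  then show ?thesis using that by blast
qed

text \<open>Two paths with the same displacement, from different starting points, close up in the
  plane when joined by a connecting path and its translate. The connecting path counts twice, and a
  closed path is even, so the two lengths have the same parity. Thus one even path decides for
  all.\<close>

lemma evens_if_even_lpath:
  assumes \<mu>: "\<mu> \<in> lattice" and p: "lpath V E m z (z + \<mu>)" "even m"
  shows "\<mu> \<in> evens"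
proof -
  have "even n" if n: "lpath V E n y (y + \<mu>)" for n y
  proof -
    obtain c where c: "lpath V E c z y" using lifted_graph_connected lpath_V[OF p(1)] lpath_V[OF n] by blast
    have "lpath V E c (y + \<mu>) (z + \<mu>)" by (rule lpath_translate[OF lpath_sym[OF c] \<mu>])
    from lpath_trans[OF lpath_sym[OF p(1)] lpath_trans[OF this lpath_trans[OF n c]]]
    have "even (m + (c + (n + c)))" by (intro lpath_closed_even) (simp add: ac_simps)
    then show ?thesis using p(2) by presburger
  qed
  then show ?thesis using \<mu> unfolding evens_def by blast
qed

lemma evens_add: assumes "\<mu> \<in> evens" "\<nu> \<in> evens" shows "\<mu> + \<nu> \<in> evens"
proof -
  have l: "\<mu> \<in> lattice" "\<nu> \<in> lattice" using assms by (auto simp: evens_def)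
  obtain z where z: "cov z \<in> V" using vertex_lift .
  obtain m where m: "lpath V E m z (z + \<mu>)" using lifted_graph_connected[OF z, of "z + \<mu>"] z l by auto
  obtain n where n: "lpath V E n (z + \<mu>) (z + \<mu> + \<nu>)"
    using lifted_graph_connected[of "z + \<mu>" "z + \<mu> + \<nu>"] z l by auto
  have "even m" "even n" using m n assms by (auto simp: evens_def)
  moreover have "lpath V E (m + n) z (z + (\<mu> + \<nu>))" using lpath_trans[OF n m] by (simp add: add.assoc)
  ultimately show ?thesis using evens_if_even_lpath lattice_add[OF l] by simp
qed

lemma evens_uminus: assumes "\<mu> \<in> evens" shows "- \<mu> \<in> evens"
proof -
  have l: "\<mu> \<in> lattice" using assms by (auto simp: evens_def)
  obtain z where z: "cov z \<in> V" using vertex_lift .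
  obtain m where m: "lpath V E m z (z + \<mu>)" using lifted_graph_connected[OF z, of "z + \<mu>"] z l by auto
  then have "even m" using assms by (auto simp: evens_def)
  moreover have "lpath V E m (z + \<mu>) ((z + \<mu>) + - \<mu>)" using lpath_sym[OF m] by simp
  ultimately show ?thesis by (intro evens_if_even_lpath[where m = m and z = "z + \<mu>"]) (use l in auto)
qed

lemma evens_int_mult: assumes "\<mu> \<in> evens" shows "of_int k * \<mu> \<in> evens"
proof -
  have "0 \<in> evens"
  proof -
    obtain z where "cov z \<in> V" using vertex_lift .
    then have "lpath V E 0 z (z + 0)" by (simp add: lpath.base)
    then show ?thesis by (rule evens_if_even_lpath[OF lattice_0]) simp
  qed
  show ?thesis
  proof (induction k rule: int_induct[of _ 0])
    case base
    then show ?case using \<open>0 \<in> evens\<close> by simp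
  next
    case (step1 i)
    then show ?case using evens_add[OF step1(2) assms] by (simp add: distrib_right)
  next
    case (step2 i)
    then show ?case using evens_add[OF step2(2) evens_uminus[OF assms]] by (simp add: left_diff_distrib)
  qed
qed

text \<open>A vertex is coloured by the parity of a path from a fixed vertex to one of its lifts.
  Two lifts of a vertex differ by a lattice vector of even parity, so the colour is well defined,
  and one more edge changes it.\<close>

lemma bipartite_if_evens:
  assumes all: "lattice \<subseteq> evens"
  shows "bipartite V E"
proof -
  obtain z0 where z0: "cov z0 \<in> V" using vertex_lift .
  define col where "col v \<longleftrightarrow> (\<exists>n z. even n \<and> lpath V E n z0 z \<and> cov z = v)" for v
  have col: "col (cov z) \<longleftrightarrow> even n" if n: "lpath V E n z0 z" for n z
  proof -
    have "even n" if m: "even m" "lpath V E m z0 z'" "cov z' = cov z" for m z'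
    proof -
      have "z' - z \<in> lattice" using m(3) by (simp add: cov_eq_iff)
      then have "z' - z \<in> evens" using all by blast
      moreover have "lpath V E (n + m) z (z + (z' - z))" using lpath_trans[OF m(2) lpath_sym[OF n]] by simp
      ultimately have "even (n + m)" unfolding evens_def by blast
      then show ?thesis using m(1) by simp
    qed
    then show ?thesis using n unfolding col_def by blast
  qed
  show ?thesis
    unfolding bipartite_def
  proof (intro exI[of _ col] ballI)
    fix e assume e: "e \<in> E"
    have s: "lpath V E 1 (\<Gamma> e 0) (\<Gamma> e 1)"
      using lpath_single[OF e \<gamma>[OF e] \<Gamma>[OF e]] cov_\<Gamma>[OF e] by (simp add: pathstart_def pathfinish_def)
    obtain n where n: "lpath V E n z0 (\<Gamma> e 0)" using lifted_graph_connected[OF z0 lpath_V(1)[OF s]] by blast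
    have "col (\<gamma> e 0) \<longleftrightarrow> even n" using col[OF n] cov_\<Gamma>[OF e, of 0] by simp
    moreover have "col (\<gamma> e 1) \<longleftrightarrow> even (n + 1)" using col[OF lpath_trans[OF s n]] cov_\<Gamma>[OF e, of 1] by simp
    ultimately have "col (\<gamma> e 0) \<noteq> col (\<gamma> e 1)" by simp
    then show "\<exists>u v. e \<inter> V = {u, v} \<and> col u \<noteq> col v" using edge_ends[OF e] by blast
  qed
qed

text \<open>In a tile of type \<open>Q13_24\<close> the two periods are realised by edge paths of length two along the
  boundary, and they generate the lattice.\<close>

lemma bipartite_if_handle:
  assumes t: "t \<in> T" and c: "F t (corner 4 1) = F t (corner 4 3)" "F t (corner 4 2) = F t (corner 4 4)"
    "F t (corner 4 1) \<noteq> F t (corner 4 2)"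
  shows "bipartite V E"
proof -
  have c4: "corner 4 1 = \<i>" "corner 4 2 = -1" "corner 4 3 = - \<i>" "corner 4 4 = 1"
  proof -
    have c0: "corner 4 0 = 1" by (simp add: corner4)
    show c1: "corner 4 1 = \<i>" using corner4_Suc[of 0] c0 by simp
    have "corner 4 2 = \<i> * corner 4 1" using corner4_Suc[of 1] by (simp add: numeral_eq_Suc)
    then show c2: "corner 4 2 = -1" using c1 by simp
    have "corner 4 3 = \<i> * corner 4 2" using corner4_Suc[of 2] by (simp add: numeral_eq_Suc)
    then show "corner 4 3 = - \<i>" using c2 by simp
    show "corner 4 4 = 1" using corner4_add4[of 0] c0 by simp
  qed
  have covL: "cov (L t (corner 4 j)) = F t (corner 4 j)" for j
    using cov_L[OF t, of "corner 4 j"] by simp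
  interpret handle_disc "L t"
  proof
    show "continuous_on (cball 0 1) (L t)" by (rule contL[OF t])
    show "q = q'" if "q \<in> ball 0 1" "q' \<in> cball 0 1" "cov (L t q) = cov (L t q')" for q q'
    proof -
      have "F t q = F t q'" using cov_L[OF t, of q] cov_L[OF t, of q'] that by simp
      then show ?thesis using F_eqD[OF t t that(1,2)] by simp
    qed
    show "L t (- \<i>) - L t \<i> \<in> lattice" "L t 1 - L t (-1) \<in> lattice" "cov (L t \<i>) \<noteq> cov (L t 1)"
      using covL[of 1] covL[of 2] covL[of 3] covL[of 4] c unfolding c4 by (simp_all flip: cov_eq_iff)
  qed
  have two: "lpath V E 2 (L t (corner 4 j)) (L t (corner 4 (j + 2)))" for j
  proof -
    have "lpath V E 1 (L t (corner 4 j)) (L t (corner 4 (j + 1)))"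
      "lpath V E 1 (L t (corner 4 (j + 1))) (L t (corner 4 (j + 1 + 1)))"
      using lpath_side[OF t lattice_0, of j] lpath_side[OF t lattice_0, of "j + 1"] by simp_all
    from lpath_trans[OF this(2,1)] show ?thesis by (simp add: numeral_eq_Suc)
  qed
  have "\<alpha> \<in> evens" "\<beta> \<in> evens"
  proof -
    have "lpath V E 2 (L t \<i>) (L t \<i> + \<alpha>)" "lpath V E 2 (L t (-1)) (L t (-1) + \<beta>)"
      using two[of 1] two[of 2] c4 by (simp_all add: \<alpha>_def \<beta>_def numeral_eq_Suc)
    moreover have "\<alpha> \<in> lattice" "\<beta> \<in> lattice" using A B by (simp_all add: \<alpha>_def \<beta>_def)
    ultimately show "\<alpha> \<in> evens" "\<beta> \<in> evens" using evens_if_even_lpath by simp_all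
  qed
  then have "lattice \<subseteq> evens"
    using periods_generate evens_add evens_int_mult by (metis subsetI)
  then show ?thesis by (rule bipartite_if_evens)
qed

lemma bipartite_lpath_even:
  assumes "bipartite V E" "lpath V E n z z'" "cov z' = cov z"
  shows "even n"
proof -
  obtain col where col: "\<And>e. e \<in> E \<Longrightarrow> \<exists>u v. e \<inter> V = {u, v} \<and> col u \<noteq> (col v :: bool)"
    using assms(1) unfolding bipartite_def by blast
  have "lpath V E n z z' \<Longrightarrow> (col (cov z') \<longleftrightarrow> col (cov z)) \<longleftrightarrow> even n"
  proof (induction rule: lpath.induct)
    case (step n z z' e q r)
    have ends: "cov z' = pathstart q" "cov (pathfinish r) = pathfinish q"
      using step(5)[of 0] step(5)[of 1] step(6) by (auto simp: pathstart_def pathfinish_def)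
    obtain u v where uv: "e \<inter> V = {u, v}" "col u \<noteq> col v" using col[OF step(2)] by blast
    moreover have "e \<inter> V = {pathstart q, pathfinish q}" using step(3) by (simp add: traverses_def)
    ultimately have "col (pathstart q) \<noteq> col (pathfinish q)" by (metis doubleton_eq_iff)
    then show ?case using step.IH ends by auto
  qed simp
  then show ?thesis using assms by simp
qed

text \<open>In the lifted graph some path has the same displacement \<mu> as a lift of
  \<open>a\<close>. The straight-line homotopy between the two lifts has displacement \<mu> at every
  stage, so it projects to a homotopy of loops. Bipartiteness makes the edge cycle even.\<close>

lemma even_cycle_if_bipartite:
  assumes bip: "bipartite V E" and a: "path a" "path_image a \<subseteq> torus" "pathfinish a = pathstart a"
  shows "represented_by_even_cycle torus V E a"
proof -
  have "continuous_on {0..1} a" "a ` {0..1} \<subseteq> torus" using a by (auto simp: path_def path_image_def)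
  from cov_lift[OF this convex_imp_contractible[OF convex_real_interval(5)]]
  obtain a' where a': "continuous_on {0..1} a'" "\<And>s. s \<in> {0..1} \<Longrightarrow> cov (a' s) = a s" by metis
  define \<mu> where "\<mu> = a' 1 - a' 0"
  have \<mu>: "\<mu> \<in> lattice"
    using a'(2)[of 0] a'(2)[of 1] a(3) by (simp add: \<mu>_def pathstart_def pathfinish_def flip: cov_eq_iff)
  obtain z where z: "cov z \<in> V" using vertex_lift .
  obtain n where n: "lpath V E n z (z + \<mu>)" using lifted_graph_connected[OF z, of "z + \<mu>"] z \<mu> by auto
  obtain p r where p: "edge_path V E n p" "path r" "pathstart r = z" "pathfinish r = z + \<mu>" "\<forall>s\<in>{0..1}. cov (r s) = p s"
    using edge_path_of_lpath[OF n] by blast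
  have cr: "continuous_on {0..1} r" "r 0 = z" "r 1 = z + \<mu>" using p by (auto simp: path_def pathstart_def pathfinish_def)
  have "even n" using bipartite_lpath_even[OF bip n] \<mu> by simp
  moreover have "pathfinish p = pathstart p"
    using p(5) cr \<mu> by (simp add: pathstart_def pathfinish_def) (metis atLeastAtMost_iff cov_add_lattice order_refl zero_le_one)
  moreover have "homotopic_loops torus a p"
    unfolding homotopic_loops
  proof (intro exI conjI ballI)
    let ?h = "\<lambda>x::real \<times> real. cov ((1 - fst x) *\<^sub>R a' (snd x) + fst x *\<^sub>R r (snd x))"
    have "continuous_on ({0..1} \<times> {0..1}) (\<lambda>x::real \<times> real. a' (snd x))"
      "continuous_on ({0..1} \<times> {0..1}) (\<lambda>x::real \<times> real. r (snd x))"
      by (rule continuous_on_compose2[OF a'(1)] continuous_on_compose2[OF cr(1)]; auto intro!: continuous_intros)+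
    then show "continuous_on ({0..1} \<times> {0..1}) ?h" by (intro continuous_intros)
    show "?h \<in> {0..1} \<times> {0..1} \<rightarrow> torus" by simp
    fix s :: real assume s: "s \<in> {0..1}"
    show "?h (0, s) = a s" using a'(2)[OF s] by simp
    show "?h (1, s) = p s" using p(5) s by simp
    have "(1 - s) *\<^sub>R a' 1 + s *\<^sub>R r 1 = ((1 - s) *\<^sub>R a' 0 + s *\<^sub>R r 0) + \<mu>"
    proof -
      have "r 1 = r 0 + \<mu>" "a' 1 = a' 0 + \<mu>" using cr by (simp_all add: \<mu>_def)
      then show ?thesis by (simp add: scaleR_add_right scaleR_left_diff_distrib)
    qed
    then show "pathfinish (?h \<circ> Pair s) = pathstart (?h \<circ> Pair s)"
      using \<mu> by (simp add: pathstart_def pathfinish_def)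
  qed
  ultimately show ?thesis using p(1) unfolding represented_by_even_cycle_def by blast
qed

end

section \<open>Displacements of loops on the torus\<close>

text \<open>For a loop this is its class in the fundamental group, read as a deck transformation.
  The starting point of the lift is left open; by \<open>displacement_unique\<close> it does not
  matter.\<close>

definition displacement :: "(real \<Rightarrow> complex \<times> complex) \<Rightarrow> complex \<Rightarrow> bool" where
  "displacement p \<mu> \<longleftrightarrow> (\<exists>r. continuous_on {0..1} r \<and> (\<forall>s\<in>{0..1}. cov (r s) = p s) \<and> r 1 - r 0 = \<mu>)"

lemma displacement_unique:
  assumes "displacement p \<mu>" "displacement p \<nu>" shows "\<mu> = \<nu>"
proof -
  obtain r r' where r: "continuous_on {0..1} r" "\<And>s. s \<in> {0..1} \<Longrightarrow> cov (r s) = p s" "r 1 - r 0 = \<mu>"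
    and r': "continuous_on {0..1} r'" "\<And>s. s \<in> {0..1} \<Longrightarrow> cov (r' s) = p s" "r' 1 - r' 0 = \<nu>"
    using assms unfolding displacement_def by blast
  obtain c where "\<And>x. x \<in> {0..1::real} \<Longrightarrow> r x = r' x + c"
    by (rule lifts_differ_by_lattice[of "{0..1::real}" r r']) (use r r' in auto)
  from this[of 0] this[of 1] show ?thesis using r(3) r'(3) by simp
qed

lemma displacement_exists:
  assumes "path p" "path_image p \<subseteq> torus" "pathfinish p = pathstart p"
  obtains \<mu> where "\<mu> \<in> lattice" "displacement p \<mu>"
proof -
  have "continuous_on {0..1} p" "p ` {0..1} \<subseteq> torus" using assms by (auto simp: path_def path_image_def)
  from cov_lift[OF this convex_imp_contractible[OF convex_real_interval(5)]]
  obtain r where r: "continuous_on {0..1} r" "\<And>s. s \<in> {0..1} \<Longrightarrow> cov (r s) = p s" by metis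
  have "r 1 - r 0 \<in> lattice"
    using r(2)[of 0] r(2)[of 1] assms(3) by (simp add: pathstart_def pathfinish_def flip: cov_eq_iff)
  then show ?thesis using that r unfolding displacement_def by blast
qed

text \<open>The homotopy lifts as a map of the square. The displacement of its stages is continuous
  and lattice-valued, hence constant, although the base point may move.\<close>

lemma displacement_homotopic:
  assumes hom: "homotopic_loops torus p q" and q: "displacement q \<mu>"
  shows "displacement p \<mu>"
proof -
  obtain h where h: "continuous_on ({0..1::real} \<times> {0..1::real}) h" "h \<in> ({0..1} \<times> {0..1}) \<rightarrow> torus"
    "\<forall>x\<in>{0..1}. h (0, x) = p x" "\<forall>x\<in>{0..1}. h (1, x) = q x"
    "\<forall>t\<in>{0..1}. pathfinish (h \<circ> Pair t) = pathstart (h \<circ> Pair t)"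
    using hom unfolding homotopic_loops by blast
  have "h ` ({0..1} \<times> {0..1}) \<subseteq> torus" using h(2) by blast
  from cov_lift[OF h(1) this convex_imp_contractible[OF convex_Times]]
  obtain H where H: "continuous_on ({0..1} \<times> {0..1}) H" "\<And>x. x \<in> {0..1} \<times> {0..1} \<Longrightarrow> cov (H x) = h x"
    by (metis convex_real_interval(5))
  have cont: "continuous_on {0..1} (\<lambda>s. H (u, s))" "continuous_on {0..1} (\<lambda>s. H (s, u))" if "u \<in> {0..1}" for u
    by (rule continuous_on_compose2[OF H(1)]; use that in \<open>auto intro!: continuous_intros\<close>)+
  have d: "displacement p (H (0, 1) - H (0, 0))" "displacement q (H (1, 1) - H (1, 0))"
    unfolding displacement_def
    using cont(1)[of 0] cont(1)[of 1] H(2) h(3,4)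
    by (intro exI[of _ "\<lambda>s. H (0, s)"], force, intro exI[of _ "\<lambda>s. H (1, s)"], force)
  have "H (0, 1) - H (0, 0) = H (1, 1) - H (1, 0)"
  proof (rule lattice_valued_constant[of "{0..1::real}" "\<lambda>u. H (u, 1) - H (u, 0)" 0 1])
    show "continuous_on {0..1} (\<lambda>u. H (u, 1) - H (u, 0))" by (intro continuous_intros cont) auto
    show "H (u, 1) - H (u, 0) \<in> lattice" if "u \<in> {0..1}" for u
      using H(2)[of "(u, 1)"] H(2)[of "(u, 0)"] h(5) that by (simp add: pathstart_def pathfinish_def flip: cov_eq_iff)
  qed auto
  then show ?thesis using d displacement_unique[OF q d(2)] by simp
qed

lemma displacement_reversepath: "displacement p \<mu> \<Longrightarrow> displacement (reversepath p) (- \<mu>)"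
proof -
  assume "displacement p \<mu>"
  then obtain r where r: "continuous_on {0..1} r" "\<And>s. s \<in> {0..1} \<Longrightarrow> cov (r s) = p s" "r 1 - r 0 = \<mu>"
    unfolding displacement_def by blast
  have "continuous_on {0..1} (\<lambda>s. r (1 - s))"
    by (rule continuous_on_compose2[OF r(1)]) (auto intro!: continuous_intros)
  then show ?thesis
    unfolding displacement_def using r by (intro exI[of _ "\<lambda>s. r (1 - s)"]) (auto simp: reversepath_def)
qed

lemma displacement_join:
  assumes "displacement p \<mu>" "displacement q \<nu>" "pathfinish p = pathstart q"
  shows "displacement (p +++ q) (\<mu> + \<nu>)"
proof -
  obtain r r' where r: "continuous_on {0..1} r" "\<And>s. s \<in> {0..1} \<Longrightarrow> cov (r s) = p s" "r 1 - r 0 = \<mu>"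
    and r': "continuous_on {0..1} r'" "\<And>s. s \<in> {0..1} \<Longrightarrow> cov (r' s) = q s" "r' 1 - r' 0 = \<nu>"
    using assms unfolding displacement_def by blast
  define c where "c = r 1 - r' 0"
  have c: "c \<in> lattice"
    using r(2)[of 1] r'(2)[of 0] assms(3) by (simp add: c_def pathstart_def pathfinish_def flip: cov_eq_iff)
  define g where "g = r +++ (\<lambda>s. r' s + c)"
  have "path (\<lambda>s. r' s + c)" "path r" using r r' by (auto simp: path_def intro!: continuous_intros)
  then have "path g" unfolding g_def by (intro path_join_imp) (auto simp: c_def pathstart_def pathfinish_def)
  moreover have "cov (g s) = (p +++ q) s" if "s \<in> {0..1}" for s
    using r(2)[of "2 * s"] r'(2)[of "2 * s - 1"] c that by (auto simp: g_def joinpaths_def)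
  moreover have "g 1 - g 0 = \<mu> + \<nu>" using r(3) r'(3) by (simp add: g_def joinpaths_def c_def algebra_simps)
  ultimately show ?thesis unfolding displacement_def path_def by blast
qed

text \<open>\<open>H\<close> plays the role of a subgroup containing the displacements of the
  generators. The induction also carries along that \<open>p\<close> is a loop at \<open>x\<close>,
  which is what lets products be lifted.\<close>

lemma generated_loop_displacement:
  assumes ab: "loop_at torus x a" "loop_at torus x b" and H: "\<And>\<mu>. displacement a \<mu> \<or> displacement b \<mu> \<Longrightarrow> \<mu> \<in> H"
    "\<And>\<mu> \<nu>. \<mu> \<in> H \<Longrightarrow> \<nu> \<in> H \<Longrightarrow> \<mu> + \<nu> \<in> H" "\<And>\<mu>. \<mu> \<in> H \<Longrightarrow> - \<mu> \<in> H"
  shows "generated_loop torus {a, b} p \<Longrightarrow> loop_at torus x p \<and> (\<exists>\<mu>\<in>H. displacement p \<mu>)"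
proof (induction rule: generated_loop.induct)
  case (generator g)
  then have "loop_at torus x g" using ab by auto
  moreover obtain \<mu> where "displacement g \<mu>"
    using displacement_exists[of g] calculation by (auto simp: loop_at_def)
  ultimately show ?case using generator H(1) by blast
next
  case (inverse p)
  then show ?case using displacement_reversepath H(3) by (fastforce simp: loop_at_def)
next
  case (product p q)
  then obtain \<mu> \<nu> where "\<mu> \<in> H" "displacement p \<mu>" "\<nu> \<in> H" "displacement q \<nu>" by blast
  then have "displacement (p +++ q) (\<mu> + \<nu>)" "\<mu> + \<nu> \<in> H"
    using product displacement_join H(2) by (auto simp: loop_at_def)
  then show ?case using product by (auto simp: loop_at_def path_image_join)
next
  case (homotopic p q)
  then have p: "loop_at torus x p" and hp: "homotopic_paths torus p q" by blast+
  have ends: "pathstart p = pathstart q" "pathfinish p = pathfinish q"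
    using homotopic_paths_imp_pathstart[OF hp] homotopic_paths_imp_pathfinish[OF hp] .
  have q: "loop_at torus x q"
    using homotopic_paths_imp_path[OF hp] homotopic_paths_imp_subset[OF hp] ends p
    unfolding loop_at_def by simp
  have "homotopic_loops torus q p"
    by (rule homotopic_paths_imp_homotopic_loops[OF homotopic_paths_sym[OF hp]])
      (use p q in \<open>simp_all add: loop_at_def\<close>)
  then show ?case using q homotopic.IH displacement_homotopic by blast
qed

text \<open>The lattice vectors of even parity are closed under sums and negatives and contain the
  displacements of both generators, hence those of all loops at \<open>x\<close>.\<close>

lemma bipartite_if_even_generators:
  assumes "lifted_tiling V E F \<gamma> \<Gamma> L ed sg hh lam"
    and gen: "generate_pi1 torus a b"
    and even: "represented_by_even_cycle torus V E a" "represented_by_even_cycle torus V E b"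
  shows "bipartite V E"
proof -
  interpret lifted_tiling V E F \<gamma> \<Gamma> L ed sg hh lam by fact
  obtain x where x: "loop_at torus x a" "loop_at torus x b" "\<And>p. loop_at torus x p \<Longrightarrow> generated_loop torus {a, b} p"
    using gen unfolding generate_pi1_def by blast
  have ev: "\<mu> \<in> evens" if c: "represented_by_even_cycle torus V E c" and \<mu>: "displacement c \<mu>" for c \<mu>
  proof -
    obtain n p where p: "even n" "edge_path V E n p" "pathfinish p = pathstart p" "homotopic_loops torus c p"
      using c unfolding represented_by_even_cycle_def by blast
    obtain r where r: "path r" "\<forall>s\<in>{0..1}. cov (r s) = p s" "lpath V E n (pathstart r) (pathfinish r)"
      using lpath_of_edge_path[OF V_torus E_torus p(2)] by blast
    have "displacement p (r 1 - r 0)" using r unfolding displacement_def path_def by blast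
    then have "displacement c (r 1 - r 0)" by (rule displacement_homotopic[OF p(4)])
    then have m: "\<mu> = r 1 - r 0" by (rule displacement_unique[OF \<mu>])
    have "\<mu> \<in> lattice" using r(2) p(3) unfolding m cov_eq_iff[symmetric] by (simp add: pathstart_def pathfinish_def)
    moreover have "lpath V E n (r 0) (r 0 + \<mu>)" using r(3) by (simp add: m pathstart_def pathfinish_def)
    ultimately show ?thesis using p(1) evens_if_even_lpath by blast
  qed
  have "\<mu> \<in> evens" if \<mu>: "\<mu> \<in> lattice" for \<mu>
  proof -
    have "x \<in> torus" using x(1) by (auto simp: loop_at_def pathstart_def path_image_def)
    then obtain y where y: "cov y = x" using cov_surj by blast
    \<comment> \<open>Every lattice vector is the displacement of a loop at \<open>x\<close>, namely
      of a projected straight segment.\<close>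
    define p where "p s = cov (y + s *\<^sub>R \<mu>)" for s :: real
    have "continuous_on {0..1} p" unfolding p_def by (intro continuous_intros)
    then have "loop_at torus x p" using y \<mu> by (auto simp: loop_at_def path_def path_image_def pathstart_def pathfinish_def p_def)
    then have "generated_loop torus {a, b} p" by (rule x(3))
    then obtain \<nu> where \<nu>: "\<nu> \<in> evens" "displacement p \<nu>"
      using generated_loop_displacement[OF x(1,2), of evens p] ev even evens_add evens_uminus by blast
    have "displacement p \<mu>"
      unfolding displacement_def p_def by (intro exI[of _ "\<lambda>s. y + s *\<^sub>R \<mu>"]) (auto intro!: continuous_intros)
    then show ?thesis using \<nu> displacement_unique by blast
  qed
  then show ?thesis by (intro bipartite_if_evens) blast
qed

lemma bipartite_if_tile_Q13_24:
  assumes "quadrilateral_tiling torus V E" "t \<in> tiles torus V E" "tile_Q13_24 V E t"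
  shows "bipartite V E"
proof -
  obtain f where f: "polygon_map V E t 4 f" "corner_identifications f = {(1, 3), (2, 4)}"
    using assms(3) unfolding tile_of_type_def by blast
  have "\<forall>u\<in>tiles torus V E. \<exists>g. polygon_map V E u 4 g"
    using assms(1) by (simp add: quadrilateral_tiling_def)
  then obtain F0 where F0: "\<And>u. u \<in> tiles torus V E \<Longrightarrow> polygon_map V E u 4 (F0 u)" by metis
  \<comment> \<open>The tile in question gets the labelling that exhibits its type; the other tiles
    keep arbitrary polygon maps.\<close>
  define F where "F = F0(t := f)"
  have F: "polygon_map V E u 4 (F u)" if "u \<in> tiles torus V E" for u
    using F0[OF that] f(1) by (simp add: F_def)
  obtain \<gamma> \<Gamma> L ed sg hh lam where "lifted_tiling V E F \<gamma> \<Gamma> L ed sg hh lam"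
    using lifted_tiling_exists[OF assms(1), of F] F by blast
  then interpret lifted_tiling V E F \<gamma> \<Gamma> L ed sg hh lam .
  have "(1, 3) \<in> corner_identifications f" "(2, 4) \<in> corner_identifications f" "(1, 2) \<notin> corner_identifications f"
    unfolding f(2) by auto
  then have "f (corner 4 1) = f (corner 4 3)" "f (corner 4 2) = f (corner 4 4)" "f (corner 4 1) \<noteq> f (corner 4 2)"
    by (auto simp: corner_identifications_def)
  then show ?thesis using bipartite_if_handle[OF assms(2)] by (simp add: F_def)
qed

theorem theorem2p6:
  fixes V :: "(complex \<times> complex) set" and E :: "(complex \<times> complex) set set"
  assumes "quadrilateral_tiling torus V E"
  shows "(subdivisible torus V E \<longrightarrow>
            (\<forall>t\<in>tiles torus V E. tile_Q V E t \<or> tile_Q13 V E t \<or> tile_Q13_24 V E t)) \<and>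
         (\<forall>a b. generate_pi1 torus a b \<longrightarrow>
            (subdivisible torus V E \<longleftrightarrow>
               ((\<forall>t\<in>tiles torus V E. tile_Q V E t \<or> tile_Q13 V E t) \<and>
                represented_by_even_cycle torus V E a \<and> represented_by_even_cycle torus V E b) \<or>
               (\<exists>t\<in>tiles torus V E. tile_Q13_24 V E t)))"
proof -
  have "\<forall>u\<in>tiles torus V E. \<exists>g. polygon_map V E u 4 g"
    using assms by (simp add: quadrilateral_tiling_def)
  then obtain F where F: "\<And>u. u \<in> tiles torus V E \<Longrightarrow> polygon_map V E u 4 (F u)" by metis
  obtain \<gamma> \<Gamma> L ed sg hh lam where lt: "lifted_tiling V E F \<gamma> \<Gamma> L ed sg hh lam"
    using lifted_tiling_exists[OF assms, of F] F by blast
  then interpret lifted_tiling V E F \<gamma> \<Gamma> L ed sg hh lam .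
  have sub: "subdivisible torus V E \<longleftrightarrow> bipartite V E"
    using bipartite_if_subdivisible[OF assms] subdivisible_if_bipartite by blast
  have cyc: "represented_by_even_cycle torus V E a \<and> represented_by_even_cycle torus V E b"
    if bip: "bipartite V E" and gen: "generate_pi1 torus a b" for a b
  proof -
    obtain x where "loop_at torus x a" "loop_at torus x b" using gen unfolding generate_pi1_def by blast
    then show ?thesis using even_cycle_if_bipartite[OF bip] by (simp add: loop_at_def)
  qed
  \<comment> \<open>A bipartite tiling either has a tile of type \<open>Q13_24\<close> or, by the
    list of types, consists of \<open>Q\<close> and \<open>Q13\<close> only; in the latter case
    \<open>cyc\<close> supplies the even cycles.\<close>
  show ?thesis
    unfolding sub
    using bipartite_tile_types bipartite_if_even_generators[OF lt] bipartite_if_tile_Q13_24[OF assms] cyc by blast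
qed

end
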